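(* Let $0<\alpha\le2$, $0<H<1$, and let $\{\Lambda_{\alpha,H}(t),t\ge0\}$ be a linear fractional stable motion with local time $L(t,x)$. Let $\beta_n$, $n\ge1$, be constants with $\beta_n\to\infty$ and $n^{-1}\beta_n\to0$. Suppose that $f:\mathbb{R}\to\mathbb{R}$ is such that $f$ and $f^2$ are Lebesgue integrable. Then, for each $t\ge 0$ and each $x\in\mathbb{R}$, $$\frac{\beta_n}{n}\sum_{k=1}^{[nt]} f\left(\beta_n\left(\Lambda_{\alpha,H}\left(\tfrac{k}{n}\right)-x\right)\right)\to\left(\int_{-\infty}^\infty f(y)\,dy\right)L(t,x)\qquad\text{in }\mathbf{L}^2$$ as $n\to\infty$.
   Context: An $\alpha$-stable Lévy motion $\{Z_\alpha(t),t\in\mathbb{R}\}$, $0<\alpha\le2$, has stationary independent increments, and for $s<t$, $Z_\alpha(t)-Z_\alpha(s)$ has characteristic function $\exp\{-(t-s)|u|^\alpha(1+i\beta\,\mathrm{sign}(u)\tan(\pi\alpha/2))\}$, $|\beta|\le1$, with $\beta=0$ when $\alpha=1$. For $0<H<1$, $H\neq1/\alpha$, a linear fractional stable motion (LFSM) is $$\Lambda_{\alpha,H}(t)=a\int_{-\infty}^0\{(t-u)^{H-1/\alpha}-(-u)^{H-1/\alpha}\}Z_\alpha(du)+a\int_0^t(t-u)^{H-1/\alpha}Z_\alpha(du),\quad t\ge0,$$ with $a$ a nonzero constant; for $H=1/\alpha$ (which forces $1<\alpha\le2$), by convention the LFSM is $\{Z_\alpha(t),t\ge0\}$. The LFSM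 is taken to be a measurable process. A local time of $\Lambda_{\alpha,H}$ is a measurable process $\{L(t,x),t\ge0,x\in\mathbb{R}\}$ such that for each $t\ge 0$, with probability one, $\int_0^t\mathbb{I}_A(\Lambda_{\alpha,H}(s))\,ds=\int_{-\infty}^\infty\mathbb{I}_A(x)L(t,x)\,dx$ for all Borel $A\subset\mathbb{R}$. The version used here is the one for which, for each $t$ and $x$, $L(t,x)=\lim_{\eta\downarrow0}\eta^{-1}\int_0^t\mathbb{I}_{[x,x+\eta)}(\Lambda_{\alpha,H}(s))\,ds$ in $\mathbf{L}^2$. Convergence in $\mathbf{L}^2$ is mean-square convergence; $[\cdot]$ is the integer part. *)

theory Defs
  imports "HOL-Probability.Probability"
begin

text \<open>
  For a Lebesgue measurable \<open>f\<close> and a random variable \<open>X\<close> with a density, \<open>f (X \<omega>)\<close> is in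
  general measurable only with respect to the completion of the probability space; the notions
  below are then used with \<open>completion M\<close>, which leaves a complete \<open>M\<close> unchanged.
\<close>

definition L2_rv :: "'w measure \<Rightarrow> ('w \<Rightarrow> real) \<Rightarrow> bool" where
  "L2_rv M X \<longleftrightarrow> X \<in> borel_measurable M \<and> integrable M (\<lambda>\<omega>. (X \<omega>)\<^sup>2)"

definition L2_tendsto ::
    "'w measure \<Rightarrow> ('i \<Rightarrow> 'w \<Rightarrow> real) \<Rightarrow> ('w \<Rightarrow> real) \<Rightarrow> 'i filter \<Rightarrow> bool" where
  "L2_tendsto M X Y F \<longleftrightarrow>
     (\<forall>\<^sub>F i in F. L2_rv M (X i)) \<and> L2_rv M Y \<and>
     ((\<lambda>i. \<integral>\<omega>. (X i \<omega> - Y \<omega>)\<^sup>2 \<partial>M) \<longlongrightarrow> 0) F"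

definition tendsto_in_prob ::
    "'w measure \<Rightarrow> (nat \<Rightarrow> 'w \<Rightarrow> real) \<Rightarrow> ('w \<Rightarrow> real) \<Rightarrow> bool" where
  "tendsto_in_prob M X Y \<longleftrightarrow>
     (\<forall>n. X n \<in> borel_measurable M) \<and> Y \<in> borel_measurable M \<and>
     (\<forall>\<epsilon>>0. (\<lambda>n. measure M {\<omega> \<in> space M. \<bar>X n \<omega> - Y \<omega>\<bar> > \<epsilon>}) \<longlonglongrightarrow> 0)"

definition independent_increments :: "'w measure \<Rightarrow> (real \<Rightarrow> 'w \<Rightarrow> real) \<Rightarrow> bool" where
  "independent_increments M Z \<longleftrightarrow>
     (\<forall>n (\<tau> :: nat \<Rightarrow> real). strict_mono \<tau> \<longrightarrow>
        prob_space.indep_vars M (\<lambda>_. borel) (\<lambda>i \<omega>. Z (\<tau> (Suc i)) \<omega> - Z (\<tau> i) \<omega>) {..<n})"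

definition stationary_increments :: "'w measure \<Rightarrow> (real \<Rightarrow> 'w \<Rightarrow> real) \<Rightarrow> bool" where
  "stationary_increments M Z \<longleftrightarrow>
     (\<forall>s t h. s < t \<longrightarrow>
        distr M borel (\<lambda>\<omega>. Z (t + h) \<omega> - Z (s + h) \<omega>) = distr M borel (\<lambda>\<omega>. Z t \<omega> - Z s \<omega>))"

text \<open>
  Two-sided stable Levy motion on the time axis \<open>\<real>\<close> with skewness \<open>b\<close>, started at \<open>0\<close>.
  At \<open>\<alpha> = 1\<close> the factor \<open>tan (pi / 2)\<close> (which is \<open>0\<close> in HOL) is multiplied by \<open>b = 0\<close>.
\<close>

definition stable_levy_motion ::
    "'w measure \<Rightarrow> real \<Rightarrow> real \<Rightarrow> (real \<Rightarrow> 'w \<Rightarrow> real) \<Rightarrow> bool" where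
  "stable_levy_motion M \<alpha> b Z \<longleftrightarrow>
     prob_space M \<and> 0 < \<alpha> \<and> \<alpha> \<le> 2 \<and> \<bar>b\<bar> \<le> 1 \<and> (\<alpha> = 1 \<longrightarrow> b = 0) \<and>
     (\<forall>t. Z t \<in> borel_measurable M) \<and>
     (AE \<omega> in M. Z 0 \<omega> = 0) \<and>
     independent_increments M Z \<and>
     stationary_increments M Z \<and>
     (\<forall>s t u. s < t \<longrightarrow>
        char (distr M borel (\<lambda>\<omega>. Z t \<omega> - Z s \<omega>)) u =
          exp (- (complex_of_real ((t - s) * \<bar>u\<bar> powr \<alpha>) *
                  (1 + \<i> * complex_of_real (b * sgn u * tan (pi * \<alpha> / 2))))))"

text \<open>
  Integrals of deterministic functions against \<open>Z\<close>. A step function is given by a list of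
  triples \<open>(c, s, t)\<close> with \<open>s \<le> t\<close>, standing for \<open>c\<close> times the indicator of the interval
  from \<open>s\<close> (excluded) to \<open>t\<close> (included). The integral of a general \<open>g\<close> with
  \<open>\<integral> \<bar>g\<bar>\<^sup>\<alpha> < \<infinity>\<close> is the limit in probability of the integrals of step functions that
  converge to \<open>g\<close> in the \<open>\<alpha>\<close>-th mean; it is determined up to null sets and does not depend
  on the approximating sequence.
\<close>

definition valid_steps :: "(real \<times> real \<times> real) list \<Rightarrow> bool" where
  "valid_steps p \<longleftrightarrow> (\<forall>(c, s, t) \<in> set p. s \<le> t)"

definition step_fun :: "(real \<times> real \<times> real) list \<Rightarrow> real \<Rightarrow> real" where
  "step_fun p u = (\<Sum>(c, s, t) \<leftarrow> p. c * indicator {s<..t} u)"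

definition step_integral ::
    "(real \<Rightarrow> 'w \<Rightarrow> real) \<Rightarrow> (real \<times> real \<times> real) list \<Rightarrow> 'w \<Rightarrow> real" where
  "step_integral Z p \<omega> = (\<Sum>(c, s, t) \<leftarrow> p. c * (Z t \<omega> - Z s \<omega>))"

definition has_stable_integral ::
    "'w measure \<Rightarrow> real \<Rightarrow> (real \<Rightarrow> 'w \<Rightarrow> real) \<Rightarrow> (real \<Rightarrow> real) \<Rightarrow> ('w \<Rightarrow> real) \<Rightarrow> bool" where
  "has_stable_integral M \<alpha> Z g Y \<longleftrightarrow>
     g \<in> borel_measurable borel \<and> integrable lborel (\<lambda>u. \<bar>g u\<bar> powr \<alpha>) \<and>
     (\<exists>p. (\<forall>n. valid_steps (p n)) \<and>
          (\<lambda>n. \<integral>u. \<bar>step_fun (p n) u - g u\<bar> powr \<alpha> \<partial>lborel) \<longlonglongrightarrow> 0 \<and>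
          tendsto_in_prob M (\<lambda>n. step_integral Z (p n)) Y)"

text \<open>
  Linear fractional stable motion with driving motion \<open>Z\<close>. Stochastic integrals are only
  defined almost surely, so the representation is required almost surely for each \<open>t\<close>.
\<close>

definition lfsm_representation ::
    "'w measure \<Rightarrow> real \<Rightarrow> real \<Rightarrow> real \<Rightarrow> (real \<Rightarrow> 'w \<Rightarrow> real) \<Rightarrow> (real \<Rightarrow> 'w \<Rightarrow> real) \<Rightarrow> bool" where
  "lfsm_representation M \<alpha> H a Z X \<longleftrightarrow>
     (\<forall>t\<ge>0. \<exists>Y1 Y2.
        has_stable_integral M \<alpha> Z
          (\<lambda>u. indicator {..<0} u * ((t - u) powr (H - 1 / \<alpha>) - (- u) powr (H - 1 / \<alpha>))) Y1 \<and>
        has_stable_integral M \<alpha> Z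
          (\<lambda>u. indicator {0..<t} u * (t - u) powr (H - 1 / \<alpha>)) Y2 \<and>
        (AE \<omega> in M. X t \<omega> = a * Y1 \<omega> + a * Y2 \<omega>))"

definition lfsm ::
    "'w measure \<Rightarrow> real \<Rightarrow> real \<Rightarrow> (real \<Rightarrow> 'w \<Rightarrow> real) \<Rightarrow> bool" where
  "lfsm M \<alpha> H X \<longleftrightarrow>
     (\<lambda>(t, \<omega>). X t \<omega>) \<in> borel_measurable (restrict_space borel {0..} \<Otimes>\<^sub>M M) \<and>
     (\<exists>b Z. stable_levy_motion M \<alpha> b Z \<and>
        (if H = 1 / \<alpha> then \<forall>t\<ge>0. AE \<omega> in M. X t \<omega> = Z t \<omega>
         else \<exists>a. a \<noteq> 0 \<and> lfsm_representation M \<alpha> H a Z X))"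

text \<open>
  The occupation-density identity determines \<open>L t x\<close> only for almost every \<open>x\<close>; the last
  conjunct selects the version for which \<open>L t x\<close> is meaningful for every \<open>x\<close>.
\<close>

definition local_time ::
    "'w measure \<Rightarrow> (real \<Rightarrow> 'w \<Rightarrow> real) \<Rightarrow> (real \<Rightarrow> real \<Rightarrow> 'w \<Rightarrow> real) \<Rightarrow> bool" where
  "local_time M X L \<longleftrightarrow>
     (\<lambda>((t, x), \<omega>). L t x \<omega>)
        \<in> borel_measurable ((restrict_space borel {0..} \<Otimes>\<^sub>M borel) \<Otimes>\<^sub>M M) \<and>
     (\<forall>t\<ge>0. AE \<omega> in M. \<forall>A \<in> sets borel.
        has_bochner_integral lborel (\<lambda>x. indicator A x * L t x \<omega>)
          (LINT s:{0..t}|lborel. indicator A (X s \<omega>))) \<and>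
     (\<forall>t\<ge>0. \<forall>x.
        L2_tendsto M
          (\<lambda>\<eta> \<omega>. (1 / \<eta>) * (LINT s:{0..t}|lborel. indicator {x..<x + \<eta>} (X s \<omega>)))
          (L t x) (at_right 0))"

end

theory Submission
  imports Defs
begin

text \<open>
  The joint law of two values of the process is controlled through Fourier inversion. For
  \<open>0 < s < r\<close> the scaling and the stationarity of the moving average kernel give
  \<open>|E exp (i (l X s + m X r))| \<le> exp (- \<kappa> (s\<^sup>\<alpha>\<^sup>H |l + m|\<^sup>\<alpha> + (r - s)\<^sup>\<alpha>\<^sup>H |m|\<^sup>\<alpha>))\<close>,
  so \<open>(X s, X r)\<close> has a density bounded by a multiple of \<open>s\<^sup>-\<^sup>H (r - s)\<^sup>-\<^sup>H\<close>, which is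
  integrable over \<open>s, r\<close>, and which depends continuously on \<open>(s, r)\<close>. Take the difference
  of the Riemann sum and \<open>\<integral>f\<close> times the occupation average over \<open>[x, x + 1 / \<surd>n)\<close>. It is a
  time integral whose second moment is a double integral of covariances. Away from the
  diagonal \<open>s = r\<close> these converge to a multiple of \<open>\<integral>f - \<integral>f = 0\<close> and are dominated; on the strip
  \<open>|s - r| \<le> 2 / n\<close> they are of order \<open>\<beta>\<^sub>n + \<surd>n\<close>, which is negligible because the strip has area
  \<open>O(1 / n)\<close> and \<open>\<beta>\<^sub>n / n \<rightarrow> 0\<close>. The occupation averages converge to the local time by its
  definition.
\<close>

section \<open>Stable integrals\<close>

text \<open>The obstacle is that \<open>f\<close> is merely in L^1 and L^2: it may be unbounded and
  nowhere continuous, so its values along the path cannot be compared at nearby times. All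
  regularity is therefore taken from the joint laws and none from \<open>f\<close>. To this end the
  occupation average is treated as a second function of the same kind,
  \<open>indicator {0..<1}\<close> at the scale \<open>sqrt n\<close>; the error becomes a sum of
  two pieces with total mass 0, and any scale tending to infinity more slowly than n would serve in
  place of \<open>sqrt n\<close>. Nondeterminism comes from causality: on u > s the kernel of time s
  vanishes, so that part of the noise enters \<open>X r\<close> alone. The bound concerns the
  modulus of the characteristic function, where the skewness of the noise disappears. For \<alpha>
  \<le> 1 even first moments are missing, so continuity in time is measured through bounded
  exponentials. Since a stable integral is given only as a limit in probability along some
  approximating sequence, the bounds lose a factor 4, which merely alters \<kappa> and
  \<open>C\<close>. The condition H < 1 makes \<open>s powr (- H)\<close> integrable at 0.\<close>

lemma abs_add_powr_le:
  fixes x y \<alpha> :: real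
  assumes "0 < \<alpha>" "\<alpha> \<le> 2"
  shows "\<bar>x + y\<bar> powr \<alpha> \<le> 4 * (\<bar>x\<bar> powr \<alpha> + \<bar>y\<bar> powr \<alpha>)"
proof -
  let ?m = "max \<bar>x\<bar> \<bar>y\<bar>"
  have "\<bar>x + y\<bar> powr \<alpha> \<le> (2 * ?m) powr \<alpha>"
    using assms by (intro powr_mono2) auto
  also have "\<dots> = 2 powr \<alpha> * ?m powr \<alpha>" by (simp add: powr_mult)
  \<comment> \<open>The largest admissible \<alpha> is 2, so one constant 4 serves the whole range.
    For \<alpha> < 1 the integral of |g|^\<alpha> is not a power of a norm; sums are therefore split
    by this inequality and not by Minkowski's.\<close>
  also have "\<dots> \<le> 2 powr 2 * ?m powr \<alpha>"
    using assms by (intro mult_right_mono powr_mono) auto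
  also have "\<dots> = 4 * ?m powr \<alpha>" by simp
  also have "?m powr \<alpha> \<le> \<bar>x\<bar> powr \<alpha> + \<bar>y\<bar> powr \<alpha>" by (simp add: max_def)
  finally show ?thesis by simp
qed

text \<open>\<open>independent_increments\<close> speaks about strictly increasing sequences indexed
  by all natural numbers, so a finite set of endpoints has to be continued to an infinite sequence.
  Beyond the last endpoint it runs in unit steps above a bound \<open>B\<close> of the set.\<close>

lemma ex_strict_mono_grid:
  fixes T :: "real set"
  assumes "finite T"
  shows "\<exists>\<tau> :: nat \<Rightarrow> real. \<exists>m. strict_mono \<tau> \<and> T \<subseteq> \<tau> ` {..m}"
proof -
  define xs where "xs = sorted_list_of_set T"
  have xs: "set xs = T" "sorted xs" "distinct xs" using assms by (auto simp: xs_def)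
  define B where "B = Max (insert 0 T) + 1"
  have B: "x < B" if "x \<in> T" for x
  proof -
    have "x \<le> Max (insert 0 T)" using assms that by (intro Max_ge) auto
    then show ?thesis by (simp only: B_def)
  qed
  define \<tau> where "\<tau> i = (if i < length xs then xs ! i else B + real i)" for i
  have "\<tau> i < \<tau> (Suc i)" for i
  proof (cases "Suc i < length xs")
    case True
    then show ?thesis using xs(2,3) by (simp add: \<tau>_def sorted_nth_mono nth_eq_iff_index_eq less_le)
  next
    case False
    then show ?thesis
    proof (cases "i < length xs")
      case True
      then have "xs ! i \<in> T" using xs(1) by auto
      then have "xs ! i < B" by (rule B)
      with True False show ?thesis by (simp add: \<tau>_def)
    qed (simp add: \<tau>_def)
  qed
  then have "strict_mono \<tau>" by (simp add: strict_mono_Suc_iff)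
  moreover have "T \<subseteq> \<tau> ` {..length xs}"
  proof
    fix x assume "x \<in> T"
    then obtain i where "i < length xs" "xs ! i = x" using xs(1) by (metis in_set_conv_nth)
    then show "x \<in> \<tau> ` {..length xs}" by (intro image_eqI[of _ _ i]) (auto simp: \<tau>_def)
  qed
  ultimately show ?thesis by blast
qed

text \<open>The height of the step function on the cell from \<tau> j (excluded) to \<tau> (j + 1)
  (included), provided that all endpoints are grid points: such a cell lies in
  \<open>{s<..t}\<close> exactly if its left end lies in \<open>{s..<t}\<close>.\<close>

definition grid_coeff :: "(nat \<Rightarrow> real) \<Rightarrow> (real \<times> real \<times> real) list \<Rightarrow> nat \<Rightarrow> real" where
  "grid_coeff \<tau> p j = (\<Sum>(c, s, t) \<leftarrow> p. if s \<le> \<tau> j \<and> \<tau> j < t then c else 0)"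

lemma step_integral_grid:
  assumes "strict_mono \<tau>" "valid_steps p"
    and "\<And>c s t. (c, s, t) \<in> set p \<Longrightarrow> s \<in> \<tau> ` {..m} \<and> t \<in> \<tau> ` {..m}"
  shows "step_integral Z p \<omega> = (\<Sum>j<m. grid_coeff \<tau> p j * (Z (\<tau> (Suc j)) \<omega> - Z (\<tau> j) \<omega>))"
  using assms(2,3)
proof (induction p)
  case Nil
  then show ?case by (simp add: step_integral_def grid_coeff_def)
next
  case (Cons q p)
  obtain c s t where q: "q = (c, s, t)" by (cases q)
  have "s \<in> \<tau> ` {..m} \<and> t \<in> \<tau> ` {..m}" using Cons.prems(2)[of c s t] q by auto
  then obtain i k where ik: "s = \<tau> i" "t = \<tau> k" "i \<le> m" "k \<le> m" by auto
  have "s \<le> t" using Cons.prems(1) q by (auto simp: valid_steps_def)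
  then have "i \<le> k" using ik assms(1) by (simp add: strict_mono_less_eq)
  have IH: "step_integral Z p \<omega> = (\<Sum>j<m. grid_coeff \<tau> p j * (Z (\<tau> (Suc j)) \<omega> - Z (\<tau> j) \<omega>))"
    using Cons.prems by (intro Cons.IH) (auto simp: valid_steps_def)
  have "(\<Sum>j<m. (if s \<le> \<tau> j \<and> \<tau> j < t then c else 0) * (Z (\<tau> (Suc j)) \<omega> - Z (\<tau> j) \<omega>))
      = (\<Sum>j\<in>{i..<k}. c * (Z (\<tau> (Suc j)) \<omega> - Z (\<tau> j) \<omega>))"
    using ik assms(1) by (intro sum.mono_neutral_cong_right)
      (auto simp: strict_mono_less_eq strict_mono_less)
  also have "\<dots> = c * (Z t \<omega> - Z s \<omega>)"
    using sum_Suc_diff'[OF \<open>i \<le> k\<close>, of "\<lambda>j. Z (\<tau> j) \<omega>"] ik by (simp add: sum_distrib_left[symmetric])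
  finally have "c * (Z t \<omega> - Z s \<omega>) + (\<Sum>j<m. grid_coeff \<tau> p j * (Z (\<tau> (Suc j)) \<omega> - Z (\<tau> j) \<omega>))
     = (\<Sum>j<m. (grid_coeff \<tau> (q # p) j) * (Z (\<tau> (Suc j)) \<omega> - Z (\<tau> j) \<omega>))"
    by (simp add: grid_coeff_def q distrib_right sum.distrib)
  then show ?case using IH by (simp add: step_integral_def q)
qed

text \<open>A step function is its own step integral against the deterministic process
  \<open>t \<mapsto> indicator {..t}\<close>, so the grid formula above also applies to it.\<close>

lemma step_fun_eq_step_integral:
  "valid_steps p \<Longrightarrow> step_fun p u = step_integral (\<lambda>t. indicator {..t}) p u"
proof (induction p)
  case (Cons q p)
  obtain c s t where q: "q = (c, s, t)" by (cases q)
  have "s \<le> t" using Cons.prems q by (auto simp: valid_steps_def)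
  then have "indicator {s<..t} u = (indicator {..t} u - indicator {..s} u :: real)"
    by (auto simp: indicator_def)
  moreover have "step_fun p u = step_integral (\<lambda>t. indicator {..t}) p u"
    using Cons by (auto simp: valid_steps_def)
  ultimately show ?case by (simp add: step_fun_def step_integral_def q)
qed (simp add: step_fun_def step_integral_def)

text \<open>The cells are disjoint, so at each u at most one summand survives and the nonlinear map
  passes through the sum. Outside all cells both sides vanish, because
  \<open>0 powr \<alpha> = 0\<close>.\<close>

lemma abs_powr_sum_grid:
  fixes d \<tau> :: "nat \<Rightarrow> real"
  assumes "strict_mono \<tau>"
  shows "\<bar>\<Sum>j<m. d j * (indicator {..\<tau> (Suc j)} u - indicator {..\<tau> j} u)\<bar> powr \<alpha>
       = (\<Sum>j<m. \<bar>d j\<bar> powr \<alpha> * indicator {\<tau> j<..\<tau> (Suc j)} u)"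
proof -
  have le: "\<tau> j \<le> \<tau> (Suc j)" for j using assms by (simp add: strict_mono_less_eq)
  then have ind: "indicator {..\<tau> (Suc j)} u - indicator {..\<tau> j} u
      = (indicator {\<tau> j<..\<tau> (Suc j)} u :: real)" for j
    using le[of j] by (auto simp: indicator_def dest: order_trans)
  show ?thesis
  proof (cases "\<exists>k<m. u \<in> {\<tau> k<..\<tau> (Suc k)}")
    case True
    then obtain k where k: "k < m" "\<tau> k < u" "u \<le> \<tau> (Suc k)" by auto
    have other: "indicator {\<tau> j<..\<tau> (Suc j)} u = (0::real)" if "j \<noteq> k" for j
    proof (cases "j < k")
      case True
      then have "\<tau> (Suc j) \<le> \<tau> k" using assms by (simp add: strict_mono_less_eq)
      then show ?thesis using k by (auto simp: indicator_def)
    next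
      case False
      then have "\<tau> (Suc k) \<le> \<tau> j" using assms that by (simp add: strict_mono_less_eq)
      then show ?thesis using k by (auto simp: indicator_def)
    qed
    have one: "(\<Sum>j<m. c j * indicator {\<tau> j<..\<tau> (Suc j)} u) = c k" for c :: "nat \<Rightarrow> real"
    proof -
      have "(\<Sum>j<m. c j * indicator {\<tau> j<..\<tau> (Suc j)} u) = (\<Sum>j<m. if j = k then c k else 0)"
        using k by (intro sum.cong) (auto simp: other)
      then show ?thesis using k by simp
    qed
    show ?thesis by (simp add: ind one)
  next
    case False
    then have "indicator {\<tau> j<..\<tau> (Suc j)} u = (0::real)" if "j < m" for j
      using that by (auto simp: indicator_def)
    then show ?thesis by (simp add: ind)
  qed
qed

lemma step_integral_measurable:
  assumes "\<And>t. Z t \<in> borel_measurable M"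
  shows "step_integral Z p \<in> borel_measurable M"
proof (induction p)
  case Nil
  have "step_integral Z [] = (\<lambda>_. 0)" by (auto simp: step_integral_def)
  then show ?case by simp
next
  case (Cons q p)
  obtain c s t where q: "q = (c, s, t)" by (cases q)
  have "step_integral Z (q # p) = (\<lambda>\<omega>. c * (Z t \<omega> - Z s \<omega>) + step_integral Z p \<omega>)"
    by (auto simp: step_integral_def q)
  then show ?case using Cons assms by simp
qed

lemma step_fun_measurable: "step_fun p \<in> borel_measurable borel"
proof (induction p)
  case Nil
  have "step_fun [] = (\<lambda>_. 0)" by (auto simp: step_fun_def)
  then show ?case by simp
next
  case (Cons q p)
  obtain c s t where q: "q = (c, s, t)" by (cases q)
  have "step_fun (q # p) = (\<lambda>u. c * indicator {s<..t} u + step_fun p u)"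
    by (auto simp: step_fun_def q)
  then show ?case using Cons by simp
qed

text \<open>On a common grid the integral is a sum of independent stable variables, and the
  characteristic function is exp (- \<Sum> w j). The real part of w j is the cell length times |d
  j|^\<alpha>; the skewness sits in the imaginary part, so it drops out of the modulus and costs at
  most the factor 1 + |tan| in the last bound.\<close>

lemma step_integral_char:
  assumes Z: "stable_levy_motion M \<alpha> b Z" and p: "valid_steps p"
  shows "integrable lborel (\<lambda>u. \<bar>step_fun p u\<bar> powr \<alpha>)"
    and "norm (LINT \<omega>|M. iexp (step_integral Z p \<omega>)) = exp (- (LINT u|lborel. \<bar>step_fun p u\<bar> powr \<alpha>))"
    and "norm (1 - (LINT \<omega>|M. iexp (step_integral Z p \<omega>)))
         \<le> (1 + \<bar>tan (pi * \<alpha> / 2)\<bar>) * (LINT u|lborel. \<bar>step_fun p u\<bar> powr \<alpha>)"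
proof -
  let ?S = "LINT u|lborel. \<bar>step_fun p u\<bar> powr \<alpha>"
  let ?\<phi> = "LINT \<omega>|M. iexp (step_integral Z p \<omega>)"
  let ?C = "1 + \<bar>tan (pi * \<alpha> / 2)\<bar>"
  interpret prob_space M using Z by (simp add: stable_levy_motion_def)
  have [measurable]: "Z t \<in> borel_measurable M" for t using Z by (simp add: stable_levy_motion_def)
  define T where "T = (\<lambda>(c, s, t). s) ` set p \<union> (\<lambda>(c, s, t). t) ` set p"
  have "finite T" by (simp add: T_def)
  from ex_strict_mono_grid[OF this] obtain \<tau> :: "nat \<Rightarrow> real" and m
    where \<tau>: "strict_mono \<tau>" and T: "T \<subseteq> \<tau> ` {..m}" by blast
  have ends: "s \<in> \<tau> ` {..m} \<and> t \<in> \<tau> ` {..m}" if "(c, s, t) \<in> set p" for c s t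
  proof -
    have "s \<in> T" "t \<in> T" using that unfolding T_def by force+
    then show ?thesis using T by blast
  qed
  have lt: "\<tau> j < \<tau> (Suc j)" for j using \<tau> by (simp add: strict_mono_less)
  define d where "d = grid_coeff \<tau> p"
  let ?\<Delta> = "\<lambda>j. \<tau> (Suc j) - \<tau> j"
  define w where "w j = complex_of_real (?\<Delta> j * \<bar>d j\<bar> powr \<alpha>) *
                  (1 + \<i> * complex_of_real (b * sgn (d j) * tan (pi * \<alpha> / 2)))" for j
  have fun_eq: "\<bar>step_fun p u\<bar> powr \<alpha> = (\<Sum>j<m. \<bar>d j\<bar> powr \<alpha> * indicator {\<tau> j<..\<tau> (Suc j)} u)" for u
    using abs_powr_sum_grid[OF \<tau>, of d u m \<alpha>]
    by (simp add: step_fun_eq_step_integral[OF p] step_integral_grid[OF \<tau> p ends] d_def)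
  have bi: "has_bochner_integral lborel (\<lambda>u. \<bar>step_fun p u\<bar> powr \<alpha>) (\<Sum>j<m. \<bar>d j\<bar> powr \<alpha> * ?\<Delta> j)"
    unfolding fun_eq
  proof (rule has_bochner_integral_sum)
    fix j assume "j \<in> {..<m}"
    have "has_bochner_integral lborel (indicator {\<tau> j<..\<tau> (Suc j)}) (?\<Delta> j)"
      using has_bochner_integral_real_indicator[of "{\<tau> j<..\<tau> (Suc j)}" lborel] lt[of j] by simp
    then show "has_bochner_integral lborel (\<lambda>u. \<bar>d j\<bar> powr \<alpha> * indicator {\<tau> j<..\<tau> (Suc j)} u)
                (\<bar>d j\<bar> powr \<alpha> * ?\<Delta> j)"
      by (rule has_bochner_integral_mult_right)
  qed
  then show "integrable lborel (\<lambda>u. \<bar>step_fun p u\<bar> powr \<alpha>)" by (simp add: has_bochner_integral_iff)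
  have int: "?S = (\<Sum>j<m. \<bar>d j\<bar> powr \<alpha> * ?\<Delta> j)"
    using bi by (simp add: has_bochner_integral_iff)
  have indep: "indep_vars (\<lambda>_. borel) (\<lambda>j \<omega>. Z (\<tau> (Suc j)) \<omega> - Z (\<tau> j) \<omega>) {..<m}"
    using Z \<tau> by (auto simp: stable_levy_motion_def independent_increments_def)
  have indep': "indep_vars (\<lambda>_. borel) (\<lambda>j \<omega>. d j * (Z (\<tau> (Suc j)) \<omega> - Z (\<tau> j) \<omega>)) {..<m}"
    using indep_vars_compose2[OF indep, of "\<lambda>j y. d j * y" "\<lambda>_. borel"] by simp
  have one: "char (distr M borel (\<lambda>\<omega>. d j * (Z (\<tau> (Suc j)) \<omega> - Z (\<tau> j) \<omega>))) 1 = exp (- w j)" for j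
  proof -
    have "char (distr M borel (\<lambda>\<omega>. d j * (Z (\<tau> (Suc j)) \<omega> - Z (\<tau> j) \<omega>))) 1
        = char (distr M borel (\<lambda>\<omega>. Z (\<tau> (Suc j)) \<omega> - Z (\<tau> j) \<omega>)) (d j)"
      by (simp add: char_def integral_distr)
    also have "\<dots> = exp (- w j)"
      using Z lt[of j] by (simp add: stable_levy_motion_def w_def)
    finally show ?thesis .
  qed
  have "?\<phi>
      = char (distr M borel (\<lambda>\<omega>. \<Sum>j<m. d j * (Z (\<tau> (Suc j)) \<omega> - Z (\<tau> j) \<omega>))) 1"
    by (simp add: char_def integral_distr step_integral_grid[OF \<tau> p ends] d_def)
  also have "\<dots> = (\<Prod>j<m. exp (- w j))"
    using char_distr_sum[OF indep', of 1] by (simp add: one)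
  also have "\<dots> = exp (- (\<Sum>j<m. w j))"
    by (simp add: exp_sum sum_negf[symmetric])
  finally have char: "?\<phi> = exp (- (\<Sum>j<m. w j))" .
  have Re: "Re (\<Sum>j<m. w j) = ?S"
    by (simp add: int w_def Re_sum mult.commute)
  show "norm ?\<phi> = exp (- ?S)"
    by (simp add: char Re[symmetric])
  have b: "\<bar>b\<bar> \<le> 1" using Z by (simp add: stable_levy_motion_def)
  have nw: "norm (w j) \<le> ?C * (\<bar>d j\<bar> powr \<alpha> * ?\<Delta> j)" for j
  proof -
    have "norm (1 + \<i> * complex_of_real (b * sgn (d j) * tan (pi * \<alpha> / 2)))
        \<le> norm (1::complex) + norm (\<i> * complex_of_real (b * sgn (d j) * tan (pi * \<alpha> / 2)))"
      by (rule norm_triangle_ineq)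
    also have "\<dots> = 1 + \<bar>b\<bar> * \<bar>sgn (d j)\<bar> * \<bar>tan (pi * \<alpha> / 2)\<bar>"
      by (simp add: norm_mult abs_mult del: of_real_mult)
    also have "\<dots> \<le> 1 + 1 * 1 * \<bar>tan (pi * \<alpha> / 2)\<bar>"
      using b by (intro add_left_mono mult_mono) (auto simp: abs_sgn_eq)
    finally have "norm (1 + \<i> * complex_of_real (b * sgn (d j) * tan (pi * \<alpha> / 2)))
        \<le> 1 + \<bar>tan (pi * \<alpha> / 2)\<bar>" by simp
    moreover have "norm (complex_of_real (?\<Delta> j * \<bar>d j\<bar> powr \<alpha>)) = \<bar>d j\<bar> powr \<alpha> * ?\<Delta> j"
      using lt[of j] by (simp add: norm_mult del: of_real_diff)
    ultimately show ?thesis unfolding w_def norm_mult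
      using lt[of j] by (simp only:) (metis mult.commute mult_right_mono mult_nonneg_nonneg powr_ge_zero less_imp_le diff_gt_0_iff_gt)
  qed
  \<comment> \<open>Mean value inequality on the left half-plane, which is convex and on which the
    derivative of exp has modulus at most 1.\<close>
  have "norm (1 - exp (- z)) \<le> norm z" if "Re z \<ge> 0" for z :: complex
  proof -
    have "norm (exp (- z) - exp 0) \<le> 1 * norm (- z - 0)"
    proof (rule field_differentiable_bound[where S = "{z. Re z \<le> 0}" and f' = exp])
      show "convex {z. Re z \<le> 0}" by (rule convex_halfspace_Re_le)
      show "(exp has_field_derivative exp z) (at z within {z. Re z \<le> 0})" for z :: complex
        by (rule DERIV_subset[OF DERIV_exp]) auto
    qed (use that in auto)
    then show ?thesis by (simp add: norm_minus_commute)
  qed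
  then have "norm (1 - ?\<phi>) \<le> norm (\<Sum>j<m. w j)"
    unfolding char using Re by (simp del: Re_sum)
  also have "\<dots> \<le> (\<Sum>j<m. norm (w j))" by (rule norm_sum)
  also have "\<dots> \<le> (\<Sum>j<m. ?C * (\<bar>d j\<bar> powr \<alpha> * ?\<Delta> j))"
    by (rule sum_mono) (rule nw)
  also have "\<dots> = ?C * ?S"
    by (simp only: int sum_distrib_left)
  finally show "norm (1 - ?\<phi>)
         \<le> ?C * ?S" .
qed

section \<open>Limits in probability of step integrals\<close>

lemma norm_iexp_diff_le: "norm (iexp x - iexp y) \<le> \<bar>x - y\<bar>"
proof -
  have "iexp x - iexp y = iexp y * (iexp (x - y) - 1)"
    by (simp add: algebra_simps exp_add[symmetric])
  moreover have "norm (iexp (x - y) - 1) \<le> \<bar>x - y\<bar>"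
    using iexp_approx1[of "x - y" 0] by simp
  ultimately show ?thesis by (simp add: norm_mult)
qed

lemma (in prob_space) integrable_iexp [simp]:
  "Y \<in> borel_measurable M \<Longrightarrow> integrable M (\<lambda>\<omega>. iexp (Y \<omega>))"
  by (rule integrable_const_bound[of _ 1]) auto

text \<open>The exponential is 1-Lipschitz and bounded: where the distance is at most d = e / 2 it
  contributes at most d, and the exceptional event, of probability below e / 4, contributes less
  than 2 * e / 4.\<close>

lemma (in prob_space) tendsto_integral_iexp:
  assumes "tendsto_in_prob M Y Y'"
  shows "(\<lambda>n. LINT \<omega>|M. iexp (Y n \<omega>)) \<longlonglongrightarrow> (LINT \<omega>|M. iexp (Y' \<omega>))"
proof (rule LIMSEQ_I)
  have [measurable]: "Y n \<in> borel_measurable M" "Y' \<in> borel_measurable M" for n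
    using assms by (auto simp: tendsto_in_prob_def)
  fix e :: real assume "0 < e"
  define d where "d = e / 2"
  have e: "0 < e" "0 < d" using \<open>0 < e\<close> by (auto simp: d_def)
  let ?A = "\<lambda>n. {\<omega> \<in> space M. \<bar>Y n \<omega> - Y' \<omega>\<bar> > d}"
  have "(\<lambda>n. prob (?A n)) \<longlonglongrightarrow> 0"
    using assms e(2) unfolding tendsto_in_prob_def by blast
  from LIMSEQ_D[OF this, of "e / 4"] e obtain N where N: "\<And>n. n \<ge> N \<Longrightarrow> prob (?A n) < e / 4"
    by auto
  have "norm ((LINT \<omega>|M. iexp (Y n \<omega>)) - (LINT \<omega>|M. iexp (Y' \<omega>))) < e" if "n \<ge> N" for n
  proof -
    have "norm ((LINT \<omega>|M. iexp (Y n \<omega>)) - (LINT \<omega>|M. iexp (Y' \<omega>)))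
        = norm (LINT \<omega>|M. iexp (Y n \<omega>) - iexp (Y' \<omega>))"
      by (subst Bochner_Integration.integral_diff) auto
    also have "\<dots> \<le> (LINT \<omega>|M. norm (iexp (Y n \<omega>) - iexp (Y' \<omega>)))"
      by (rule integral_norm_bound)
    also have "\<dots> \<le> (LINT \<omega>|M. d + 2 * indicator (?A n) \<omega>)"
    proof (rule integral_mono)
      show "integrable M (\<lambda>\<omega>. norm (iexp (Y n \<omega>) - iexp (Y' \<omega>)))"
        by (intro integrable_norm Bochner_Integration.integrable_diff integrable_iexp) auto
      fix \<omega> assume \<omega>: "\<omega> \<in> space M"
      have "norm (iexp (Y n \<omega>) - iexp (Y' \<omega>)) \<le> norm (iexp (Y n \<omega>)) + norm (iexp (Y' \<omega>))"
        by (rule norm_triangle_ineq4)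
      then have "norm (iexp (Y n \<omega>) - iexp (Y' \<omega>)) \<le> 2" by simp
      with norm_iexp_diff_le[of "Y n \<omega>" "Y' \<omega>"] \<omega> e
      show "norm (iexp (Y n \<omega>) - iexp (Y' \<omega>)) \<le> d + 2 * indicator (?A n) \<omega>"
        by (auto simp: indicator_def)
    next
      show "integrable M (\<lambda>\<omega>. d + 2 * indicator (?A n) \<omega>)"
        by (intro Bochner_Integration.integrable_add integrable_mult_right integrable_real_indicator)
          (auto simp: emeasure_eq_measure)
    qed
    also have "\<dots> = d + 2 * prob (?A n)" by (simp add: prob_space emeasure_eq_measure)
    also have "\<dots> < e" using N[OF that] by (simp add: d_def)
    finally show ?thesis .
  qed
  then show "\<exists>N. \<forall>n\<ge>N. norm ((LINT \<omega>|M. iexp (Y n \<omega>)) - (LINT \<omega>|M. iexp (Y' \<omega>))) < e"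
    by blast
qed

lemma integrable_step_diff_powr:
  assumes \<alpha>: "0 < \<alpha>" "\<alpha> \<le> 2" and p: "integrable lborel (\<lambda>u. \<bar>step_fun p u\<bar> powr \<alpha>)"
    and g: "g \<in> borel_measurable borel" "integrable lborel (\<lambda>u. \<bar>g u\<bar> powr \<alpha>)"
  shows "integrable lborel (\<lambda>u. \<bar>step_fun p u - g u\<bar> powr \<alpha>)"
proof (rule Bochner_Integration.integrable_bound)
  show "integrable lborel (\<lambda>u. 4 * (\<bar>step_fun p u\<bar> powr \<alpha> + \<bar>g u\<bar> powr \<alpha>))"
    using p g by auto
  show "(\<lambda>u. \<bar>step_fun p u - g u\<bar> powr \<alpha>) \<in> borel_measurable lborel"
    using step_fun_measurable[of p] g by measurable
  show "AE u in lborel. norm (\<bar>step_fun p u - g u\<bar> powr \<alpha>)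
      \<le> norm (4 * (\<bar>step_fun p u\<bar> powr \<alpha> + \<bar>g u\<bar> powr \<alpha>))"
    using abs_add_powr_le[OF \<alpha>, of "step_fun p _" "- g _"] by (auto intro!: AE_I2)
qed

text \<open>The identity for step functions passes to the limit with a factor 4 on either side:
  \<open>abs_add_powr_le\<close> compares the integrals of |g|^\<alpha> and of its approximants in
  both directions, and the error terms \<open>?D n\<close> vanish.\<close>

lemma stable_integral_char:
  assumes Z: "stable_levy_motion M \<alpha> b Z" and Y: "has_stable_integral M \<alpha> Z g Y"
  shows "norm (LINT \<omega>|M. iexp (Y \<omega>)) \<le> exp (- (LINT u|lborel. \<bar>g u\<bar> powr \<alpha>) / 4)"
    and "norm (1 - (LINT \<omega>|M. iexp (Y \<omega>)))
       \<le> 4 * (1 + \<bar>tan (pi * \<alpha> / 2)\<bar>) * (LINT u|lborel. \<bar>g u\<bar> powr \<alpha>)"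
proof -
  interpret prob_space M using Z by (simp add: stable_levy_motion_def)
  have \<alpha>: "0 < \<alpha>" "\<alpha> \<le> 2" using Z by (auto simp: stable_levy_motion_def)
  obtain p where p: "\<And>n. valid_steps (p n)"
    and lim: "(\<lambda>n. LINT u|lborel. \<bar>step_fun (p n) u - g u\<bar> powr \<alpha>) \<longlonglongrightarrow> 0"
    and prob: "tendsto_in_prob M (\<lambda>n. step_integral Z (p n)) Y"
    and g: "g \<in> borel_measurable borel" "integrable lborel (\<lambda>u. \<bar>g u\<bar> powr \<alpha>)"
    using Y unfolding has_stable_integral_def by blast
  let ?I = "LINT u|lborel. \<bar>g u\<bar> powr \<alpha>"
  let ?S = "\<lambda>n. LINT u|lborel. \<bar>step_fun (p n) u\<bar> powr \<alpha>"
  let ?D = "\<lambda>n. LINT u|lborel. \<bar>step_fun (p n) u - g u\<bar> powr \<alpha>"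
  note S = step_integral_char[OF Z p]
  note D = integrable_step_diff_powr[OF \<alpha> S(1) g]
  have 1: "?I \<le> 4 * (?S n + ?D n)" for n
  proof -
    have "?I \<le> (LINT u|lborel. 4 * (\<bar>step_fun (p n) u\<bar> powr \<alpha> + \<bar>step_fun (p n) u - g u\<bar> powr \<alpha>))"
    proof (rule integral_mono[OF g(2)])
      show "integrable lborel (\<lambda>u. 4 * (\<bar>step_fun (p n) u\<bar> powr \<alpha> + \<bar>step_fun (p n) u - g u\<bar> powr \<alpha>))"
        using S(1) D by auto
      show "\<bar>g u\<bar> powr \<alpha> \<le> 4 * (\<bar>step_fun (p n) u\<bar> powr \<alpha> + \<bar>step_fun (p n) u - g u\<bar> powr \<alpha>)" for u
        using abs_add_powr_le[OF \<alpha>, of "step_fun (p n) u" "g u - step_fun (p n) u"]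
        by (simp add: abs_minus_commute)
    qed
    also have "\<dots> = 4 * (?S n + ?D n)" using S(1) D by simp
    finally show ?thesis .
  qed
  have 2: "?S n \<le> 4 * (?I + ?D n)" for n
  proof -
    have "?S n \<le> (LINT u|lborel. 4 * (\<bar>g u\<bar> powr \<alpha> + \<bar>step_fun (p n) u - g u\<bar> powr \<alpha>))"
    proof (rule integral_mono[OF S(1)])
      show "integrable lborel (\<lambda>u. 4 * (\<bar>g u\<bar> powr \<alpha> + \<bar>step_fun (p n) u - g u\<bar> powr \<alpha>))"
        using g D by auto
      show "\<bar>step_fun (p n) u\<bar> powr \<alpha> \<le> 4 * (\<bar>g u\<bar> powr \<alpha> + \<bar>step_fun (p n) u - g u\<bar> powr \<alpha>)" for u
        using abs_add_powr_le[OF \<alpha>, of "g u" "step_fun (p n) u - g u"] by simp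
    qed
    also have "\<dots> = 4 * (?I + ?D n)" using g D by simp
    finally show ?thesis .
  qed
  note conv = tendsto_integral_iexp[OF prob]
  show "norm (LINT \<omega>|M. iexp (Y \<omega>)) \<le> exp (- ?I / 4)"
  proof (rule LIMSEQ_le[OF tendsto_norm[OF conv]])
    show "(\<lambda>n. exp (?D n - ?I / 4)) \<longlonglongrightarrow> exp (- ?I / 4)"
      using tendsto_exp[OF tendsto_diff[OF lim tendsto_const, of "?I / 4"]] by simp
    have "norm (LINT \<omega>|M. iexp (step_integral Z (p n) \<omega>)) \<le> exp (?D n - ?I / 4)" for n
      unfolding S(2) using 1[of n] by simp
    then show "\<exists>N. \<forall>n\<ge>N. norm (LINT \<omega>|M. iexp (step_integral Z (p n) \<omega>)) \<le> exp (?D n - ?I / 4)"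
      by blast
  qed
  let ?C = "1 + \<bar>tan (pi * \<alpha> / 2)\<bar>"
  show "norm (1 - (LINT \<omega>|M. iexp (Y \<omega>))) \<le> 4 * ?C * ?I"
  proof (rule LIMSEQ_le[OF tendsto_norm[OF tendsto_diff[OF tendsto_const conv]]])
    show "(\<lambda>n. ?C * (4 * (?I + ?D n))) \<longlonglongrightarrow> 4 * ?C * ?I"
      using tendsto_mult_left[OF tendsto_mult_left[OF tendsto_add[OF tendsto_const lim]], of ?C 4 ?I]
      by (simp add: algebra_simps)
    have "norm (1 - (LINT \<omega>|M. iexp (step_integral Z (p n) \<omega>))) \<le> ?C * (4 * (?I + ?D n))" for n
      using S(3)[of n] mult_left_mono[OF 2[of n], of ?C] by linarith
    then show "\<exists>N. \<forall>n\<ge>N. norm (1 - (LINT \<omega>|M. iexp (step_integral Z (p n) \<omega>))) \<le> ?C * (4 * (?I + ?D n))"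
      by blast
  qed
qed

lemma has_stable_integral_cong_AE:
  assumes "has_stable_integral M \<alpha> Z g Y" "AE \<omega> in M. Y \<omega> = Y' \<omega>" "Y' \<in> borel_measurable M"
  shows "has_stable_integral M \<alpha> Z g Y'"
proof -
  have "tendsto_in_prob M X Y'" if "tendsto_in_prob M X Y" for X
  proof -
    have [measurable]: "X n \<in> borel_measurable M" "Y \<in> borel_measurable M" for n
      using that by (auto simp: tendsto_in_prob_def)
    note [measurable] = assms(3)
    have "measure M {\<omega> \<in> space M. \<bar>X n \<omega> - Y' \<omega>\<bar> > e} = measure M {\<omega> \<in> space M. \<bar>X n \<omega> - Y \<omega>\<bar> > e}" for e n
      using assms(2) by (intro measure_eq_AE) auto
    then show ?thesis using that assms(3) by (simp add: tendsto_in_prob_def)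
  qed
  then show ?thesis using assms(1) unfolding has_stable_integral_def by blast
qed

section \<open>Linearity of the stable integral\<close>

lemma tendsto_in_prob_lincomb:
  assumes "prob_space M" "tendsto_in_prob M X Y" "tendsto_in_prob M X' Y'"
  shows "tendsto_in_prob M (\<lambda>n \<omega>. c * X n \<omega> + c' * X' n \<omega>) (\<lambda>\<omega>. c * Y \<omega> + c' * Y' \<omega>)"
proof -
  interpret prob_space M by fact
  have [measurable]: "X n \<in> borel_measurable M" "Y \<in> borel_measurable M"
      "X' n \<in> borel_measurable M" "Y' \<in> borel_measurable M" for n
    using assms by (auto simp: tendsto_in_prob_def)
  have "(\<lambda>n. prob {\<omega> \<in> space M. \<bar>(c * X n \<omega> + c' * X' n \<omega>) - (c * Y \<omega> + c' * Y' \<omega>)\<bar> > e}) \<longlonglongrightarrow> 0"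
    if e: "e > 0" for e
  proof -
    \<comment> \<open>Small enough for (|c| + |c'|) d \<le> e; the summand 1 keeps the denominator
      positive when both coefficients vanish.\<close>
    define d where "d = e / (2 * (1 + \<bar>c\<bar> + \<bar>c'\<bar>))"
    have d: "d > 0" using e by (auto simp: d_def intro!: divide_pos_pos)
    have d2: "(\<bar>c\<bar> + \<bar>c'\<bar>) * d \<le> e"
      using e by (auto simp: d_def divide_simps)
    let ?A = "\<lambda>n. {\<omega> \<in> space M. \<bar>X n \<omega> - Y \<omega>\<bar> > d}" and ?B = "\<lambda>n. {\<omega> \<in> space M. \<bar>X' n \<omega> - Y' \<omega>\<bar> > d}"
    have lim: "(\<lambda>n. prob (?A n) + prob (?B n)) \<longlonglongrightarrow> 0"
      using assms d tendsto_add[of "\<lambda>n. prob (?A n)" 0 _ "\<lambda>n. prob (?B n)" 0]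
      by (simp add: tendsto_in_prob_def)
    have sub: "{\<omega> \<in> space M. \<bar>(c * X n \<omega> + c' * X' n \<omega>) - (c * Y \<omega> + c' * Y' \<omega>)\<bar> > e} \<subseteq> ?A n \<union> ?B n" for n
    proof safe
      fix \<omega> assume *: "\<bar>(c * X n \<omega> + c' * X' n \<omega>) - (c * Y \<omega> + c' * Y' \<omega>)\<bar> > e"
        and B: "\<not> \<bar>X' n \<omega> - Y' \<omega>\<bar> > d"
      show "\<bar>X n \<omega> - Y \<omega>\<bar> > d"
      proof (rule ccontr)
        assume A: "\<not> \<bar>X n \<omega> - Y \<omega>\<bar> > d"
        have "(c * X n \<omega> + c' * X' n \<omega>) - (c * Y \<omega> + c' * Y' \<omega>) = c * (X n \<omega> - Y \<omega>) + c' * (X' n \<omega> - Y' \<omega>)"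
          by (simp add: algebra_simps)
        also have "\<bar>\<dots>\<bar> \<le> \<bar>c\<bar> * \<bar>X n \<omega> - Y \<omega>\<bar> + \<bar>c'\<bar> * \<bar>X' n \<omega> - Y' \<omega>\<bar>"
          by (metis abs_mult abs_triangle_ineq)
        also have "\<dots> \<le> \<bar>c\<bar> * d + \<bar>c'\<bar> * d"
          using A B by (intro add_mono mult_left_mono) auto
        finally show False using * d2 by (simp add: algebra_simps)
      qed
    qed
    have "prob {\<omega> \<in> space M. \<bar>(c * X n \<omega> + c' * X' n \<omega>) - (c * Y \<omega> + c' * Y' \<omega>)\<bar> > e}
        \<le> prob (?A n) + prob (?B n)" for n
      using finite_measure_mono[OF sub[of n]] measure_Un_le[of "?A n" M "?B n"] by simp
    then show ?thesis
      by (intro tendsto_sandwich[OF _ _ tendsto_const lim]) auto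
  qed
  then show ?thesis by (simp add: tendsto_in_prob_def)
qed

lemma has_stable_integral_lincomb:
  assumes Z: "stable_levy_motion M \<alpha> b Z"
    and Y: "has_stable_integral M \<alpha> Z g Y" and Y': "has_stable_integral M \<alpha> Z g' Y'"
  shows "has_stable_integral M \<alpha> Z (\<lambda>u. c * g u + c' * g' u) (\<lambda>\<omega>. c * Y \<omega> + c' * Y' \<omega>)"
proof -
  have M: "prob_space M" and \<alpha>: "0 < \<alpha>" "\<alpha> \<le> 2" using Z by (auto simp: stable_levy_motion_def)
  obtain p where p: "\<And>n. valid_steps (p n)"
    and lim: "(\<lambda>n. LINT u|lborel. \<bar>step_fun (p n) u - g u\<bar> powr \<alpha>) \<longlonglongrightarrow> 0"
    and prob: "tendsto_in_prob M (\<lambda>n. step_integral Z (p n)) Y"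
    and g: "g \<in> borel_measurable borel" "integrable lborel (\<lambda>u. \<bar>g u\<bar> powr \<alpha>)"
    using Y unfolding has_stable_integral_def by blast
  obtain p' where p': "\<And>n. valid_steps (p' n)"
    and lim': "(\<lambda>n. LINT u|lborel. \<bar>step_fun (p' n) u - g' u\<bar> powr \<alpha>) \<longlonglongrightarrow> 0"
    and prob': "tendsto_in_prob M (\<lambda>n. step_integral Z (p' n)) Y'"
    and g': "g' \<in> borel_measurable borel" "integrable lborel (\<lambda>u. \<bar>g' u\<bar> powr \<alpha>)"
    using Y' unfolding has_stable_integral_def by blast
  note [measurable] = g(1) g'(1) step_fun_measurable
  define mul :: "real \<Rightarrow> (real \<times> real \<times> real) list \<Rightarrow> (real \<times> real \<times> real) list"
    where "mul e = map (\<lambda>(r, s, t). (e * r, s, t))" for e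
  define q where "q n = mul c (p n) @ mul c' (p' n)" for n
  have scale: "step_fun (mul e l) u = e * step_fun l u"
    "step_integral Z (mul e l) \<omega> = e * step_integral Z l \<omega>" for e l u \<omega>
    by (induction l) (auto simp: mul_def step_fun_def step_integral_def algebra_simps)
  have "step_fun (l @ l') u = step_fun l u + step_fun l' u"
    "step_integral Z (l @ l') \<omega> = step_integral Z l \<omega> + step_integral Z l' \<omega>" for l l' u \<omega>
    by (auto simp: step_fun_def step_integral_def)
  then have q: "step_fun (q n) u = c * step_fun (p n) u + c' * step_fun (p' n) u"
    "step_integral Z (q n) = (\<lambda>\<omega>. c * step_integral Z (p n) \<omega> + c' * step_integral Z (p' n) \<omega>)" for n u
    by (auto simp: q_def scale)
  have vq: "valid_steps (q n)" for n
    using p[of n] p'[of n] by (auto simp: q_def mul_def valid_steps_def)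
  have le: "\<bar>c * y + c' * z\<bar> powr \<alpha> \<le> 4 * (\<bar>c\<bar> powr \<alpha> * \<bar>y\<bar> powr \<alpha> + \<bar>c'\<bar> powr \<alpha> * \<bar>z\<bar> powr \<alpha>)" for y z
    using abs_add_powr_le[OF \<alpha>, of "c * y" "c' * z"] by (simp add: abs_mult powr_mult)
  have int: "integrable lborel (\<lambda>u. \<bar>c * g u + c' * g' u\<bar> powr \<alpha>)"
  proof (rule Bochner_Integration.integrable_bound)
    show "integrable lborel (\<lambda>u. 4 * (\<bar>c\<bar> powr \<alpha> * \<bar>g u\<bar> powr \<alpha> + \<bar>c'\<bar> powr \<alpha> * \<bar>g' u\<bar> powr \<alpha>))"
      using g g' by auto
  qed (use le in \<open>auto intro!: AE_I2\<close>)
  note D = integrable_step_diff_powr[OF \<alpha> step_integral_char(1)[OF Z p] g]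
  note D' = integrable_step_diff_powr[OF \<alpha> step_integral_char(1)[OF Z p'] g']
  note Dq = integrable_step_diff_powr[OF \<alpha> step_integral_char(1)[OF Z vq] _ int]
  let ?J = "\<lambda>n. 4 * (\<bar>c\<bar> powr \<alpha> * (LINT u|lborel. \<bar>step_fun (p n) u - g u\<bar> powr \<alpha>)
                 + \<bar>c'\<bar> powr \<alpha> * (LINT u|lborel. \<bar>step_fun (p' n) u - g' u\<bar> powr \<alpha>))"
  have bound: "(LINT u|lborel. \<bar>step_fun (q n) u - (c * g u + c' * g' u)\<bar> powr \<alpha>) \<le> ?J n" for n
  proof -
    have "(LINT u|lborel. \<bar>step_fun (q n) u - (c * g u + c' * g' u)\<bar> powr \<alpha>)
       \<le> (LINT u|lborel. 4 * (\<bar>c\<bar> powr \<alpha> * \<bar>step_fun (p n) u - g u\<bar> powr \<alpha>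
                 + \<bar>c'\<bar> powr \<alpha> * \<bar>step_fun (p' n) u - g' u\<bar> powr \<alpha>))"
    proof (rule integral_mono)
      show "integrable lborel (\<lambda>u. \<bar>step_fun (q n) u - (c * g u + c' * g' u)\<bar> powr \<alpha>)"
        by (rule Dq) measurable
      show "integrable lborel (\<lambda>u. 4 * (\<bar>c\<bar> powr \<alpha> * \<bar>step_fun (p n) u - g u\<bar> powr \<alpha>
                 + \<bar>c'\<bar> powr \<alpha> * \<bar>step_fun (p' n) u - g' u\<bar> powr \<alpha>))"
        using D D' by auto
      fix u
      have "step_fun (q n) u - (c * g u + c' * g' u)
          = c * (step_fun (p n) u - g u) + c' * (step_fun (p' n) u - g' u)"
        by (simp add: q algebra_simps)
      then show "\<bar>step_fun (q n) u - (c * g u + c' * g' u)\<bar> powr \<alpha>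
        \<le> 4 * (\<bar>c\<bar> powr \<alpha> * \<bar>step_fun (p n) u - g u\<bar> powr \<alpha>
                 + \<bar>c'\<bar> powr \<alpha> * \<bar>step_fun (p' n) u - g' u\<bar> powr \<alpha>)"
        using le by simp
    qed
    also have "\<dots> = ?J n" using D D' by simp
    finally show ?thesis .
  qed
  have J_lim: "?J \<longlonglongrightarrow> 0"
    using tendsto_mult_left[OF tendsto_add[OF tendsto_mult_left[OF lim, of "\<bar>c\<bar> powr \<alpha>"]
        tendsto_mult_left[OF lim', of "\<bar>c'\<bar> powr \<alpha>"]], of 4] by simp
  have "(\<lambda>n. LINT u|lborel. \<bar>step_fun (q n) u - (c * g u + c' * g' u)\<bar> powr \<alpha>) \<longlonglongrightarrow> 0"
  proof (rule tendsto_sandwich[OF _ _ tendsto_const J_lim])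
    show "\<forall>\<^sub>F n in sequentially. 0 \<le> (LINT u|lborel. \<bar>step_fun (q n) u - (c * g u + c' * g' u)\<bar> powr \<alpha>)"
      by (intro always_eventually allI integral_nonneg_AE) auto
  qed (intro always_eventually allI bound)
  moreover have "tendsto_in_prob M (\<lambda>n. step_integral Z (q n)) (\<lambda>\<omega>. c * Y \<omega> + c' * Y' \<omega>)"
    unfolding q(2) by (rule tendsto_in_prob_lincomb[OF M prob prob'])
  moreover have "(\<lambda>u. c * g u + c' * g' u) \<in> borel_measurable borel" by measurable
  ultimately show ?thesis
    unfolding has_stable_integral_def using int vq by (intro conjI exI[of _ q]) auto
qed

section \<open>The moving average kernel\<close>

definition pos_powr :: "real \<Rightarrow> real \<Rightarrow> real" where
  "pos_powr \<gamma> v = (if 0 < v then v powr \<gamma> else 0)"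

text \<open>The Mandelbrot-Van Ness kernel. For \<gamma> = 0 and t \<ge> 0 it equals
  \<open>indicator {0..<t}\<close>, so that the convention for H = 1 / \<alpha> fits the same
  formula.\<close>

definition mvn_kernel :: "real \<Rightarrow> real \<Rightarrow> real \<Rightarrow> real" where
  "mvn_kernel \<gamma> t u = pos_powr \<gamma> (t - u) - pos_powr \<gamma> (- u)"

lemma pos_powr_measurable [measurable]: "pos_powr \<gamma> \<in> borel_measurable borel"
  unfolding pos_powr_def by measurable

lemma mvn_kernel_measurable [measurable]: "mvn_kernel \<gamma> t \<in> borel_measurable borel"
  unfolding mvn_kernel_def by measurable

lemma mvn_kernel_scale: "0 < h \<Longrightarrow> mvn_kernel \<gamma> h (h * u) = h powr \<gamma> * mvn_kernel \<gamma> 1 u"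
proof -
  assume h: "0 < h"
  have *: "pos_powr \<gamma> (h * v) = h powr \<gamma> * pos_powr \<gamma> v" for v
    using h by (simp add: pos_powr_def powr_mult zero_less_mult_iff)
  have "mvn_kernel \<gamma> h (h * u) = pos_powr \<gamma> (h * (1 - u)) - pos_powr \<gamma> (h * (- u))"
    by (simp add: mvn_kernel_def algebra_simps)
  then show ?thesis unfolding * by (simp add: mvn_kernel_def algebra_simps)
qed

lemma mvn_kernel_diff: "mvn_kernel \<gamma> r u - mvn_kernel \<gamma> s u = mvn_kernel \<gamma> (r - s) (u - s)"
  by (simp add: mvn_kernel_def)

text \<open>The set is the whole line if \<open>P\<close> is true and the positive half-line
  otherwise; both are invariant under dilation by h. The exponent is the Jacobian h together with
  the kernel's factor: 1 + (H - 1 / \<alpha>) \<alpha> = \<alpha> H.\<close>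

lemma mvn_kernel_self_similar:
  fixes \<alpha> H :: real
  assumes "0 < \<alpha>" "0 < h"
  shows "(LINT u|lborel. indicator {v. 0 < v \<or> P} u * \<bar>mvn_kernel (H - 1 / \<alpha>) h u\<bar> powr \<alpha>)
       = h powr (\<alpha> * H) * (LINT u|lborel. indicator {v. 0 < v \<or> P} u * \<bar>mvn_kernel (H - 1 / \<alpha>) 1 u\<bar> powr \<alpha>)"
proof -
  let ?\<gamma> = "H - 1 / \<alpha>"
  have "(LINT u|lborel. indicator {v. 0 < v \<or> P} u * \<bar>mvn_kernel ?\<gamma> h u\<bar> powr \<alpha>)
     = h * (LINT u|lborel. indicator {v. 0 < v \<or> P} (h * u) * \<bar>mvn_kernel ?\<gamma> h (h * u)\<bar> powr \<alpha>)"
    using assms by (subst lborel_integral_real_affine[where c = h and t = 0]) auto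
  also have "(\<lambda>u. indicator {v. 0 < v \<or> P} (h * u) * \<bar>mvn_kernel ?\<gamma> h (h * u)\<bar> powr \<alpha>)
    = (\<lambda>u. h powr (?\<gamma> * \<alpha>) * (indicator {v. 0 < v \<or> P} u * \<bar>mvn_kernel ?\<gamma> 1 u\<bar> powr \<alpha>))"
    using assms by (auto simp: mvn_kernel_scale abs_mult powr_mult powr_powr indicator_def zero_less_mult_iff)
  also have "h * (LINT u|lborel. h powr (?\<gamma> * \<alpha>) * (indicator {v. 0 < v \<or> P} u * \<bar>mvn_kernel ?\<gamma> 1 u\<bar> powr \<alpha>))
     = h powr 1 * h powr (?\<gamma> * \<alpha>) * (LINT u|lborel. indicator {v. 0 < v \<or> P} u * \<bar>mvn_kernel ?\<gamma> 1 u\<bar> powr \<alpha>)"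
    using assms by simp
  also have "h powr 1 * h powr (?\<gamma> * \<alpha>) = h powr (\<alpha> * H)"
    using assms by (simp only: powr_add[symmetric]) (simp add: field_simps)
  finally show ?thesis .
qed

section \<open>The process as one stable integral\<close>

lemma lfsm_measurable:
  assumes "lfsm M \<alpha> H X" "0 \<le> t"
  shows "X t \<in> borel_measurable M"
proof -
  have "(\<lambda>(t, \<omega>). X t \<omega>) \<in> borel_measurable (restrict_space borel {0..} \<Otimes>\<^sub>M M)"
    using assms by (simp add: lfsm_def)
  from measurable_compose[OF measurable_Pair1'[of t "restrict_space borel {0..}" M] this] assms(2)
  show ?thesis by (simp add: space_restrict_space)
qed

text \<open>A constant sequence with one step approximates: \<open>{0<..t}\<close> and
  \<open>{0..<t}\<close> differ by a null set, and \<open>Z 0\<close> vanishes almost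
  surely.\<close>

lemma levy_has_stable_integral:
  assumes Z: "stable_levy_motion M \<alpha> b Z" and t: "0 \<le> t"
  shows "has_stable_integral M \<alpha> Z (mvn_kernel 0 t) (Z t)"
proof -
  interpret prob_space M using Z by (simp add: stable_levy_motion_def)
  have [measurable]: "Z t \<in> borel_measurable M" for t using Z by (simp add: stable_levy_motion_def)
  have \<alpha>: "0 < \<alpha>" using Z by (simp add: stable_levy_motion_def)
  have k: "mvn_kernel 0 t u = indicator {0..<t} u" for u
    using t by (auto simp: mvn_kernel_def pos_powr_def indicator_def)
  have "\<bar>mvn_kernel 0 t u\<bar> powr \<alpha> = indicator {0..<t} u" for u
    unfolding k by (simp add: indicator_def)
  moreover have "has_bochner_integral lborel (indicator {0..<t} :: real \<Rightarrow> real) t"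
    using has_bochner_integral_real_indicator[of "{0..<t}" lborel] t by simp
  ultimately have int: "integrable lborel (\<lambda>u. \<bar>mvn_kernel 0 t u\<bar> powr \<alpha>)"
    by (simp add: has_bochner_integral_iff)
  have "valid_steps [(1, 0, t)]" using t by (simp add: valid_steps_def)
  moreover have "(LINT u|lborel. \<bar>step_fun [(1, 0, t)] u - mvn_kernel 0 t u\<bar> powr \<alpha>) = (LINT u|(lborel::real measure). 0)"
  proof (rule integral_cong_AE)
    have "AE u in lborel. u \<noteq> 0 \<and> u \<noteq> t"
      using AE_lborel_singleton[of 0] AE_lborel_singleton[of t] by eventually_elim auto
    then show "AE u in lborel. \<bar>step_fun [(1, 0, t)] u - mvn_kernel 0 t u\<bar> powr \<alpha> = 0"
      by eventually_elim (auto simp: step_fun_def k indicator_def)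
    show "(\<lambda>u. \<bar>step_fun [(1, 0, t)] u - mvn_kernel 0 t u\<bar> powr \<alpha>) \<in> borel_measurable lborel"
      using step_fun_measurable[of "[(1, 0, t)]"] by measurable
  qed auto
  moreover have "tendsto_in_prob M (\<lambda>n. step_integral Z [(1, 0, t)]) (Z t)"
  proof -
    have "measure M {\<omega> \<in> space M. \<bar>Z t \<omega> - Z 0 \<omega> - Z t \<omega>\<bar> > e} = measure M {}" if "e > 0" for e
    proof (rule measure_eq_AE)
      have "AE \<omega> in M. Z 0 \<omega> = 0" using Z by (simp add: stable_levy_motion_def)
      then show "AE \<omega> in M. (\<omega> \<in> {\<omega> \<in> space M. \<bar>Z t \<omega> - Z 0 \<omega> - Z t \<omega>\<bar> > e}) = (\<omega> \<in> {})"
        by (rule AE_mp) (use that in \<open>auto intro!: AE_I2\<close>)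
    qed auto
    then show ?thesis
      using step_integral_measurable[of Z M "[(1, 0, t)]"]
      by (auto simp: tendsto_in_prob_def step_integral_def)
  qed
  ultimately show ?thesis
    unfolding has_stable_integral_def using int
    by (auto intro!: exI[of _ "\<lambda>n. [(1, 0, t)]"])
qed

text \<open>Merges the case H = 1 / \<alpha>, where a = 1 and the process is the driving motion
  itself, with the general one, where the integrals over u < 0 and over 0 \<le> u < t add up to one
  integral of the full kernel. The bounds on characteristic functions are derived from this form
  alone.\<close>

lemma lfsm_has_stable_integral:
  assumes X: "lfsm M \<alpha> H X"
  shows "\<exists>b Z a. stable_levy_motion M \<alpha> b Z \<and> a \<noteq> 0 \<and>
    (\<forall>t\<ge>0. has_stable_integral M \<alpha> Z (\<lambda>u. a * mvn_kernel (H - 1 / \<alpha>) t u) (X t))"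
proof -
  obtain b Z where Z: "stable_levy_motion M \<alpha> b Z"
    and rep: "if H = 1 / \<alpha> then \<forall>t\<ge>0. AE \<omega> in M. X t \<omega> = Z t \<omega>
         else \<exists>a. a \<noteq> 0 \<and> lfsm_representation M \<alpha> H a Z X"
    using X unfolding lfsm_def by (elim conjE exE) blast
  show ?thesis
  proof (cases "H = 1 / \<alpha>")
    case True
    have X_Z: "AE \<omega> in M. X t \<omega> = Z t \<omega>" if "0 \<le> t" for t
      using rep that unfolding if_P[OF True] by blast
    have "has_stable_integral M \<alpha> Z (\<lambda>u. 1 * mvn_kernel (H - 1 / \<alpha>) t u) (X t)" if t: "0 \<le> t" for t
    proof (rule has_stable_integral_cong_AE)
      show "has_stable_integral M \<alpha> Z (\<lambda>u. 1 * mvn_kernel (H - 1 / \<alpha>) t u) (Z t)"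
        using levy_has_stable_integral[OF Z t] True by simp
      show "AE \<omega> in M. Z t \<omega> = X t \<omega>" using X_Z[OF t] by eventually_elim simp
    qed (rule lfsm_measurable[OF X t])
    then show ?thesis using Z by (intro exI[of _ b] exI[of _ Z] exI[of _ 1]) auto
  next
    case False
    then obtain a where a: "a \<noteq> 0" and R: "lfsm_representation M \<alpha> H a Z X" using rep by auto
    let ?\<gamma> = "H - 1 / \<alpha>"
    have "has_stable_integral M \<alpha> Z (\<lambda>u. a * mvn_kernel ?\<gamma> t u) (X t)" if t: "0 \<le> t" for t
    proof -
      obtain Y1 Y2 where
        Y: "has_stable_integral M \<alpha> Z (\<lambda>u. indicator {..<0} u * ((t - u) powr ?\<gamma> - (- u) powr ?\<gamma>)) Y1"
        "has_stable_integral M \<alpha> Z (\<lambda>u. indicator {0..<t} u * (t - u) powr ?\<gamma>) Y2"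
        and AE: "AE \<omega> in M. X t \<omega> = a * Y1 \<omega> + a * Y2 \<omega>"
        using R t unfolding lfsm_representation_def by blast
      have k: "a * (indicator {..<0} u * ((t - u) powr ?\<gamma> - (- u) powr ?\<gamma>)) + a * (indicator {0..<t} u * (t - u) powr ?\<gamma>)
          = a * mvn_kernel ?\<gamma> t u" for u
        using t by (auto simp: mvn_kernel_def pos_powr_def indicator_def)
      show ?thesis
      proof (rule has_stable_integral_cong_AE)
        show "has_stable_integral M \<alpha> Z (\<lambda>u. a * mvn_kernel ?\<gamma> t u) (\<lambda>\<omega>. a * Y1 \<omega> + a * Y2 \<omega>)"
          using has_stable_integral_lincomb[OF Z Y, of a a] unfolding k .
        show "AE \<omega> in M. a * Y1 \<omega> + a * Y2 \<omega> = X t \<omega>" using AE by eventually_elim simp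
      qed (rule lfsm_measurable[OF X t])
    qed
    then show ?thesis using Z a by blast
  qed
qed

text \<open>On u > s the kernel of time s vanishes and that of time r is the shifted kernel of
  length r - s, which yields the |m|^\<alpha> term. The |l + m|^\<alpha> term follows from writing
  (l + m) k_s as l k_s + m k_r minus m (k_r - k_s), where the last difference is again a shifted
  kernel.\<close>

lemma mvn_kernel_lincomb_lower_bound:
  fixes \<alpha> H :: real
  assumes \<alpha>: "0 < \<alpha>" "\<alpha> \<le> 2"
    and int: "\<And>t. 0 \<le> t \<Longrightarrow> integrable lborel (\<lambda>u. \<bar>mvn_kernel (H - 1 / \<alpha>) t u\<bar> powr \<alpha>)"
  shows "\<exists>\<kappa>>0. \<forall>s r l m. 0 < s \<longrightarrow> s < r \<longrightarrow>
    \<kappa> * (s powr (\<alpha> * H) * \<bar>l + m\<bar> powr \<alpha> + (r - s) powr (\<alpha> * H) * \<bar>m\<bar> powr \<alpha>)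
    \<le> (LINT u|lborel. \<bar>l * mvn_kernel (H - 1 / \<alpha>) s u + m * mvn_kernel (H - 1 / \<alpha>) r u\<bar> powr \<alpha>)"
proof -
  let ?k = "mvn_kernel (H - 1 / \<alpha>)"
  define C1 where "C1 = (LINT u|lborel. \<bar>?k 1 u\<bar> powr \<alpha>)"
  \<comment> \<open>The mass on the innovation side u > 0. It is positive because the kernel is (1 -
    u)^\<gamma> on the interval from 0 to 1.\<close>
  define C2 where "C2 = (LINT u|lborel. indicator {0<..} u * \<bar>?k 1 u\<bar> powr \<alpha>)"
  have tot: "(LINT u|lborel. \<bar>?k h u\<bar> powr \<alpha>) = h powr (\<alpha> * H) * C1" if "0 < h" for h
    using mvn_kernel_self_similar[OF \<alpha>(1) that, of True H] by (simp add: C1_def)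
  have half: "(LINT u|lborel. indicator {0<..} u * \<bar>?k h u\<bar> powr \<alpha>) = h powr (\<alpha> * H) * C2" if "0 < h" for h
    using mvn_kernel_self_similar[OF \<alpha>(1) that, of False H] by (simp add: C2_def greaterThan_def)
  have inth: "integrable lborel (\<lambda>u. indicator {0<..} u * \<bar>?k h u\<bar> powr \<alpha>)" if "0 \<le> h" for h
    using integrable_mult_indicator[OF _ int[OF that], of "{0<..}"] by simp
  have "C2 \<le> C1" unfolding C1_def C2_def
    using int[of 1] inth[of 1] by (intro integral_mono) (auto simp: indicator_def)
  have "C2 > 0"
  proof -
    have "C2 \<ge> 0" unfolding C2_def by (intro integral_nonneg_AE) auto
    moreover have "C2 \<noteq> 0"
    proof
      assume "C2 = 0"
      then have "AE u in lborel. indicator {0<..} u * \<bar>?k 1 u\<bar> powr \<alpha> = 0"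
        using integral_nonneg_eq_0_iff_AE[OF inth[of 1]] by (simp add: C2_def)
      then have "AE u in lborel. u \<notin> {0<..<1::real}"
        by eventually_elim (auto simp: mvn_kernel_def pos_powr_def)
      then have "emeasure lborel {0<..<1::real} = 0"
        by (subst (asm) AE_iff_measurable[of "{0<..<1::real}"]) auto
      then show False by simp
    qed
    ultimately show ?thesis by simp
  qed
  \<comment> \<open>With the abbreviations below, \<open>?Q\<close> \<le> \<open>?N / C2\<close> and
    \<open>?P\<close> \<le> \<open>4 * ?N / C1 + 4 * ?Q\<close>; adding them gives the factor 4 / C1
    + 4 / C2 + 1 / C2.\<close>
  define \<kappa> where "\<kappa> = 1 / (4 / C1 + 5 / C2)"
  have "\<kappa> > 0" using \<open>C2 > 0\<close> \<open>C2 \<le> C1\<close> by (simp add: \<kappa>_def add_pos_pos)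
  moreover have "\<kappa> * (s powr (\<alpha> * H) * \<bar>l + m\<bar> powr \<alpha> + (r - s) powr (\<alpha> * H) * \<bar>m\<bar> powr \<alpha>)
    \<le> (LINT u|lborel. \<bar>l * ?k s u + m * ?k r u\<bar> powr \<alpha>)" if s: "0 < s" "s < r" for s r l m
  proof -
    let ?N = "LINT u|lborel. \<bar>l * ?k s u + m * ?k r u\<bar> powr \<alpha>"
    let ?P = "s powr (\<alpha> * H) * \<bar>l + m\<bar> powr \<alpha>" and ?Q = "(r - s) powr (\<alpha> * H) * \<bar>m\<bar> powr \<alpha>"
    have intN: "integrable lborel (\<lambda>u. \<bar>l * ?k s u + m * ?k r u\<bar> powr \<alpha>)"
    proof (rule Bochner_Integration.integrable_bound)
      show "integrable lborel (\<lambda>u. 4 * (\<bar>l\<bar> powr \<alpha> * \<bar>?k s u\<bar> powr \<alpha> + \<bar>m\<bar> powr \<alpha> * \<bar>?k r u\<bar> powr \<alpha>))"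
        using int s by auto
      show "AE u in lborel. norm (\<bar>l * ?k s u + m * ?k r u\<bar> powr \<alpha>)
        \<le> norm (4 * (\<bar>l\<bar> powr \<alpha> * \<bar>?k s u\<bar> powr \<alpha> + \<bar>m\<bar> powr \<alpha> * \<bar>?k r u\<bar> powr \<alpha>))"
        using abs_add_powr_le[OF \<alpha>, of "l * ?k s _" "m * ?k r _"]
        by (auto intro!: AE_I2 simp: abs_mult powr_mult)
    qed measurable
    have shift: "integrable lborel (\<lambda>u. \<bar>?k (r - s) (u - s)\<bar> powr \<alpha>)"
      using lborel_integrable_real_affine[OF int[of "r - s"], of 1 "- s"] s by simp
    have shift2: "(LINT u|lborel. \<bar>?k (r - s) (u - s)\<bar> powr \<alpha>) = (r - s) powr (\<alpha> * H) * C1"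
      using lborel_integral_real_affine[of 1 "\<lambda>u. \<bar>?k (r - s) u\<bar> powr \<alpha>" "- s"] tot[of "r - s"] s by simp
    have sh: "integrable lborel (\<lambda>u. indicator {0<..} (u - s) * \<bar>?k (r - s) (u - s)\<bar> powr \<alpha>)"
      using lborel_integrable_real_affine[OF inth[of "r - s"], of 1 "- s"] s by simp
    have sh2: "(LINT u|lborel. indicator {0<..} (u - s) * \<bar>?k (r - s) (u - s)\<bar> powr \<alpha>) = (r - s) powr (\<alpha> * H) * C2"
      using lborel_integral_real_affine[of 1 "\<lambda>u. indicator {0<..} u * \<bar>?k (r - s) u\<bar> powr \<alpha>" "- s"] half[of "r - s"] s by simp
    have Q: "C2 * ?Q \<le> ?N"
    proof -
      have "C2 * ?Q = (LINT u|lborel. \<bar>m\<bar> powr \<alpha> * (indicator {0<..} (u - s) * \<bar>?k (r - s) (u - s)\<bar> powr \<alpha>))"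
        by (simp add: sh2)
      also have "\<dots> \<le> ?N"
      proof (rule integral_mono[OF _ intN])
        fix u
        show "\<bar>m\<bar> powr \<alpha> * (indicator {0<..} (u - s) * \<bar>?k (r - s) (u - s)\<bar> powr \<alpha>)
          \<le> \<bar>l * ?k s u + m * ?k r u\<bar> powr \<alpha>"
        proof (cases "s < u")
          case True
          then have "?k s u = 0" "?k (r - s) (u - s) = ?k r u"
            using s by (auto simp: mvn_kernel_def pos_powr_def)
          then show ?thesis using True by (simp add: abs_mult powr_mult)
        qed simp
      qed (use sh in auto)
      finally show ?thesis .
    qed
    have P: "C1 * ?P \<le> 4 * (?N + C1 * ?Q)"
    proof -
      have "C1 * ?P = (LINT u|lborel. \<bar>l + m\<bar> powr \<alpha> * \<bar>?k s u\<bar> powr \<alpha>)"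
        using tot[OF s(1)] by simp
      also have "\<dots> \<le> (LINT u|lborel. 4 * (\<bar>l * ?k s u + m * ?k r u\<bar> powr \<alpha> + \<bar>m\<bar> powr \<alpha> * \<bar>?k (r - s) (u - s)\<bar> powr \<alpha>))"
      proof (rule integral_mono)
        fix u
        have "(l + m) * ?k s u = (l * ?k s u + m * ?k r u) + (- m) * ?k (r - s) (u - s)"
          unfolding mvn_kernel_diff[symmetric] by (simp add: algebra_simps)
        then have "\<bar>(l + m) * ?k s u\<bar> powr \<alpha> \<le> 4 * (\<bar>l * ?k s u + m * ?k r u\<bar> powr \<alpha> + \<bar>(- m) * ?k (r - s) (u - s)\<bar> powr \<alpha>)"
          using abs_add_powr_le[OF \<alpha>] by metis
        then show "\<bar>l + m\<bar> powr \<alpha> * \<bar>?k s u\<bar> powr \<alpha> \<le> 4 * (\<bar>l * ?k s u + m * ?k r u\<bar> powr \<alpha> + \<bar>m\<bar> powr \<alpha> * \<bar>?k (r - s) (u - s)\<bar> powr \<alpha>)"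
          by (simp add: abs_mult powr_mult)
      qed (use int[of s] s intN shift in auto)
      also have "\<dots> = 4 * (?N + C1 * ?Q)" using intN shift by (simp add: shift2)
      finally show ?thesis .
    qed
    have C: "C1 > 0" "C2 > 0" using \<open>C2 > 0\<close> \<open>C2 \<le> C1\<close> by auto
    have "?Q \<le> ?N / C2" using Q C by (simp add: field_simps)
    moreover have "?P \<le> 4 * ?N / C1 + 4 * ?Q" using P C by (simp add: field_simps)
    ultimately have "?P + ?Q \<le> (4 / C1 + 5 / C2) * ?N" by (simp add: distrib_right)
    moreover have "4 / C1 + 5 / C2 > 0" using C by (simp add: add_pos_pos)
    ultimately show ?thesis unfolding \<kappa>_def by (simp add: field_simps)
  qed
  ultimately show ?thesis by blast
qed

text \<open>The first bound is the strong local nondeterminism of the process.\<close>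

lemma lfsm_char_bounds:
  assumes X: "lfsm M \<alpha> H X"
  shows "\<exists>\<kappa> C. 0 < \<kappa> \<and>
    (\<forall>s r l m. 0 < s \<longrightarrow> s < r \<longrightarrow> norm (LINT \<omega>|M. iexp (l * X s \<omega> + m * X r \<omega>))
       \<le> exp (- \<kappa> * (s powr (\<alpha> * H) * \<bar>l + m\<bar> powr \<alpha> + (r - s) powr (\<alpha> * H) * \<bar>m\<bar> powr \<alpha>))) \<and>
    (\<forall>s r l. 0 \<le> s \<longrightarrow> s < r \<longrightarrow> norm (1 - (LINT \<omega>|M. iexp (l * (X r \<omega> - X s \<omega>))))
       \<le> C * \<bar>l\<bar> powr \<alpha> * (r - s) powr (\<alpha> * H))"
proof -
  let ?B = "\<lambda>s r l m. s powr (\<alpha> * H) * \<bar>l + m\<bar> powr \<alpha> + (r - s) powr (\<alpha> * H) * \<bar>m\<bar> powr \<alpha>"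
  obtain b Z a where Z: "stable_levy_motion M \<alpha> b Z" and a: "a \<noteq> 0"
    and rep: "\<And>t. 0 \<le> t \<Longrightarrow> has_stable_integral M \<alpha> Z (\<lambda>u. a * mvn_kernel (H - 1 / \<alpha>) t u) (X t)"
    using lfsm_has_stable_integral[OF X] by blast
  have \<alpha>: "0 < \<alpha>" "\<alpha> \<le> 2" using Z by (auto simp: stable_levy_motion_def)
  let ?k = "mvn_kernel (H - 1 / \<alpha>)"
  have int: "integrable lborel (\<lambda>u. \<bar>?k t u\<bar> powr \<alpha>)" if "0 \<le> t" for t
    using rep[OF that] a by (simp add: has_stable_integral_def abs_mult powr_mult)
  obtain \<kappa>0 where \<kappa>0: "\<kappa>0 > 0" and low: "\<And>s r l m. 0 < s \<Longrightarrow> s < r \<Longrightarrow>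
    \<kappa>0 * ?B s r l m
    \<le> (LINT u|lborel. \<bar>l * ?k s u + m * ?k r u\<bar> powr \<alpha>)"
    using mvn_kernel_lincomb_lower_bound[OF \<alpha> int] by blast
  have comb: "has_stable_integral M \<alpha> Z (\<lambda>u. a * (l * ?k s u + m * ?k r u)) (\<lambda>\<omega>. l * X s \<omega> + m * X r \<omega>)"
    if "0 \<le> s" "0 \<le> r" for s r l m
    using has_stable_integral_lincomb[OF Z rep[OF that(1)] rep[OF that(2)], of l m]
    by (simp add: algebra_simps)
  have J: "(LINT u|lborel. \<bar>a * (l * ?k s u + m * ?k r u)\<bar> powr \<alpha>)
     = \<bar>a\<bar> powr \<alpha> * (LINT u|lborel. \<bar>l * ?k s u + m * ?k r u\<bar> powr \<alpha>)" for l m s r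
    by (simp add: abs_mult powr_mult)
  \<comment> \<open>The factor |a|^\<alpha> comes out of the kernel, and the 4 is the loss in
    \<open>stable_integral_char\<close>.\<close>
  define \<kappa> where "\<kappa> = \<bar>a\<bar> powr \<alpha> * \<kappa>0 / 4"
  define C where "C = 4 * (1 + \<bar>tan (pi * \<alpha> / 2)\<bar>) * \<bar>a\<bar> powr \<alpha> * (LINT u|lborel. \<bar>?k 1 u\<bar> powr \<alpha>)"
  have "\<kappa> > 0" using a \<kappa>0 by (simp add: \<kappa>_def)
  moreover have "norm (LINT \<omega>|M. iexp (l * X s \<omega> + m * X r \<omega>))
       \<le> exp (- \<kappa> * ?B s r l m)"
    if s: "0 < s" "s < r" for s r l m
  proof -
    have "norm (LINT \<omega>|M. iexp (l * X s \<omega> + m * X r \<omega>))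
      \<le> exp (- (LINT u|lborel. \<bar>a * (l * ?k s u + m * ?k r u)\<bar> powr \<alpha>) / 4)"
      using stable_integral_char(1)[OF Z comb] s by simp
    also have "\<dots> \<le> exp (- \<kappa> * ?B s r l m)"
      unfolding J using mult_left_mono[OF low[OF s, of l m], of "\<bar>a\<bar> powr \<alpha>"]
      by (simp add: \<kappa>_def algebra_simps)
    finally show ?thesis .
  qed
  moreover have "norm (1 - (LINT \<omega>|M. iexp (l * (X r \<omega> - X s \<omega>)))) \<le> C * \<bar>l\<bar> powr \<alpha> * (r - s) powr (\<alpha> * H)"
    if s: "0 \<le> s" "s < r" for s r l
  proof -
    have "(LINT u|lborel. \<bar>- l * ?k s u + l * ?k r u\<bar> powr \<alpha>) = (LINT u|lborel. \<bar>l\<bar> powr \<alpha> * \<bar>?k (r - s) (u - s)\<bar> powr \<alpha>)"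
      unfolding mvn_kernel_diff[symmetric] powr_mult[symmetric] abs_mult[symmetric]
      by (simp add: algebra_simps)
    also have "\<dots> = \<bar>l\<bar> powr \<alpha> * (LINT u|lborel. \<bar>?k (r - s) u\<bar> powr \<alpha>)"
      using lborel_integral_real_affine[of 1 "\<lambda>u. \<bar>?k (r - s) u\<bar> powr \<alpha>" "- s"] by simp
    also have "\<dots> = \<bar>l\<bar> powr \<alpha> * ((r - s) powr (\<alpha> * H) * (LINT u|lborel. \<bar>?k 1 u\<bar> powr \<alpha>))"
      using mvn_kernel_self_similar[OF \<alpha>(1), of "r - s" True H] s by simp
    finally have N: "(LINT u|lborel. \<bar>- l * ?k s u + l * ?k r u\<bar> powr \<alpha>) = \<dots>" .
    have "norm (1 - (LINT \<omega>|M. iexp (- l * X s \<omega> + l * X r \<omega>))) \<le> 4 * (1 + \<bar>tan (pi * \<alpha> / 2)\<bar>) *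
       (LINT u|lborel. \<bar>a * (- l * ?k s u + l * ?k r u)\<bar> powr \<alpha>)"
      using stable_integral_char(2)[OF Z comb, of s r "- l" l] s by simp
    also have "\<dots> = C * \<bar>l\<bar> powr \<alpha> * (r - s) powr (\<alpha> * H)"
      unfolding J N C_def by (simp add: algebra_simps)
    finally show ?thesis by (simp add: algebra_simps)
  qed
  ultimately show ?thesis by blast
qed

section \<open>Densities by Fourier inversion in the plane\<close>

lemma has_bochner_integral_pair_mult:
  fixes f :: "'a \<Rightarrow> 'c::{real_normed_field, banach, second_countable_topology}" and g :: "'b \<Rightarrow> 'c"
  assumes "sigma_finite_measure M" "sigma_finite_measure N"
    and f: "has_bochner_integral M f a" and g: "has_bochner_integral N g b"
  shows "has_bochner_integral (M \<Otimes>\<^sub>M N) (\<lambda>x. f (fst x) * g (snd x)) (a * b)"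
proof -
  interpret pair_sigma_finite M N using assms by (simp add: pair_sigma_finite_def)
  have fg: "integrable M f" "integrable N g" "integral\<^sup>L M f = a" "integral\<^sup>L N g = b"
    using f g by (auto simp: has_bochner_integral_iff)
  have [measurable]: "f \<in> borel_measurable M" "g \<in> borel_measurable N" using fg by auto
  have int: "integrable (M \<Otimes>\<^sub>M N) (\<lambda>x. f (fst x) * g (snd x))"
  proof (rule Fubini_integrable)
    show "integrable M (\<lambda>x. LINT y|N. norm (f (fst (x, y)) * g (snd (x, y))))"
      using fg by (auto simp: norm_mult)
  qed (use fg in auto)
  have "(\<integral>x. f (fst x) * g (snd x) \<partial>(M \<Otimes>\<^sub>M N)) = (LINT x|M. LINT y|N. f x * g y)"
    using integral_fst'[OF int] by simp
  also have "\<dots> = a * b" using fg by simp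
  finally show ?thesis using int by (simp add: has_bochner_integral_iff)
qed

lemma normal_density_fourier:
  fixes v \<sigma> :: real
  assumes "0 < \<sigma>"
  shows "has_bochner_integral lborel (\<lambda>l. iexp (l * v) * complex_of_real (exp (- (\<sigma> * l)\<^sup>2 / 2)))
    (complex_of_real (2 * pi * normal_density 0 \<sigma> v))"
proof -
  have norm_eq: "exp (- l\<^sup>2 / 2) = sqrt (2 * pi) * std_normal_density l" for l :: real
    by (simp add: std_normal_density_def)
  have int: "integrable lborel (\<lambda>l. iexp (l * w) * complex_of_real (exp (- l\<^sup>2 / 2)))" for w
  proof (rule Bochner_Integration.integrable_bound)
    show "integrable lborel (\<lambda>l. sqrt (2 * pi) * std_normal_density l)"
      using integrable_std_normal_moment[of 0] by simp
  qed (auto simp: norm_mult norm_eq[unfolded minus_divide_left[symmetric]] intro!: AE_I2)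
  have val: "(LINT l|lborel. iexp (l * w) * complex_of_real (exp (- l\<^sup>2 / 2))) = complex_of_real (sqrt (2 * pi) * exp (- w\<^sup>2 / 2))" for w
  proof -
    have "complex_of_real (exp (- w\<^sup>2 / 2)) = (LINT l|std_normal_distribution. iexp (w * l))"
      using fun_cong[OF char_std_normal_distribution, of w] by (simp add: char_def)
    also have "\<dots> = (LINT l|lborel. std_normal_density l *\<^sub>R iexp (w * l))"
      by (rule integral_density) auto
    finally have "complex_of_real (sqrt (2 * pi)) * complex_of_real (exp (- w\<^sup>2 / 2))
      = (LINT l|lborel. complex_of_real (sqrt (2 * pi)) * (std_normal_density l *\<^sub>R iexp (w * l)))"
      by (simp only: integral_mult_right_zero)
    also have "(\<lambda>l. complex_of_real (sqrt (2 * pi)) * (std_normal_density l *\<^sub>R iexp (w * l)))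
       = (\<lambda>l. iexp (l * w) * complex_of_real (exp (- l\<^sup>2 / 2)))"
      unfolding norm_eq by (auto simp: scaleR_conv_of_real algebra_simps)
    finally show ?thesis by simp
  qed
  let ?f = "\<lambda>l. iexp (l * (v / \<sigma>)) * complex_of_real (exp (- l\<^sup>2 / 2))"
  have "has_bochner_integral lborel ?f (complex_of_real (sqrt (2 * pi) * exp (- (v / \<sigma>)\<^sup>2 / 2)))"
    using int[of "v / \<sigma>"] val[of "v / \<sigma>"] by (simp only: has_bochner_integral_iff simp_thms)
  then have "has_bochner_integral lborel (\<lambda>l. ?f (0 + \<sigma> * l)) (complex_of_real (sqrt (2 * pi) * exp (- (v / \<sigma>)\<^sup>2 / 2)) /\<^sub>R \<bar>\<sigma>\<bar>)"
    using assms by (subst (asm) lborel_has_bochner_integral_real_affine_iff[of \<sigma> _ _ 0]) auto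
  moreover have "complex_of_real (sqrt (2 * pi) * exp (- (v / \<sigma>)\<^sup>2 / 2)) /\<^sub>R \<bar>\<sigma>\<bar> = complex_of_real (2 * pi * normal_density 0 \<sigma> v)"
  proof -
    have "sqrt (2 * pi) = 2 * pi / sqrt (2 * pi)"
      using real_sqrt_mult_self[of "2 * pi"] by (simp add: field_simps)
    then have "sqrt (2 * pi) * exp (- (v / \<sigma>)\<^sup>2 / 2) / \<sigma> = 2 * pi * normal_density 0 \<sigma> v"
      using assms by (simp add: normal_density_def real_sqrt_mult power_divide field_simps)
    then show ?thesis using assms by (simp add: scaleR_conv_of_real divide_inverse[symmetric] flip: of_real_mult of_real_inverse) (simp add: field_simps)
  qed
  moreover have "(\<lambda>l. ?f (0 + \<sigma> * l)) = (\<lambda>l. iexp (l * v) * complex_of_real (exp (- (\<sigma> * l)\<^sup>2 / 2)))"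
    using assms by (auto simp: field_simps)
  ultimately show ?thesis by simp
qed

abbreviation lborel2 :: "(real \<times> real) measure" where
  "lborel2 \<equiv> lborel \<Otimes>\<^sub>M lborel"

text \<open>Inverse Fourier transform in the plane. Taking the real part makes it a candidate
  density at once, without a separate argument that the integral is real.\<close>

definition fourier_inv :: "(real \<times> real \<Rightarrow> complex) \<Rightarrow> real \<times> real \<Rightarrow> real" where
  "fourier_inv \<phi> w = Re (LINT \<xi>|lborel2. iexp (- (fst \<xi> * fst w + snd \<xi> * snd w)) * \<phi> \<xi>) / (2 * pi)\<^sup>2"

definition char2 :: "'w measure \<Rightarrow> ('w \<Rightarrow> real) \<Rightarrow> ('w \<Rightarrow> real) \<Rightarrow> real \<times> real \<Rightarrow> complex" where
  "char2 M U V \<xi> = (LINT \<omega>|M. iexp (fst \<xi> * U \<omega> + snd \<xi> * V \<omega>))"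

lemma abs_fourier_inv_le:
  "\<bar>fourier_inv \<phi> w\<bar> \<le> (LINT \<xi>|lborel2. norm (\<phi> \<xi>)) / (2 * pi)\<^sup>2"
proof -
  have "norm (LINT \<xi>|lborel2. iexp (- (fst \<xi> * fst w + snd \<xi> * snd w)) * \<phi> \<xi>)
     \<le> (LINT \<xi>|lborel2. norm (iexp (- (fst \<xi> * fst w + snd \<xi> * snd w)) * \<phi> \<xi>))"
    by (rule integral_norm_bound)
  also have "\<dots> = (LINT \<xi>|lborel2. norm (\<phi> \<xi>))" by (simp add: norm_mult)
  finally have "\<bar>Re (LINT \<xi>|lborel2. iexp (- (fst \<xi> * fst w + snd \<xi> * snd w)) * \<phi> \<xi>)\<bar> \<le> (LINT \<xi>|lborel2. norm (\<phi> \<xi>))"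
    using abs_Re_le_cmod order_trans by blast
  then show ?thesis unfolding fourier_inv_def by (simp add: divide_right_mono)
qed

text \<open>The point varies together with the transform because the rescaled test functions will
  look at the density at x + v / b n and not at x itself.\<close>

lemma fourier_inv_tendsto:
  fixes \<phi> :: "nat \<Rightarrow> real \<times> real \<Rightarrow> complex"
  assumes "\<And>n. \<phi> n \<in> borel_measurable lborel2" "\<psi> \<in> borel_measurable lborel2" "integrable lborel2 D"
    and "\<And>\<xi>. (\<lambda>n. \<phi> n \<xi>) \<longlonglongrightarrow> \<psi> \<xi>" "\<And>n \<xi>. norm (\<phi> n \<xi>) \<le> D \<xi>"
    and w: "w \<longlonglongrightarrow> w'"
  shows "(\<lambda>n. fourier_inv (\<phi> n) (w n)) \<longlonglongrightarrow> fourier_inv \<psi> w'"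
  unfolding fourier_inv_def
proof (intro tendsto_divide tendsto_Re tendsto_const integral_dominated_convergence[where w = D])
  show "AE \<xi> in lborel2. (\<lambda>n. iexp (- (fst \<xi> * fst (w n) + snd \<xi> * snd (w n))) * \<phi> n \<xi>)
      \<longlonglongrightarrow> iexp (- (fst \<xi> * fst w' + snd \<xi> * snd w')) * \<psi> \<xi>"
    using assms(4) w by (auto intro!: AE_I2 tendsto_intros)
qed (use assms in \<open>auto simp: norm_mult\<close>)

lemma fourier_inv_measurable:
  assumes [measurable]: "\<phi> \<in> borel_measurable lborel2"
  shows "fourier_inv \<phi> \<in> borel_measurable lborel2"
proof -
  interpret sigma_finite_measure lborel2
    by (rule sigma_finite_pair_measure) unfold_locales
  show ?thesis unfolding fourier_inv_def by measurable
qed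

context prob_space
begin

lemma char2_measurable:
  assumes [measurable]: "U \<in> borel_measurable M" "V \<in> borel_measurable M"
  shows "char2 M U V \<in> borel_measurable lborel2"
  unfolding char2_def by measurable

text \<open>The smoothed law has the characteristic function multiplied by a Gaussian. That factor
  alone makes the double integral absolutely convergent, so Fubini applies to arbitrary
  \<open>U\<close> and \<open>V\<close>; integrability of the characteristic function matters only
  when the smoothing is removed.\<close>

lemma gaussian_smoothing:
  fixes U V :: "'a \<Rightarrow> real"
  assumes [measurable]: "U \<in> borel_measurable M" "V \<in> borel_measurable M" and \<sigma>: "0 < \<sigma>"
  shows "(LINT \<omega>|M. normal_density 0 \<sigma> (fst w - U \<omega>) * normal_density 0 \<sigma> (snd w - V \<omega>))
    = fourier_inv (\<lambda>\<xi>. char2 M U V \<xi> * complex_of_real (exp (- (\<sigma> * fst \<xi>)\<^sup>2 / 2) * exp (- (\<sigma> * snd \<xi>)\<^sup>2 / 2))) w"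
proof -
  let ?e = "\<lambda>\<xi>. exp (- (\<sigma> * fst \<xi>)\<^sup>2 / 2) * exp (- (\<sigma> * snd \<xi>)\<^sup>2 / 2)"
  let ?i = "\<lambda>\<xi>. iexp (- (fst \<xi> * fst w + snd \<xi> * snd w))"
  interpret L: sigma_finite_measure lborel2
    by (rule sigma_finite_pair_measure) unfold_locales
  interpret P: pair_sigma_finite M lborel2 by unfold_locales
  let ?n = "normal_density 0 \<sigma>"
  let ?h = "\<lambda>v l. iexp (l * v) * complex_of_real (exp (- (\<sigma> * l)\<^sup>2 / 2))"
  let ?F = "\<lambda>\<omega> \<xi>. ?h (U \<omega> - fst w) (fst \<xi>) * ?h (V \<omega> - snd w) (snd \<xi>)"
  have sf: "sigma_finite_measure (lborel :: real measure)" by unfold_locales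
  have hb: "has_bochner_integral lborel2 (?F \<omega>) (complex_of_real (2 * pi * ?n (U \<omega> - fst w)) * complex_of_real (2 * pi * ?n (V \<omega> - snd w)))" for \<omega>
    by (intro has_bochner_integral_pair_mult sf normal_density_fourier \<sigma>)
  have nF: "norm (?F \<omega> \<xi>) = ?e \<xi>" for \<omega> \<xi>
    by (simp add: norm_mult)
  have intG: "integrable lborel2 (\<lambda>\<xi>. ?e \<xi>)"
  proof -
    obtain \<omega> where "\<omega> \<in> space M" using not_empty by auto
    have "integrable lborel2 (\<lambda>\<xi>. norm (?F \<omega> \<xi>))" using hb[of \<omega>] by (simp add: has_bochner_integral_iff)
    then show ?thesis unfolding nF .
  qed
  have int: "integrable (M \<Otimes>\<^sub>M lborel2) (\<lambda>(\<omega>, \<xi>). ?F \<omega> \<xi>)"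
  proof (rule P.Fubini_integrable)
    show "integrable M (\<lambda>\<omega>. LINT \<xi>|lborel2. norm (case (\<omega>, \<xi>) of (\<omega>, \<xi>) \<Rightarrow> ?F \<omega> \<xi>))"
      by (simp only: prod.case nF) simp
    show "AE \<omega> in M. integrable lborel2 (\<lambda>\<xi>. case (\<omega>, \<xi>) of (\<omega>, \<xi>) \<Rightarrow> ?F \<omega> \<xi>)"
      using hb by (auto simp: has_bochner_integral_iff)
  qed measurable
  have "(LINT \<omega>|M. complex_of_real ((2 * pi)\<^sup>2 * (?n (U \<omega> - fst w) * ?n (V \<omega> - snd w)))) = (LINT \<omega>|M. LINT \<xi>|lborel2. ?F \<omega> \<xi>)"
    using hb by (intro Bochner_Integration.integral_cong) (auto simp: has_bochner_integral_iff power2_eq_square)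
  also have "\<dots> = (LINT \<xi>|lborel2. LINT \<omega>|M. ?F \<omega> \<xi>)"
    using P.Fubini_integral[OF int] by simp
  also have "(\<lambda>\<xi>. LINT \<omega>|M. ?F \<omega> \<xi>) = (\<lambda>\<xi>. ?i \<xi> * (char2 M U V \<xi> * complex_of_real (?e \<xi>)))"
  proof
    fix \<xi> :: "real \<times> real"
    have "?F \<omega> \<xi> = (?i \<xi> * complex_of_real (?e \<xi>)) * iexp (fst \<xi> * U \<omega> + snd \<xi> * V \<omega>)" for \<omega>
    proof -
      have "iexp (fst \<xi> * (U \<omega> - fst w)) * iexp (snd \<xi> * (V \<omega> - snd w)) = ?i \<xi> * iexp (fst \<xi> * U \<omega> + snd \<xi> * V \<omega>)"
        unfolding exp_add[symmetric] by (simp add: algebra_simps)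
      then show ?thesis by (simp add: algebra_simps)
    qed
    then have "(LINT \<omega>|M. ?F \<omega> \<xi>) = (?i \<xi> * complex_of_real (?e \<xi>)) * char2 M U V \<xi>"
      unfolding char2_def integral_mult_right_zero[symmetric]
      by (intro Bochner_Integration.integral_cong refl)
    then show "(LINT \<omega>|M. ?F \<omega> \<xi>) = ?i \<xi> * (char2 M U V \<xi> * complex_of_real (?e \<xi>))"
      by (simp only: mult_ac)
  qed
  finally have "complex_of_real ((2 * pi)\<^sup>2 * (LINT \<omega>|M. ?n (U \<omega> - fst w) * ?n (V \<omega> - snd w))) =
     (LINT \<xi>|lborel2. ?i \<xi> * (char2 M U V \<xi> * complex_of_real (?e \<xi>)))"
    by (simp only: integral_complex_of_real integral_mult_right_zero)
  then have "(2 * pi)\<^sup>2 * (LINT \<omega>|M. ?n (U \<omega> - fst w) * ?n (V \<omega> - snd w)) =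
     Re (LINT \<xi>|lborel2. ?i \<xi> * (char2 M U V \<xi> * complex_of_real (?e \<xi>)))"
    by (metis Re_complex_of_real)
  moreover have "?n (a - b) = ?n (b - a)" for a b by (simp add: normal_density_def power2_commute)
  ultimately show ?thesis by (simp add: fourier_inv_def field_simps)
qed

end

section \<open>Removing the smoothing with continuous test functions\<close>

definition trapezoid :: "real \<Rightarrow> real \<Rightarrow> nat \<Rightarrow> real \<Rightarrow> real" where
  "trapezoid a b k y = max 0 (min 1 (real k * min (y - a) (b - y)))"

lemma integrable_indicator_Ioo: "integrable lborel (indicator {a<..<b} :: real \<Rightarrow> real)"
  using emeasure_lborel_box_finite[of a b] by (simp add: box_real)

lemma trapezoid_bounds: "0 \<le> trapezoid a b k y" "trapezoid a b k y \<le> indicator {a<..<b} y"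
proof -
  show "0 \<le> trapezoid a b k y" by (simp add: trapezoid_def)
  show "trapezoid a b k y \<le> indicator {a<..<b} y"
  proof (cases "y \<in> {a<..<b}")
    case False
    then have "real k * min (y - a) (b - y) \<le> 0" by (intro mult_nonneg_nonpos) auto
    then show ?thesis by (simp add: trapezoid_def)
  qed (simp add: trapezoid_def)
qed

lemma continuous_trapezoid: "continuous_on UNIV (trapezoid a b k)"
  unfolding trapezoid_def by (intro continuous_intros)

lemma trapezoid_measurable [measurable]: "trapezoid a b k \<in> borel_measurable borel"
  unfolding trapezoid_def by measurable

lemma trapezoid_tendsto: "(\<lambda>k. trapezoid a b k y) \<longlonglongrightarrow> indicator {a<..<b} y"
proof (cases "y \<in> {a<..<b}")
  case True
  define m where "m = min (y - a) (b - y)"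
  have "m > 0" using True by (simp add: m_def)
  have "eventually (\<lambda>k. real k \<ge> 1 / m) sequentially"
    using filterlim_real_sequentially by (simp add: filterlim_at_top)
  then have "eventually (\<lambda>k. trapezoid a b k y = 1) sequentially"
  proof eventually_elim
    case (elim k)
    then have "real k * m \<ge> 1" using \<open>m > 0\<close> by (simp add: field_simps)
    then show ?case by (simp add: trapezoid_def m_def[symmetric])
  qed
  then show ?thesis using True by (simp add: tendsto_eventually)
next
  case False
  then have "trapezoid a b k y = 0" for k using trapezoid_bounds[of a b k y] by simp
  then show ?thesis using False by simp
qed

text \<open>After the substitution y = u + \<sigma> n v this is dominated convergence. Convergence
  at every u, which is needed since the law of \<open>U\<close> is not yet known to be absolutely
  continuous, relies on continuity of g; this is why the trapezoids stand in for indicators.\<close>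

lemma normal_convolution_tendsto:
  fixes g :: "real \<Rightarrow> real" and \<sigma> :: "nat \<Rightarrow> real"
  assumes g: "continuous_on UNIV g" "\<And>y. \<bar>g y\<bar> \<le> B" and \<sigma>: "\<And>n. 0 < \<sigma> n" "\<sigma> \<longlonglongrightarrow> 0"
  shows "(\<lambda>n. LINT y|lborel. g y * normal_density 0 (\<sigma> n) (y - u)) \<longlonglongrightarrow> g u"
proof -
  have [measurable]: "g \<in> borel_measurable borel" using g(1) by (rule borel_measurable_continuous_onI)
  have eq: "(LINT y|lborel. g y * normal_density 0 (\<sigma> n) (y - u))
      = (LINT v|lborel. g (u + \<sigma> n * v) * std_normal_density v)" for n
  proof -
    have "\<sigma> n * normal_density 0 (\<sigma> n) (\<sigma> n * v) = std_normal_density v" for v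
      using \<sigma>(1)[of n] by (simp add: normal_density_def real_sqrt_mult power_mult_distrib)
    then have "\<sigma> n * (g (u + \<sigma> n * v) * normal_density 0 (\<sigma> n) (\<sigma> n * v)) = g (u + \<sigma> n * v) * std_normal_density v" for v
      by (metis mult.left_commute)
    note mult_eq = this
    have "(LINT y|lborel. g y * normal_density 0 (\<sigma> n) (y - u))
      = \<sigma> n * (LINT v|lborel. g (u + \<sigma> n * v) * normal_density 0 (\<sigma> n) (\<sigma> n * v))"
      using \<sigma>(1)[of n] by (subst lborel_integral_real_affine[of "\<sigma> n" _ u]) auto
    also have "\<dots> = (LINT v|lborel. \<sigma> n * (g (u + \<sigma> n * v) * normal_density 0 (\<sigma> n) (\<sigma> n * v)))"
      by (rule integral_mult_right_zero[symmetric])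
    finally show ?thesis unfolding mult_eq .
  qed
  have "(\<lambda>n. LINT v|lborel. g (u + \<sigma> n * v) * std_normal_density v) \<longlonglongrightarrow> (LINT v|lborel. g u * std_normal_density v)"
  proof (rule integral_dominated_convergence[where w = "\<lambda>v. B * std_normal_density v"])
    show "integrable lborel (\<lambda>v. B * std_normal_density v)" by simp
    have "(\<lambda>n. g (u + \<sigma> n * v)) \<longlonglongrightarrow> g u" for v
    proof (rule continuous_on_tendsto_compose[OF g(1)])
      show "(\<lambda>n. u + \<sigma> n * v) \<longlonglongrightarrow> u"
        using tendsto_add[OF tendsto_const tendsto_mult_right[OF \<sigma>(2)], of u v] by simp
    qed auto
    then show "AE v in lborel. (\<lambda>n. g (u + \<sigma> n * v) * std_normal_density v) \<longlonglongrightarrow> g u * std_normal_density v"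
      by (intro AE_I2 tendsto_mult tendsto_const)
    show "AE v in lborel. norm (g (u + \<sigma> n * v) * std_normal_density v) \<le> B * std_normal_density v" for n
      using g(2) by (auto intro!: AE_I2 mult_right_mono simp: abs_mult)
  qed measurable
  then show ?thesis by (simp add: eq)
qed

context prob_space
begin

text \<open>The Gaussian factors tend to 1 and are at most 1, so the modulus of the characteristic
  function dominates. The bound on \<open>q n\<close> does not depend on n and supplies the
  dominating function for the passage to the limit in the density.\<close>

lemma gaussian_smoothing_tendsto:
  fixes U V :: "'a \<Rightarrow> real" and \<sigma> :: "nat \<Rightarrow> real"
  assumes [measurable]: "U \<in> borel_measurable M" "V \<in> borel_measurable M"
    and int: "integrable lborel2 (char2 M U V)"
    and \<sigma>: "\<And>n. 0 < \<sigma> n" "\<sigma> \<longlonglongrightarrow> 0"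
  defines "q \<equiv> \<lambda>n w. LINT \<omega>|M. normal_density 0 (\<sigma> n) (fst w - U \<omega>) * normal_density 0 (\<sigma> n) (snd w - V \<omega>)"
  shows "(\<lambda>n. q n w) \<longlonglongrightarrow> fourier_inv (char2 M U V) w"
    and "0 \<le> q n w" and "q n w \<le> (LINT \<xi>|lborel2. norm (char2 M U V \<xi>)) / (2 * pi)\<^sup>2"
    and "q n \<in> borel_measurable lborel2"
proof -
  note [measurable] = char2_measurable[OF assms(1,2)]
  define e where "e n \<xi> = exp (- (\<sigma> n * fst \<xi>)\<^sup>2 / 2) * exp (- (\<sigma> n * snd \<xi>)\<^sup>2 / 2)" for n and \<xi> :: "real \<times> real"
  have [measurable]: "e n \<in> borel_measurable lborel2" for n unfolding e_def by measurable
  have e: "0 \<le> e n \<xi>" "e n \<xi> \<le> 1" for n \<xi> by (auto simp: e_def mult_le_one)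
  have q: "q n w = fourier_inv (\<lambda>\<xi>. char2 M U V \<xi> * complex_of_real (e n \<xi>)) w" for n w
    unfolding q_def e_def by (rule gaussian_smoothing) (use \<sigma> in auto)
  have le: "norm (char2 M U V \<xi> * complex_of_real (e n \<xi>)) \<le> norm (char2 M U V \<xi>)" for n \<xi>
    using e[of n \<xi>] by (simp add: norm_mult mult_left_le)
  have e_lim: "(\<lambda>n. e n \<xi>) \<longlonglongrightarrow> 1" for \<xi>
  proof -
    have "(\<lambda>n. exp (- (\<sigma> n * fst \<xi>)\<^sup>2 / 2) * exp (- (\<sigma> n * snd \<xi>)\<^sup>2 / 2)) \<longlonglongrightarrow> exp (- (0 * fst \<xi>)\<^sup>2 / 2) * exp (- (0 * snd \<xi>)\<^sup>2 / 2)"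
      by (intro tendsto_intros \<sigma>) auto
    then show ?thesis by (simp add: e_def)
  qed
  show "(\<lambda>n. q n w) \<longlonglongrightarrow> fourier_inv (char2 M U V) w"
    unfolding q
  proof (rule fourier_inv_tendsto[where D = "\<lambda>\<xi>. norm (char2 M U V \<xi>)"])
    show "(\<lambda>n. char2 M U V \<xi> * complex_of_real (e n \<xi>)) \<longlonglongrightarrow> char2 M U V \<xi>" for \<xi>
      using tendsto_mult[OF tendsto_const tendsto_of_real[OF e_lim]] by fastforce
  qed (use int le in auto)
  show "0 \<le> q n w" unfolding q_def by (intro integral_nonneg_AE) auto
  have "q n w \<le> (LINT \<xi>|lborel2. norm (char2 M U V \<xi> * complex_of_real (e n \<xi>))) / (2 * pi)\<^sup>2"
    unfolding q using abs_fourier_inv_le abs_le_D1 by blast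
  also have "\<dots> \<le> (LINT \<xi>|lborel2. norm (char2 M U V \<xi>)) / (2 * pi)\<^sup>2"
  proof (intro divide_right_mono integral_mono)
    show "integrable lborel2 (\<lambda>\<xi>. norm (char2 M U V \<xi> * complex_of_real (e n \<xi>)))"
      by (rule Bochner_Integration.integrable_bound[OF int]) (use le in auto)
  qed (use int le in auto)
  finally show "q n w \<le> (LINT \<xi>|lborel2. norm (char2 M U V \<xi>)) / (2 * pi)\<^sup>2" .
  show "q n \<in> borel_measurable lborel2"
    unfolding q by (rule fourier_inv_measurable) measurable
qed

text \<open>Invisible in the oscillating integral; it is inherited from the smoothed densities,
  which are expectations of nonnegative functions.\<close>

lemma fourier_inv_char2_nonneg:
  fixes U V :: "'a \<Rightarrow> real"
  assumes "U \<in> borel_measurable M" "V \<in> borel_measurable M" "integrable lborel2 (char2 M U V)"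
  shows "0 \<le> fourier_inv (char2 M U V) w"
  by (rule LIMSEQ_le_const[OF gaussian_smoothing_tendsto(1)[OF assms, of "\<lambda>n. inverse (real (Suc n))"]])
    (use gaussian_smoothing_tendsto(2)[OF assms, of "\<lambda>n. inverse (real (Suc n))"] LIMSEQ_inverse_real_of_nat in auto)

text \<open>The integral of the test functions against the smoothed density is computed in two ways.
  The density tends to the inverse transform on one side; by Fubini the smoothing can be moved to
  the test functions on the other, and these converge because they are continuous.\<close>

lemma integral_trapezoids_fourier_inv:
  fixes U V :: "'a \<Rightarrow> real"
  assumes [measurable]: "U \<in> borel_measurable M" "V \<in> borel_measurable M"
    and int: "integrable lborel2 (char2 M U V)"
  shows "(LINT \<omega>|M. trapezoid a b k (U \<omega>) * trapezoid c d k (V \<omega>))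
    = (LINT w|lborel2. trapezoid a b k (fst w) * trapezoid c d k (snd w) * fourier_inv (char2 M U V) w)"
proof -
  interpret L: sigma_finite_measure lborel2
    by (rule sigma_finite_pair_measure) unfold_locales
  interpret P: pair_sigma_finite M lborel2 by unfold_locales
  define \<sigma> where "\<sigma> = (\<lambda>n. inverse (real (Suc n)))"
  have \<sigma>: "0 < \<sigma> n" "\<sigma> \<longlonglongrightarrow> 0" for n
    using LIMSEQ_inverse_real_of_nat by (simp_all add: \<sigma>_def del: of_nat_Suc)
  define q where "q n w = (LINT \<omega>|M. normal_density 0 (\<sigma> n) (fst w - U \<omega>) * normal_density 0 (\<sigma> n) (snd w - V \<omega>))" for n w
  note q = gaussian_smoothing_tendsto[OF assms, of \<sigma>, OF \<sigma>, folded q_def]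
  define K where "K = (LINT \<xi>|lborel2. norm (char2 M U V \<xi>)) / (2 * pi)\<^sup>2"
  let ?g = "trapezoid a b k" and ?h = "trapezoid c d k"
  note [measurable] = q(4) fourier_inv_measurable[OF char2_measurable[OF assms(1,2)]]
  have bd: "\<bar>trapezoid a b k y\<bar> \<le> 1" for a b y
    by (simp add: trapezoid_def)
  have intg: "integrable lborel (trapezoid a b k)" for a b
    by (rule Bochner_Integration.integrable_bound[of _ "indicator {a<..<b} :: real \<Rightarrow> real"])
      (use trapezoid_bounds[of a b k] in \<open>auto intro!: AE_I2 integrable_indicator_Ioo\<close>)
  have sf: "sigma_finite_measure (lborel :: real measure)" by unfold_locales
  have intgh: "integrable lborel2 (\<lambda>w. ?g (fst w) * ?h (snd w))"
    using has_bochner_integral_pair_mult[OF sf sf, of ?g _ ?h] intg by (auto simp: has_bochner_integral_iff)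
  define G where "G a b n u = (LINT y|lborel. trapezoid a b k y * normal_density 0 (\<sigma> n) (y - u))" for a b n u
  have G_meas [measurable]: "G a b n \<in> borel_measurable borel" for a b n unfolding G_def by measurable
  have G_lim: "(\<lambda>n. G a b n u) \<longlonglongrightarrow> trapezoid a b k u" for a b u
    unfolding G_def by (rule normal_convolution_tendsto[OF continuous_trapezoid bd \<sigma>])
  have nint: "integrable lborel (\<lambda>y. normal_density 0 (\<sigma> n) (y - u))" "(LINT y|lborel. normal_density 0 (\<sigma> n) (y - u)) = 1" for n u
    using \<sigma>(1)[of n] lborel_integrable_real_affine[of "normal_density 0 (\<sigma> n)" 1 "- u"]
      lborel_integral_real_affine[of 1 "normal_density 0 (\<sigma> n)" "- u"] by auto
  have gnint: "integrable lborel (\<lambda>y. trapezoid a b k y * normal_density 0 (\<sigma> n) (y - u))" for a b n u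
    by (rule Bochner_Integration.integrable_bound[OF nint(1)])
      (auto intro!: AE_I2 mult_left_le_one_le simp: abs_mult bd)
  have G_bd: "\<bar>G a b n u\<bar> \<le> 1" for a b n u
  proof -
    have "\<bar>G a b n u\<bar> \<le> (LINT y|lborel. \<bar>trapezoid a b k y * normal_density 0 (\<sigma> n) (y - u)\<bar>)"
      unfolding G_def using integral_norm_bound by (simp add: real_norm_def[symmetric] del: real_norm_def)
    also have "\<dots> \<le> (LINT y|lborel. normal_density 0 (\<sigma> n) (y - u))"
      using integrable_abs[OF gnint] nint(1)
      by (intro integral_mono) (assumption, assumption, auto simp: abs_mult intro!: mult_left_le_one_le bd)
    finally show ?thesis by (simp add: nint)
  qed
  have fub: "(LINT w|lborel2. ?g (fst w) * ?h (snd w) * q n w) = (LINT \<omega>|M. G a b n (U \<omega>) * G c d n (V \<omega>))" for n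
  proof -
    let ?n = "normal_density 0 (\<sigma> n)"
    let ?F = "\<lambda>\<omega> w. (?g (fst w) * ?n (fst w - U \<omega>)) * (?h (snd w) * ?n (snd w - V \<omega>))"
    have hb: "has_bochner_integral lborel2 (?F \<omega>) (G a b n (U \<omega>) * G c d n (V \<omega>))" for \<omega>
      by (intro has_bochner_integral_pair_mult sf) (use gnint in \<open>auto simp: has_bochner_integral_iff G_def\<close>)
    have F0: "\<bar>?F \<omega> w\<bar> = ?F \<omega> w" for \<omega> w
      using trapezoid_bounds(1) by (intro abs_of_nonneg mult_nonneg_nonneg) auto
    have int: "integrable (M \<Otimes>\<^sub>M lborel2) (\<lambda>(\<omega>, w). ?F \<omega> w)"
    proof (rule P.Fubini_integrable)
      have "integrable M (\<lambda>\<omega>. G a b n (U \<omega>) * G c d n (V \<omega>))"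
        by (rule integrable_const_bound[of _ 1]) (use G_bd in \<open>auto simp: abs_mult mult_le_one\<close>)
      moreover have "(LINT w|lborel2. norm (?F \<omega> w)) = G a b n (U \<omega>) * G c d n (V \<omega>)" for \<omega>
        unfolding real_norm_def F0 using hb by (simp add: has_bochner_integral_iff)
      ultimately show "integrable M (\<lambda>\<omega>. LINT w|lborel2. norm (case (\<omega>, w) of (\<omega>, w) \<Rightarrow> ?F \<omega> w))"
        by simp
      show "AE \<omega> in M. integrable lborel2 (\<lambda>w. case (\<omega>, w) of (\<omega>, w) \<Rightarrow> ?F \<omega> w)"
        using hb by (auto simp: has_bochner_integral_iff)
    qed measurable
    have "(LINT \<omega>|M. G a b n (U \<omega>) * G c d n (V \<omega>)) = (LINT \<omega>|M. LINT w|lborel2. ?F \<omega> w)"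
      using hb by (simp add: has_bochner_integral_iff)
    also have "\<dots> = (LINT w|lborel2. LINT \<omega>|M. ?F \<omega> w)"
      using P.Fubini_integral[OF int] by simp
    also have "(\<lambda>w. LINT \<omega>|M. ?F \<omega> w) = (\<lambda>w. ?g (fst w) * ?h (snd w) * q n w)"
    proof
      fix w
      have "?F \<omega> w = ?g (fst w) * ?h (snd w) * (?n (fst w - U \<omega>) * ?n (snd w - V \<omega>))" for \<omega> by simp
      then show "(LINT \<omega>|M. ?F \<omega> w) = ?g (fst w) * ?h (snd w) * q n w"
        unfolding q_def integral_mult_right_zero[symmetric]
        by (intro Bochner_Integration.integral_cong refl)
    qed
    finally show ?thesis by simp
  qed
  have lim1: "(\<lambda>n. LINT w|lborel2. ?g (fst w) * ?h (snd w) * q n w)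
      \<longlonglongrightarrow> (LINT w|lborel2. ?g (fst w) * ?h (snd w) * fourier_inv (char2 M U V) w)"
  proof (rule integral_dominated_convergence[where w = "\<lambda>w. K * (?g (fst w) * ?h (snd w))"])
    show "integrable lborel2 (\<lambda>w. K * (?g (fst w) * ?h (snd w)))" using intgh by simp
    show "AE w in lborel2. (\<lambda>n. ?g (fst w) * ?h (snd w) * q n w) \<longlonglongrightarrow> ?g (fst w) * ?h (snd w) * fourier_inv (char2 M U V) w"
      by (intro AE_I2 tendsto_mult tendsto_const q(1))
    show "AE w in lborel2. norm (?g (fst w) * ?h (snd w) * q n w) \<le> K * (?g (fst w) * ?h (snd w))" for n
    proof (rule AE_I2)
      fix w :: "real \<times> real"
      have "?g (fst w) * ?h (snd w) * q n w \<le> ?g (fst w) * ?h (snd w) * K"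
        using q(3)[of n w] trapezoid_bounds(1) by (intro mult_left_mono mult_nonneg_nonneg) (auto simp: K_def)
      then show "norm (?g (fst w) * ?h (snd w) * q n w) \<le> K * (?g (fst w) * ?h (snd w))"
        using q(2)[of n w] trapezoid_bounds(1) by (simp add: abs_mult mult.commute)
    qed
  qed measurable
  have lim2: "(\<lambda>n. LINT \<omega>|M. G a b n (U \<omega>) * G c d n (V \<omega>)) \<longlonglongrightarrow> (LINT \<omega>|M. ?g (U \<omega>) * ?h (V \<omega>))"
  proof (rule integral_dominated_convergence[where w = "\<lambda>_. 1"])
    show "AE \<omega> in M. (\<lambda>n. G a b n (U \<omega>) * G c d n (V \<omega>)) \<longlonglongrightarrow> ?g (U \<omega>) * ?h (V \<omega>)"
      by (intro AE_I2 tendsto_mult G_lim)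
    show "AE \<omega> in M. norm (G a b n (U \<omega>) * G c d n (V \<omega>)) \<le> 1" for n
      using G_bd by (auto simp: abs_mult mult_le_one)
  qed auto
  show ?thesis using LIMSEQ_unique[OF lim1[unfolded fub] lim2] by simp
qed

text \<open>The trapezoids tend to the indicators of open intervals; the uniform bound
  \<open>K\<close> on the density and the bounded support of the test functions give domination in
  the plane.\<close>

lemma box_fourier_inv:
  fixes U V :: "'a \<Rightarrow> real"
  assumes [measurable]: "U \<in> borel_measurable M" "V \<in> borel_measurable M"
    and int: "integrable lborel2 (char2 M U V)"
  shows "emeasure M {\<omega> \<in> space M. U \<omega> \<in> {a<..<b} \<and> V \<omega> \<in> {c<..<d}}
    = (\<integral>\<^sup>+ w. ennreal (fourier_inv (char2 M U V) w) * indicator ({a<..<b} \<times> {c<..<d}) w \<partial>lborel2)"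
proof -
  note [measurable] = fourier_inv_measurable[OF char2_measurable[OF assms(1,2)]]
  let ?p = "fourier_inv (char2 M U V)"
  note p0 = fourier_inv_char2_nonneg[OF assms]
  define K where "K = (LINT \<xi>|lborel2. norm (char2 M U V \<xi>)) / (2 * pi)\<^sup>2"
  have pK: "?p w \<le> K" for w using abs_fourier_inv_le[of "char2 M U V" w] by (simp add: K_def)
  let ?I = "\<lambda>w. indicator {a<..<b} (fst w) * indicator {c<..<d} (snd w) * ?p w"
  have sf: "sigma_finite_measure (lborel :: real measure)" by unfold_locales
  have intI: "integrable lborel (indicator {a<..<b} :: real \<Rightarrow> real)" for a b :: real
    by (rule integrable_indicator_Ioo)
  have intII: "integrable lborel2 (\<lambda>w. indicator {a<..<b} (fst w) * indicator {c<..<d} (snd w) :: real)"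
    using has_bochner_integral_pair_mult[OF sf sf, of "indicator {a<..<b} :: real \<Rightarrow> real" _ "indicator {c<..<d}"] intI
    by (auto simp: has_bochner_integral_iff)
  have dom: "norm (trapezoid a b k (fst w) * trapezoid c d k (snd w) * ?p w)
     \<le> indicator {a<..<b} (fst w) * indicator {c<..<d} (snd w) * K" for k w
    using trapezoid_bounds[of a b k "fst w"] trapezoid_bounds[of c d k "snd w"] p0[of w] pK[of w]
    by (simp add: abs_mult mult_mono)
  have lim1: "(\<lambda>k. LINT w|lborel2. trapezoid a b k (fst w) * trapezoid c d k (snd w) * ?p w) \<longlonglongrightarrow> (LINT w|lborel2. ?I w)"
  proof (rule integral_dominated_convergence[where w = "\<lambda>w. indicator {a<..<b} (fst w) * indicator {c<..<d} (snd w) * K"])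
    show "integrable lborel2 (\<lambda>w. indicator {a<..<b} (fst w) * indicator {c<..<d} (snd w) * K)"
      using intII by simp
    show "AE w in lborel2. (\<lambda>k. trapezoid a b k (fst w) * trapezoid c d k (snd w) * ?p w) \<longlonglongrightarrow> ?I w"
      by (intro AE_I2 tendsto_mult tendsto_const trapezoid_tendsto)
  qed (use dom in auto)
  have intp: "integrable lborel2 ?I"
    by (rule Bochner_Integration.integrable_bound[OF integrable_mult_left[OF intII, of K]])
      (use p0 order_trans[OF pK abs_ge_self] in \<open>auto simp: abs_mult indicator_def intro!: AE_I2\<close>)
  let ?A = "{\<omega> \<in> space M. U \<omega> \<in> {a<..<b} \<and> V \<omega> \<in> {c<..<d}}"
  have lim2: "(\<lambda>k. LINT \<omega>|M. trapezoid a b k (U \<omega>) * trapezoid c d k (V \<omega>)) \<longlonglongrightarrow> (LINT \<omega>|M. indicator {a<..<b} (U \<omega>) * indicator {c<..<d} (V \<omega>))"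
  proof (rule integral_dominated_convergence[where w = "\<lambda>_. 1"])
    show "AE \<omega> in M. (\<lambda>k. trapezoid a b k (U \<omega>) * trapezoid c d k (V \<omega>)) \<longlonglongrightarrow> indicator {a<..<b} (U \<omega>) * indicator {c<..<d} (V \<omega>)"
      by (intro AE_I2 tendsto_mult trapezoid_tendsto)
    have "trapezoid a b k y \<le> 1" for a b k y by (simp add: trapezoid_def)
    then show "AE \<omega> in M. norm (trapezoid a b k (U \<omega>) * trapezoid c d k (V \<omega>)) \<le> 1" for k
      using trapezoid_bounds(1) by (auto simp: abs_mult mult_le_one)
  qed auto
  have "(LINT \<omega>|M. indicator {a<..<b} (U \<omega>) * indicator {c<..<d} (V \<omega>)) = (\<integral>\<omega>. indicator ?A \<omega> \<partial>M :: real)"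
    by (intro Bochner_Integration.integral_cong) (auto simp: indicator_def)
  then have "(LINT w|lborel2. ?I w) = measure M ?A"
    using LIMSEQ_unique[OF lim1[folded integral_trapezoids_fourier_inv[OF assms]] lim2] by simp
  then have "emeasure M ?A = ennreal (LINT w|lborel2. ?I w)" by (simp add: emeasure_eq_measure)
  also have "\<dots> = (\<integral>\<^sup>+ w. ennreal (?I w) \<partial>lborel2)"
    using intp p0 by (intro nn_integral_eq_integral[symmetric]) auto
  also have "\<dots> = (\<integral>\<^sup>+ w. ennreal (?p w) * indicator ({a<..<b} \<times> {c<..<d}) w \<partial>lborel2)"
    by (intro nn_integral_cong) (auto simp: indicator_def)
  finally show ?thesis .
qed

text \<open>Open boxes are stable under intersection, generate the Borel sets and exhaust the plane.
  From here on the joint law inherits the bounds of the explicit integral and its continuity in the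
  parameters.\<close>

lemma distr_eq_density_fourier_inv:
  fixes U V :: "'a \<Rightarrow> real"
  assumes [measurable]: "U \<in> borel_measurable M" "V \<in> borel_measurable M"
    and int: "integrable lborel2 (char2 M U V)"
  shows "distr M lborel2 (\<lambda>\<omega>. (U \<omega>, V \<omega>)) = density lborel2 (\<lambda>w. ennreal (fourier_inv (char2 M U V) w))"
proof (rule measure_eqI_generator_eq[where E = "range (\<lambda>(a, b). box a b :: (real \<times> real) set)" and \<Omega> = UNIV
      and A = "\<lambda>n. box (- real n, - real n) (real n, real n)"])
  note [measurable] = fourier_inv_measurable[OF char2_measurable[OF assms(1,2)]]
  have sets2: "sets lborel2 = sets (borel :: (real \<times> real) measure)"
    unfolding lborel_prod by (rule sets_lborel)
  show "Int_stable (range (\<lambda>(a, b). box a b :: (real \<times> real) set))"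
  proof (rule Int_stableI_image)
    fix i j :: "(real \<times> real) \<times> (real \<times> real)"
    show "\<exists>k\<in>UNIV. (case i of (a, b) \<Rightarrow> box a b) \<inter> (case j of (a, b) \<Rightarrow> box a b) = (case k of (a, b) \<Rightarrow> box a b)"
      by (rule bexI[of _ "(\<Sum>b\<in>Basis. max (fst i \<bullet> b) (fst j \<bullet> b) *\<^sub>R b, \<Sum>b\<in>Basis. min (snd i \<bullet> b) (snd j \<bullet> b) *\<^sub>R b)"])
        (simp_all add: split_beta box_Int_box)
  qed
  show "sets (distr M lborel2 (\<lambda>\<omega>. (U \<omega>, V \<omega>))) = sigma_sets UNIV (range (\<lambda>(a, b). box a b))"
    by (simp add: sets2 borel_eq_box)
  show "sets (density lborel2 (\<lambda>w. ennreal (fourier_inv (char2 M U V) w))) = sigma_sets UNIV (range (\<lambda>(a, b). box a b))"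
    by (simp add: sets2 borel_eq_box)
  fix X assume "X \<in> range (\<lambda>(a, b). box a b :: (real \<times> real) set)"
  then obtain a b c d where X: "X = box (a, c) (b, d)" by (auto simp: split_beta)
  have X2: "X = {a<..<b} \<times> {c<..<d}" unfolding X by (auto simp: mem_box Basis_prod_def)
  have "emeasure (distr M lborel2 (\<lambda>\<omega>. (U \<omega>, V \<omega>))) X = emeasure M {\<omega> \<in> space M. U \<omega> \<in> {a<..<b} \<and> V \<omega> \<in> {c<..<d}}"
    unfolding X2 by (subst emeasure_distr) (auto intro!: arg_cong[where f = "emeasure M"])
  also have "\<dots> = emeasure (density lborel2 (\<lambda>w. ennreal (fourier_inv (char2 M U V) w))) X"
    unfolding X2 box_fourier_inv[OF assms] by (subst emeasure_density) auto
  finally show "emeasure (distr M lborel2 (\<lambda>\<omega>. (U \<omega>, V \<omega>))) X = emeasure (density lborel2 (\<lambda>w. ennreal (fourier_inv (char2 M U V) w))) X" .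
next
  interpret D: prob_space "distr M lborel2 (\<lambda>\<omega>. (U \<omega>, V \<omega>))" by (rule prob_space_distr) simp
  show "emeasure (distr M lborel2 (\<lambda>\<omega>. (U \<omega>, V \<omega>))) (box (- real i, - real i) (real i, real i)) \<noteq> \<infinity>" for i
    by simp
  show "range (\<lambda>n. box (- real n, - real n) (real n, real n)) \<subseteq> range (\<lambda>(a, b). box a b :: (real \<times> real) set)"
    by auto
  show "(\<Union>i. box (- real i, - real i) (real i, real i)) = (UNIV :: (real \<times> real) set)"
  proof (intro set_eqI iffI)
    fix w :: "real \<times> real"
    obtain n where "max \<bar>fst w\<bar> \<bar>snd w\<bar> < real n" using reals_Archimedean2 by blast
    then have "w \<in> box (- real n, - real n) (real n, real n)"
      by (cases w) (auto simp: mem_box Basis_prod_def)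
    then show "w \<in> (\<Union>i. box (- real i, - real i) (real i, real i))" by blast
  qed auto
qed auto

end

section \<open>Integrals of stable exponentials and bounds for expectations\<close>

lemma integrable_exp_neg_abs_powr:
  fixes \<alpha> :: real
  assumes \<alpha>: "0 < \<alpha>"
  shows "integrable lborel (\<lambda>v. exp (- (\<bar>v\<bar> powr \<alpha>)))"
proof -
  \<comment> \<open>With \<alpha> k \<ge> 2 the inequality exp y \<ge> (1 + y / k)^k at y =
    |v|^\<alpha> yields growth at least v^2 / k^k for |v| \<ge> 1, so a multiple of the Cauchy
    density dominates.\<close>
  obtain k :: nat where k: "2 / \<alpha> < real k" using reals_Archimedean2 by blast
  have "2 / \<alpha> > 0" using \<alpha> by simp
  then have "real k > 0" using k by linarith
  then have k0: "k > 0" by simp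
  have k2: "\<alpha> * real k \<ge> 2" using k \<alpha> by (simp add: field_simps)
  have "einterval (- \<infinity>) \<infinity> = UNIV" by (auto simp: einterval_def)
  then have int: "integrable lborel (\<lambda>v::real. 2 * real k ^ k * inverse (1 + v\<^sup>2))"
    using integrable_inverse_1_plus_square by (simp add: set_integrable_def)
  have "exp (- (\<bar>v\<bar> powr \<alpha>)) \<le> 2 * real k ^ k * inverse (1 + v\<^sup>2)" for v :: real
  proof (cases "\<bar>v\<bar> \<ge> 1")
    case True
    have "v\<^sup>2 = \<bar>v\<bar> powr 2" using True by simp
    also have "\<dots> \<le> \<bar>v\<bar> powr (\<alpha> * real k)" using True k2 by (intro powr_mono) auto
    also have "\<dots> = (\<bar>v\<bar> powr \<alpha>) ^ k" using True by (simp add: powr_powr[symmetric] powr_realpow)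
    also have "\<dots> = real k ^ k * (\<bar>v\<bar> powr \<alpha> / real k) ^ k" using k0 by (simp add: power_divide)
    also have "\<dots> \<le> real k ^ k * (1 + \<bar>v\<bar> powr \<alpha> / real k) ^ k"
      by (intro mult_left_mono power_mono) auto
    also have "\<dots> \<le> real k ^ k * exp (\<bar>v\<bar> powr \<alpha>)"
      using k0 by (intro mult_left_mono exp_ge_one_plus_x_over_n_power_n) (auto intro: order_trans[of _ 0])
    finally have *: "v\<^sup>2 \<le> real k ^ k * exp (\<bar>v\<bar> powr \<alpha>)" .
    have "1 \<le> v\<^sup>2" using True by (simp add: abs_le_square_iff[of 1 v, simplified])
    with * have "1 + v\<^sup>2 \<le> 2 * real k ^ k * exp (\<bar>v\<bar> powr \<alpha>)" by linarith
    moreover have "1 + v\<^sup>2 > 0" by (simp add: add_pos_nonneg)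
    ultimately show ?thesis by (simp add: exp_minus field_simps)
  next
    case False
    have "exp (- (\<bar>v\<bar> powr \<alpha>)) \<le> 1" by simp
    also have "1 \<le> 2 * 1 * inverse (1 + v\<^sup>2)"
      using False abs_square_le_1[of v] by (simp add: field_simps add_pos_nonneg)
    also have "\<dots> \<le> 2 * real k ^ k * inverse (1 + v\<^sup>2)"
      using k0 by (intro mult_right_mono mult_left_mono) (auto simp: one_le_power)
    finally show ?thesis .
  qed
  then show ?thesis
    by (intro Bochner_Integration.integrable_bound[OF int]) (auto intro!: AE_I2 simp: abs_mult)
qed

text \<open>For \<alpha> > 0 this is 2 Gamma (1 + 1 / \<alpha>); for 0 < \<alpha> \<le> 2 it is 2 pi
  times the value at 0 of the standard symmetric stable density.\<close>

definition stable_const :: "real \<Rightarrow> real" where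
  "stable_const \<alpha> = (LINT v|lborel. exp (- (\<bar>v\<bar> powr \<alpha>)))"

lemma stable_const_nonneg: "0 \<le> stable_const \<alpha>"
  unfolding stable_const_def by (intro integral_nonneg_AE) auto

lemma has_bochner_integral_exp_neg_abs_powr:
  assumes \<alpha>: "0 < \<alpha>" and A: "0 < A"
  shows "has_bochner_integral lborel (\<lambda>v. exp (- A * \<bar>v + m\<bar> powr \<alpha>)) (A powr (- 1 / \<alpha>) * stable_const \<alpha>)"
proof -
  define c where "c = A powr (1 / \<alpha>)"
  have c: "c > 0" "A = c powr \<alpha>" using \<alpha> A by (auto simp: c_def powr_powr)
  have "has_bochner_integral lborel (\<lambda>v. exp (- (\<bar>v\<bar> powr \<alpha>))) (stable_const \<alpha>)"
    using integrable_exp_neg_abs_powr[OF \<alpha>] by (simp add: has_bochner_integral_iff stable_const_def)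
  then have "has_bochner_integral lborel (\<lambda>v. exp (- (\<bar>c * m + c * v\<bar> powr \<alpha>))) (stable_const \<alpha> /\<^sub>R \<bar>c\<bar>)"
    using c by (subst (asm) lborel_has_bochner_integral_real_affine_iff[of c _ _ "c * m"]) auto
  moreover have "\<bar>c * m + c * v\<bar> powr \<alpha> = A * \<bar>v + m\<bar> powr \<alpha>" for v
  proof -
    have "c * m + c * v = c * (v + m)" by (simp add: algebra_simps)
    then show ?thesis using c by (simp add: abs_mult powr_mult)
  qed
  moreover have "stable_const \<alpha> /\<^sub>R \<bar>c\<bar> = A powr (- 1 / \<alpha>) * stable_const \<alpha>"
    using c(1) unfolding c_def by (simp add: powr_minus)
  ultimately show ?thesis by (simp only: minus_mult_left)
qed

text \<open>The exponent couples the variables, but integrating over the first one first removes the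
  shift by the second, by translation invariance, and the integral factorizes.\<close>

lemma has_bochner_integral_stable_bound:
  assumes \<alpha>: "0 < \<alpha>" and AB: "0 < A" "0 < B"
  shows "has_bochner_integral lborel2 (\<lambda>\<xi>. exp (- A * \<bar>fst \<xi> + snd \<xi>\<bar> powr \<alpha> - B * \<bar>snd \<xi>\<bar> powr \<alpha>))
    ((A powr (- 1 / \<alpha>) * stable_const \<alpha>) * (B powr (- 1 / \<alpha>) * stable_const \<alpha>))"
proof (rule has_bochner_integral_nn_integral)
  have nn: "(\<integral>\<^sup>+ v. ennreal (exp (- A * \<bar>v + m\<bar> powr \<alpha>)) \<partial>lborel) = ennreal (A powr (- 1 / \<alpha>) * stable_const \<alpha>)"
    if "0 < A" for A m
    using has_bochner_integral_exp_neg_abs_powr[OF \<alpha> that, of m]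
    by (subst nn_integral_eq_integral) (auto simp: has_bochner_integral_iff)
  have "(\<integral>\<^sup>+ \<xi>. ennreal (exp (- A * \<bar>fst \<xi> + snd \<xi>\<bar> powr \<alpha> - B * \<bar>snd \<xi>\<bar> powr \<alpha>)) \<partial>lborel2)
    = (\<integral>\<^sup>+ m. \<integral>\<^sup>+ l. ennreal (exp (- A * \<bar>l + m\<bar> powr \<alpha> - B * \<bar>m\<bar> powr \<alpha>)) \<partial>lborel \<partial>lborel)"
    by (subst lborel_pair.nn_integral_snd[symmetric]) auto
  also have "\<dots> = (\<integral>\<^sup>+ m. \<integral>\<^sup>+ l. ennreal (exp (- B * \<bar>m\<bar> powr \<alpha>)) * ennreal (exp (- A * \<bar>l + m\<bar> powr \<alpha>)) \<partial>lborel \<partial>lborel)"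
    by (intro nn_integral_cong) (simp add: ennreal_mult[symmetric] exp_add[symmetric] algebra_simps)
  also have "\<dots> = (\<integral>\<^sup>+ m. ennreal (exp (- B * \<bar>m\<bar> powr \<alpha>)) * ennreal (A powr (- 1 / \<alpha>) * stable_const \<alpha>) \<partial>lborel)"
    by (intro nn_integral_cong) (simp add: nn_integral_cmult nn[OF AB(1), simplified])
  also have "\<dots> = ennreal (B powr (- 1 / \<alpha>) * stable_const \<alpha>) * ennreal (A powr (- 1 / \<alpha>) * stable_const \<alpha>)"
    using nn[OF AB(2), of 0] by (subst nn_integral_multc) auto
  also have "\<dots> = ennreal ((A powr (- 1 / \<alpha>) * stable_const \<alpha>) * (B powr (- 1 / \<alpha>) * stable_const \<alpha>))"
    using stable_const_nonneg[of \<alpha>] by (subst ennreal_mult[symmetric]) (auto simp: algebra_simps)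
  finally show "(\<integral>\<^sup>+ \<xi>. ennreal (exp (- A * \<bar>fst \<xi> + snd \<xi>\<bar> powr \<alpha> - B * \<bar>snd \<xi>\<bar> powr \<alpha>)) \<partial>lborel2) = \<dots>" .
qed (use stable_const_nonneg[of \<alpha>] in auto)

context prob_space
begin

lemma nn_integral_fourier_inv:
  assumes "U \<in> borel_measurable M" "V \<in> borel_measurable M" "integrable lborel2 (char2 M U V)"
    and [measurable]: "h \<in> borel_measurable lborel2"
  shows "(\<integral>\<^sup>+ \<omega>. h (U \<omega>, V \<omega>) \<partial>M) = (\<integral>\<^sup>+ w. ennreal (fourier_inv (char2 M U V) w) * h w \<partial>lborel2)"
proof -
  note [measurable] = assms(1,2) fourier_inv_measurable[OF char2_measurable[OF assms(1,2)]]
  have "(\<integral>\<^sup>+ \<omega>. h (U \<omega>, V \<omega>) \<partial>M) = (\<integral>\<^sup>+ w. h w \<partial>distr M lborel2 (\<lambda>\<omega>. (U \<omega>, V \<omega>)))"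
    by (subst nn_integral_distr) auto
  also have "\<dots> = (\<integral>\<^sup>+ w. ennreal (fourier_inv (char2 M U V) w) * h w \<partial>lborel2)"
    unfolding distr_eq_density_fourier_inv[OF assms(1-3)] by (subst nn_integral_density) auto
  finally show ?thesis .
qed

lemma integral_fourier_inv:
  fixes h :: "real \<times> real \<Rightarrow> real"
  assumes "U \<in> borel_measurable M" "V \<in> borel_measurable M" "integrable lborel2 (char2 M U V)"
    and [measurable]: "h \<in> borel_measurable lborel2"
  shows "(LINT \<omega>|M. h (U \<omega>, V \<omega>)) = (LINT w|lborel2. fourier_inv (char2 M U V) w * h w)"
proof -
  note [measurable] = assms(1,2) fourier_inv_measurable[OF char2_measurable[OF assms(1,2)]]
  have "(LINT \<omega>|M. h (U \<omega>, V \<omega>)) = (\<integral>w. h w \<partial>distr M lborel2 (\<lambda>\<omega>. (U \<omega>, V \<omega>)))"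
    by (subst integral_distr) auto
  also have "\<dots> = (LINT w|lborel2. fourier_inv (char2 M U V) w * h w)"
    unfolding distr_eq_density_fourier_inv[OF assms(1-3)] using fourier_inv_char2_nonneg[OF assms(1-3)]
    by (subst integral_density) auto
  finally show ?thesis .
qed

text \<open>A joint density bounded by \<open>K\<close> lets the two coordinates be treated as if
  they were independent and spread by Lebesgue measure. Values in \<open>ennreal\<close> avoid
  integrability conditions on the test functions.\<close>

lemma nn_integral_le_fourier_inv:
  assumes "U \<in> borel_measurable M" "V \<in> borel_measurable M" "integrable lborel2 (char2 M U V)"
    and [measurable]: "h1 \<in> borel_measurable borel" "h2 \<in> borel_measurable borel"
    and K: "(LINT \<xi>|lborel2. norm (char2 M U V \<xi>)) / (2 * pi)\<^sup>2 \<le> K"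
  shows "(\<integral>\<^sup>+ \<omega>. h1 (U \<omega>) * h2 (V \<omega>) \<partial>M) \<le> ennreal K * ((\<integral>\<^sup>+ y. h1 y \<partial>lborel) * (\<integral>\<^sup>+ z. h2 z \<partial>lborel))"
proof -
  have "(\<integral>\<^sup>+ \<omega>. h1 (U \<omega>) * h2 (V \<omega>) \<partial>M) = (\<integral>\<^sup>+ w. ennreal (fourier_inv (char2 M U V) w) * (h1 (fst w) * h2 (snd w)) \<partial>lborel2)"
    using nn_integral_fourier_inv[OF assms(1-3), of "\<lambda>w. h1 (fst w) * h2 (snd w)"] by simp
  also have "\<dots> \<le> (\<integral>\<^sup>+ w. ennreal K * (h1 (fst w) * h2 (snd w)) \<partial>lborel2)"
  proof (intro nn_integral_mono mult_right_mono ennreal_leI)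
    show "fourier_inv (char2 M U V) w \<le> K" for w
      using abs_fourier_inv_le[of "char2 M U V" w] K by linarith
  qed auto
  also have "\<dots> = ennreal K * (\<integral>\<^sup>+ w. h1 (fst w) * h2 (snd w) \<partial>lborel2)"
    by (intro nn_integral_cmult) measurable
  also have "(\<integral>\<^sup>+ w. h1 (fst w) * h2 (snd w) \<partial>lborel2) = (\<integral>\<^sup>+ y. \<integral>\<^sup>+ z. h1 y * h2 z \<partial>lborel \<partial>lborel)"
    by (subst lborel.nn_integral_fst[symmetric]) auto
  also have "\<dots> = (\<integral>\<^sup>+ y. h1 y \<partial>lborel) * (\<integral>\<^sup>+ z. h2 z \<partial>lborel)"
    by (simp add: nn_integral_cmult nn_integral_multc)
  finally show ?thesis .
qed

end

text \<open>The constant left by an auxiliary standard normal coordinate: sqrt (2 pi) is the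
  integral of its characteristic function, (2 pi)^2 belongs to the inversion in the plane, and the
  normal mass of \<open>{0..1}\<close> is divided out because the auxiliary coordinate is tested on
  that interval, whose Lebesgue measure is 1.\<close>

definition smoothing_const :: real where
  "smoothing_const = sqrt (2 * pi) / ((2 * pi)\<^sup>2 * measure std_normal_distribution {0..1})"

lemma measure_std_normal_01: "measure std_normal_distribution {0..1} > 0"
proof -
  interpret N: prob_space std_normal_distribution by (rule prob_space_normal_density) simp
  have "emeasure std_normal_distribution {0..1} \<noteq> 0"
  proof
    assume "emeasure std_normal_distribution {0..1} = 0"
    then have "(\<integral>\<^sup>+ v. ennreal (std_normal_density v) * indicator {0..1} v \<partial>lborel) = 0"
      by (subst (asm) emeasure_density) auto
    then have "AE v in lborel. ennreal (std_normal_density v) * indicator {0..1::real} v = 0"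
      by (subst (asm) nn_integral_0_iff_AE) auto
    then have "AE v in lborel. v \<notin> {0..1::real}"
    proof eventually_elim
      case (elim v)
      have "ennreal (std_normal_density v) \<noteq> 0"
        using normal_density_pos[of 1 0 v] by (simp add: ennreal_eq_0_iff not_le)
      with elim show ?case by (auto simp: indicator_def split: if_splits)
    qed
    then have "emeasure lborel {0..1::real} = 0"
      by (subst (asm) AE_iff_measurable[of "{0..1::real}"]) auto
    then show False by simp
  qed
  then show ?thesis by (simp add: N.emeasure_eq_measure measure_le_0_iff[symmetric] zero_less_measure_iff)
qed

text \<open>An independent Gaussian second coordinate reduces the one-dimensional bound to the
  two-dimensional one.\<close>

lemma (in prob_space) nn_integral_le_char:
  fixes U :: "'a \<Rightarrow> real"
  assumes U [measurable]: "U \<in> borel_measurable M" and g: "integrable lborel g"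
    and bound: "\<And>l. norm (LINT \<omega>|M. iexp (l * U \<omega>)) \<le> g l"
    and [measurable]: "h \<in> borel_measurable borel"
  shows "(\<integral>\<^sup>+ \<omega>. h (U \<omega>) \<partial>M) \<le> ennreal (smoothing_const * (LINT l|lborel. g l)) * (\<integral>\<^sup>+ y. h y \<partial>lborel)"
proof -
  interpret N: prob_space std_normal_distribution by (rule prob_space_normal_density) simp
  let ?P = "M \<Otimes>\<^sub>M std_normal_distribution"
  interpret P: pair_prob_space M std_normal_distribution ..
  let ?U = "\<lambda>w. U (fst w)" and ?V = "snd :: _ \<Rightarrow> real"
  have sf: "sigma_finite_measure M" "sigma_finite_measure std_normal_distribution" "sigma_finite_measure (lborel :: real measure)"
    by unfold_locales
  have g0: "0 \<le> g l" for l using bound[of l] norm_ge_zero order_trans by blast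
  have char: "char2 ?P ?U ?V \<xi> = (LINT \<omega>|M. iexp (fst \<xi> * U \<omega>)) * complex_of_real (exp (- (snd \<xi>)\<^sup>2 / 2))" for \<xi>
  proof -
    have "has_bochner_integral ?P (\<lambda>w. iexp (fst \<xi> * U (fst w)) * iexp (snd \<xi> * snd w))
      ((LINT \<omega>|M. iexp (fst \<xi> * U \<omega>)) * (LINT v|std_normal_distribution. iexp (snd \<xi> * v)))"
    proof (intro has_bochner_integral_pair_mult sf has_bochner_integral_integrable)
      show "integrable M (\<lambda>\<omega>. iexp (fst \<xi> * U \<omega>))" by (rule integrable_const_bound[of _ 1]) auto
      show "integrable std_normal_distribution (\<lambda>v. iexp (snd \<xi> * v))" by (rule N.integrable_const_bound[of _ 1]) auto
    qed
    moreover have "(\<lambda>w. iexp (fst \<xi> * U (fst w)) * iexp (snd \<xi> * snd w)) = (\<lambda>w. iexp (fst \<xi> * U (fst w) + snd \<xi> * snd w))"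
      by (simp add: exp_add[symmetric] algebra_simps)
    moreover have "(LINT v|std_normal_distribution. iexp (snd \<xi> * v)) = complex_of_real (exp (- (snd \<xi>)\<^sup>2 / 2))"
      using fun_cong[OF char_std_normal_distribution, of "snd \<xi>"] by (simp add: char_def)
    ultimately show ?thesis by (simp add: char2_def has_bochner_integral_iff)
  qed
  have gauss: "has_bochner_integral lborel (\<lambda>m::real. exp (- m\<^sup>2 / 2)) (sqrt (2 * pi))"
  proof -
    have "has_bochner_integral lborel (\<lambda>m. sqrt (2 * pi) * std_normal_density m) (sqrt (2 * pi) * 1)"
      using integral_std_normal_moment_even[of 0] integrable_std_normal_moment[of 0]
      by (intro has_bochner_integral_mult_right) (simp add: has_bochner_integral_iff)
    then show ?thesis by (simp add: std_normal_density_def)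
  qed
  have dom: "has_bochner_integral lborel2 (\<lambda>\<xi>. g (fst \<xi>) * exp (- (snd \<xi>)\<^sup>2 / 2)) ((LINT l|lborel. g l) * sqrt (2 * pi))"
    by (intro has_bochner_integral_pair_mult sf gauss has_bochner_integral_integrable g)
  have le: "norm (char2 ?P ?U ?V \<xi>) \<le> g (fst \<xi>) * exp (- (snd \<xi>)\<^sup>2 / 2)" for \<xi>
    using bound[of "fst \<xi>"] by (simp add: char norm_mult)
  have meas: "?U \<in> borel_measurable ?P" "?V \<in> borel_measurable ?P" by measurable
  have int: "integrable lborel2 (char2 ?P ?U ?V)"
  proof (rule Bochner_Integration.integrable_bound)
    show "integrable lborel2 (\<lambda>\<xi>. g (fst \<xi>) * exp (- (snd \<xi>)\<^sup>2 / 2))" using dom by (simp add: has_bochner_integral_iff)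
    show "char2 ?P ?U ?V \<in> borel_measurable lborel2" by (rule P.char2_measurable) measurable
    show "AE \<xi> in lborel2. norm (char2 ?P ?U ?V \<xi>) \<le> norm (g (fst \<xi>) * exp (- (snd \<xi>)\<^sup>2 / 2))"
      using le g0 by (auto intro!: AE_I2 simp: abs_mult)
  qed
  define N01 where "N01 = measure std_normal_distribution {0..1}"
  have N01: "N01 > 0" using measure_std_normal_01 by (simp add: N01_def)
  define K where "K = (LINT l|lborel. g l) * sqrt (2 * pi) / (2 * pi)\<^sup>2"
  have K0: "0 \<le> K" unfolding K_def using g0 by (intro divide_nonneg_nonneg mult_nonneg_nonneg integral_nonneg_AE) auto
  have "(LINT \<xi>|lborel2. norm (char2 ?P ?U ?V \<xi>)) \<le> (LINT \<xi>|lborel2. g (fst \<xi>) * exp (- (snd \<xi>)\<^sup>2 / 2))"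
    using dom integrable_norm[OF int] by (intro integral_mono le) (auto simp: has_bochner_integral_iff)
  also have "\<dots> = (LINT l|lborel. g l) * sqrt (2 * pi)"
    using dom by (simp add: has_bochner_integral_iff)
  finally have "(LINT \<xi>|lborel2. norm (char2 ?P ?U ?V \<xi>)) \<le> (LINT l|lborel. g l) * sqrt (2 * pi)" .
  then have "(LINT \<xi>|lborel2. norm (char2 ?P ?U ?V \<xi>)) / (2 * pi)\<^sup>2 \<le> K"
    unfolding K_def by (intro divide_right_mono) auto
  then have "(\<integral>\<^sup>+ w. h (U (fst w)) * indicator {0..1::real} (snd w) \<partial>?P) \<le> ennreal K * ((\<integral>\<^sup>+ y. h y \<partial>lborel) * (\<integral>\<^sup>+ z. indicator {0..1::real} z \<partial>lborel))"
    by (intro P.nn_integral_le_fourier_inv[OF meas int]) auto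
  also have "(\<integral>\<^sup>+ w. h (U (fst w)) * indicator {0..1::real} (snd w) \<partial>?P) = (\<integral>\<^sup>+ \<omega>. \<integral>\<^sup>+ v. h (U \<omega>) * indicator {0..1::real} v \<partial>std_normal_distribution \<partial>M)"
    by (subst N.nn_integral_fst[symmetric]) auto
  also have "\<dots> = ennreal N01 * (\<integral>\<^sup>+ \<omega>. h (U \<omega>) \<partial>M)"
    by (simp add: nn_integral_cmult nn_integral_multc N.emeasure_eq_measure N01_def mult.commute)
  finally have *: "ennreal N01 * (\<integral>\<^sup>+ \<omega>. h (U \<omega>) \<partial>M) \<le> ennreal K * (\<integral>\<^sup>+ y. h y \<partial>lborel)" by simp
  have "(\<integral>\<^sup>+ \<omega>. h (U \<omega>) \<partial>M) = ennreal (1 / N01) * (ennreal N01 * (\<integral>\<^sup>+ \<omega>. h (U \<omega>) \<partial>M))"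
    using N01 by (simp add: mult.assoc[symmetric] ennreal_mult[symmetric])
  also have "\<dots> \<le> ennreal (1 / N01) * (ennreal K * (\<integral>\<^sup>+ y. h y \<partial>lborel))"
    using * by (intro mult_left_mono) auto
  also have "\<dots> = ennreal (1 / N01 * K) * (\<integral>\<^sup>+ y. h y \<partial>lborel)"
  proof -
    have "ennreal (1 / N01 * K) = ennreal (1 / N01) * ennreal K"
      using N01 K0 by (intro ennreal_mult) auto
    then show ?thesis by (simp only: mult.assoc)
  qed
  also have "1 / N01 * K = smoothing_const * (LINT l|lborel. g l)"
    by (simp add: smoothing_const_def K_def N01_def field_simps)
  finally show ?thesis .
qed

section \<open>Processes with locally nondeterministic increments\<close>

text \<open>An approximate point mass at x of weight \<integral>f. For b > 0 rescaling preserves the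
  L^1 norm but multiplies the integral of the square by b; this is why second moments at a single
  time grow with the scale.\<close>

definition scaled :: "(real \<Rightarrow> real) \<Rightarrow> real \<Rightarrow> real \<Rightarrow> real \<Rightarrow> real" where
  "scaled f b x y = b * f (b * (y - x))"

lemma scaled_measurable [measurable]:
  assumes [measurable]: "f \<in> borel_measurable borel"
  shows "scaled f b x \<in> borel_measurable borel"
  unfolding scaled_def by measurable

lemma nn_integral_scaled:
  assumes [measurable]: "f \<in> borel_measurable borel" and b: "0 < b"
  shows "(\<integral>\<^sup>+ y. ennreal \<bar>scaled f b x y\<bar> \<partial>lborel) = (\<integral>\<^sup>+ y. ennreal \<bar>f y\<bar> \<partial>lborel)"
    and "(\<integral>\<^sup>+ y. ennreal ((scaled f b x y)\<^sup>2) \<partial>lborel) = ennreal b * (\<integral>\<^sup>+ y. ennreal ((f y)\<^sup>2) \<partial>lborel)"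
proof -
  have aff: "(\<integral>\<^sup>+ y. ennreal (g (b * (y - x))) \<partial>lborel) = ennreal (1 / b) * (\<integral>\<^sup>+ y. ennreal (g y) \<partial>lborel)"
    if [measurable]: "g \<in> borel_measurable borel" for g
    using b by (subst nn_integral_real_affine[where c = "1 / b" and t = x]) auto
  have "(\<integral>\<^sup>+ y. ennreal \<bar>scaled f b x y\<bar> \<partial>lborel) = (\<integral>\<^sup>+ y. ennreal b * ennreal \<bar>f (b * (y - x))\<bar> \<partial>lborel)"
    using b by (intro nn_integral_cong) (simp add: scaled_def abs_mult ennreal_mult)
  also have "\<dots> = (ennreal b * ennreal (1 / b)) * (\<integral>\<^sup>+ y. ennreal \<bar>f y\<bar> \<partial>lborel)"
    using aff[of "\<lambda>v. \<bar>f v\<bar>"] by (simp add: nn_integral_cmult mult.assoc)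
  also have "ennreal b * ennreal (1 / b) = 1" using b by (simp add: ennreal_mult[symmetric])
  finally show "(\<integral>\<^sup>+ y. ennreal \<bar>scaled f b x y\<bar> \<partial>lborel) = (\<integral>\<^sup>+ y. ennreal \<bar>f y\<bar> \<partial>lborel)" by simp
  have "(\<integral>\<^sup>+ y. ennreal ((scaled f b x y)\<^sup>2) \<partial>lborel) = (\<integral>\<^sup>+ y. ennreal (b\<^sup>2) * ennreal ((f (b * (y - x)))\<^sup>2) \<partial>lborel)"
    by (intro nn_integral_cong) (simp add: scaled_def power_mult_distrib ennreal_mult)
  also have "\<dots> = (ennreal (b\<^sup>2) * ennreal (1 / b)) * (\<integral>\<^sup>+ y. ennreal ((f y)\<^sup>2) \<partial>lborel)"
    using aff[of "\<lambda>v. (f v)\<^sup>2"] by (simp add: nn_integral_cmult mult.assoc)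
  also have "ennreal (b\<^sup>2) * ennreal (1 / b) = ennreal b"
    using b by (simp add: ennreal_mult[symmetric] power2_eq_square)
  finally show "(\<integral>\<^sup>+ y. ennreal ((scaled f b x y)\<^sup>2) \<partial>lborel) = ennreal b * (\<integral>\<^sup>+ y. ennreal ((f y)\<^sup>2) \<partial>lborel)" .
qed

text \<open>The kernel, the driving noise and its skewness are forgotten here.
  \<open>char_pair\<close> yields joint densities and their bounds, and \<open>char_incr\<close>
  yields their continuity in the times.\<close>

locale rough_process = prob_space M for M :: "'w measure" +
  fixes X :: "real \<Rightarrow> 'w \<Rightarrow> real" and \<alpha> H \<kappa> C :: real
  assumes X_joint: "(\<lambda>(t, \<omega>). X t \<omega>) \<in> borel_measurable (borel \<Otimes>\<^sub>M M)"
    and alpha_pos: "0 < \<alpha>" and H_pos: "0 < H" and H_less: "H < 1" and kappa_pos: "0 < \<kappa>"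
    and char_pair: "\<And>s r l m. 0 < s \<Longrightarrow> s < r \<Longrightarrow> norm (LINT \<omega>|M. iexp (l * X s \<omega> + m * X r \<omega>))
       \<le> exp (- \<kappa> * (s powr (\<alpha> * H) * \<bar>l + m\<bar> powr \<alpha> + (r - s) powr (\<alpha> * H) * \<bar>m\<bar> powr \<alpha>))"
    and char_incr: "\<And>s r l. 0 \<le> s \<Longrightarrow> s < r \<Longrightarrow> norm (1 - (LINT \<omega>|M. iexp (l * (X r \<omega> - X s \<omega>))))
       \<le> C * \<bar>l\<bar> powr \<alpha> * (r - s) powr (\<alpha> * H)"
begin

lemma X_compose [measurable (raw)]:
  assumes "f \<in> borel_measurable N" "g \<in> N \<rightarrow>\<^sub>M M"
  shows "(\<lambda>z. X (f z) (g z)) \<in> borel_measurable N"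
  using measurable_compose[OF measurable_Pair[OF assms] X_joint] by simp

lemma X_measurable [measurable]: "X t \<in> borel_measurable M"
  by measurable

lemma scale_powr: "0 < h \<Longrightarrow> (\<kappa> * h powr (\<alpha> * H)) powr (- 1 / \<alpha>) = \<kappa> powr (- 1 / \<alpha>) * h powr (- H)"
  using alpha_pos kappa_pos by (simp add: powr_mult powr_powr)

text \<open>At times s < r the joint density is at most
  \<open>bound2 * (s powr (- H) * (r - s) powr (- H))\<close>: each of the gaps h = s and h = r - s
  contributes (\<kappa> h^(\<alpha> H))^(- 1 / \<alpha>), which is \<kappa>^(- 1 / \<alpha>) h^(-
  H). The counterpart for one time is \<open>bound1\<close>.\<close>

definition bound2 :: real where
  "bound2 = (\<kappa> powr (- 1 / \<alpha>) * stable_const \<alpha>)\<^sup>2 / (2 * pi)\<^sup>2"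

definition bound1 :: real where
  "bound1 = smoothing_const * (\<kappa> powr (- 1 / \<alpha>) * stable_const \<alpha>)"

lemma bound2_nonneg: "0 \<le> bound2" by (simp add: bound2_def)

lemma bound1_nonneg: "0 \<le> bound1"
  using stable_const_nonneg[of \<alpha>] measure_std_normal_01 by (simp add: bound1_def smoothing_const_def)

lemma char2_le:
  assumes "0 < s" "s < r"
  shows "norm (char2 M (X s) (X r) \<xi>)
    \<le> exp (- (\<kappa> * s powr (\<alpha> * H)) * \<bar>fst \<xi> + snd \<xi>\<bar> powr \<alpha> - (\<kappa> * (r - s) powr (\<alpha> * H)) * \<bar>snd \<xi>\<bar> powr \<alpha>)"
proof -
  have "- \<kappa> * (s powr (\<alpha> * H) * \<bar>fst \<xi> + snd \<xi>\<bar> powr \<alpha> + (r - s) powr (\<alpha> * H) * \<bar>snd \<xi>\<bar> powr \<alpha>)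
    = - (\<kappa> * s powr (\<alpha> * H)) * \<bar>fst \<xi> + snd \<xi>\<bar> powr \<alpha> - (\<kappa> * (r - s) powr (\<alpha> * H)) * \<bar>snd \<xi>\<bar> powr \<alpha>"
    by (simp add: algebra_simps)
  then show ?thesis
    using char_pair[OF assms, of "fst \<xi>" "snd \<xi>"] unfolding char2_def by (simp only:)
qed

lemma integrable_char2:
  assumes "0 < s" "s < r"
  shows "integrable lborel2 (char2 M (X s) (X r))"
    and "(LINT \<xi>|lborel2. norm (char2 M (X s) (X r) \<xi>)) / (2 * pi)\<^sup>2 \<le> bound2 * (s powr (- H) * (r - s) powr (- H))"
proof -
  let ?A = "\<kappa> * s powr (\<alpha> * H)" and ?B = "\<kappa> * (r - s) powr (\<alpha> * H)"
  let ?G = "\<lambda>\<xi>. exp (- ?A * \<bar>fst \<xi> + snd \<xi>\<bar> powr \<alpha> - ?B * \<bar>snd \<xi>\<bar> powr \<alpha>)"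
  have AB: "0 < ?A" "0 < ?B" using assms kappa_pos by auto
  note G = has_bochner_integral_stable_bound[OF alpha_pos AB]
  show int: "integrable lborel2 (char2 M (X s) (X r))"
  proof (rule Bochner_Integration.integrable_bound)
    show "integrable lborel2 ?G" using G by (simp add: has_bochner_integral_iff)
    show "char2 M (X s) (X r) \<in> borel_measurable lborel2" by (rule char2_measurable) measurable
    show "AE \<xi> in lborel2. norm (char2 M (X s) (X r) \<xi>) \<le> norm (?G \<xi>)"
      using char2_le[OF assms] by (intro AE_I2) simp
  qed
  have "(LINT \<xi>|lborel2. norm (char2 M (X s) (X r) \<xi>)) \<le> (LINT \<xi>|lborel2. ?G \<xi>)"
    using G integrable_norm[OF int] by (intro integral_mono char2_le assms) (auto simp: has_bochner_integral_iff)
  also have "\<dots> = (?A powr (- 1 / \<alpha>) * stable_const \<alpha>) * (?B powr (- 1 / \<alpha>) * stable_const \<alpha>)"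
    using G by (simp only: has_bochner_integral_iff)
  also have "\<dots> = (\<kappa> powr (- 1 / \<alpha>) * stable_const \<alpha>)\<^sup>2 * (s powr (- H) * (r - s) powr (- H))"
    using assms scale_powr[of s] scale_powr[of "r - s"] by (simp add: power2_eq_square)
  finally show "(LINT \<xi>|lborel2. norm (char2 M (X s) (X r) \<xi>)) / (2 * pi)\<^sup>2 \<le> bound2 * (s powr (- H) * (r - s) powr (- H))"
    by (simp add: bound2_def divide_right_mono)
qed

lemma nn_integral_pair_le:
  assumes "0 < s" "s < r" "h1 \<in> borel_measurable borel" "h2 \<in> borel_measurable borel"
  shows "(\<integral>\<^sup>+ \<omega>. h1 (X s \<omega>) * h2 (X r \<omega>) \<partial>M)
     \<le> ennreal (bound2 * (s powr (- H) * (r - s) powr (- H))) * ((\<integral>\<^sup>+ y. h1 y \<partial>lborel) * (\<integral>\<^sup>+ z. h2 z \<partial>lborel))"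
  using assms integrable_char2[OF assms(1,2)] by (intro nn_integral_le_fourier_inv) auto

lemma nn_integral_single_le:
  assumes s: "0 < s" and [measurable]: "h \<in> borel_measurable borel"
  shows "(\<integral>\<^sup>+ \<omega>. h (X s \<omega>) \<partial>M) \<le> ennreal (bound1 * s powr (- H)) * (\<integral>\<^sup>+ y. h y \<partial>lborel)"
proof -
  let ?A = "\<kappa> * s powr (\<alpha> * H)"
  have A: "0 < ?A" using s kappa_pos by auto
  have hb: "has_bochner_integral lborel (\<lambda>l. exp (- ?A * \<bar>l + 0\<bar> powr \<alpha>)) (?A powr (- 1 / \<alpha>) * stable_const \<alpha>)"
    by (rule has_bochner_integral_exp_neg_abs_powr[OF alpha_pos A])
  have "(\<integral>\<^sup>+ \<omega>. h (X s \<omega>) \<partial>M) \<le> ennreal (smoothing_const * (LINT l|lborel. exp (- ?A * \<bar>l + 0\<bar> powr \<alpha>))) * (\<integral>\<^sup>+ y. h y \<partial>lborel)"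
  proof (rule nn_integral_le_char)
    \<comment> \<open>The estimate for pairs with m = 0; any time after s could replace s +
      1.\<close>
    show "norm (LINT \<omega>|M. iexp (l * X s \<omega>)) \<le> exp (- ?A * \<bar>l + 0\<bar> powr \<alpha>)" for l
      using char_pair[of s "s + 1" l 0] s by (simp add: mult.assoc)
    show "integrable lborel (\<lambda>l. exp (- ?A * \<bar>l + 0\<bar> powr \<alpha>))" using hb by (simp only: has_bochner_integral_iff)
  qed auto
  also have "(LINT l|lborel. exp (- ?A * \<bar>l + 0\<bar> powr \<alpha>)) = ?A powr (- 1 / \<alpha>) * stable_const \<alpha>"
    using hb by (simp only: has_bochner_integral_iff)
  also have "smoothing_const * (?A powr (- 1 / \<alpha>) * stable_const \<alpha>) = bound1 * s powr (- H)"
    using scale_powr[OF s] by (simp add: bound1_def)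
  finally show ?thesis .
qed

text \<open>By |exp (i y) - 1|^2 = 2 - 2 Re (exp (i y)) the second moment of this distance is
  controlled by 1 minus the characteristic function; nonnegativity of the variance then gives the
  first moment. Bounded exponentials replace the increments themselves, which may have no
  moments.\<close>

lemma incr_le:
  assumes s: "0 \<le> s" "0 \<le> r"
  shows "(LINT \<omega>|M. norm (iexp (l * (X r \<omega> - X s \<omega>)) - 1)) \<le> sqrt (2 * (C * \<bar>l\<bar> powr \<alpha> * \<bar>r - s\<bar> powr (\<alpha> * H)))"
proof -
  have main: "(LINT \<omega>|M. norm (iexp (l * (X r \<omega> - X s \<omega>)) - 1)) \<le> sqrt (2 * (C * \<bar>l\<bar> powr \<alpha> * \<bar>r - s\<bar> powr (\<alpha> * H)))"
    if s: "0 \<le> s" "s < r" for s r l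
  proof -
    let ?Y = "\<lambda>\<omega>. l * (X r \<omega> - X s \<omega>)"
    let ?Z = "\<lambda>\<omega>. norm (iexp (?Y \<omega>) - 1)"
    have inte: "integrable M (\<lambda>\<omega>. iexp (?Y \<omega>))" by (rule integrable_const_bound[of _ 1]) auto
    have Z2: "(?Z \<omega>)\<^sup>2 = 2 - 2 * Re (iexp (?Y \<omega>))" for \<omega>
    proof -
      have "(Re (iexp (?Y \<omega>)))\<^sup>2 + (Im (iexp (?Y \<omega>)))\<^sup>2 = 1"
        using norm_exp_i_times[of "?Y \<omega>"] by (metis cmod_power2 power_one)
      then show ?thesis by (simp only: cmod_power2 minus_complex.simps one_complex.simps) (simp add: power2_eq_square algebra_simps)
    qed
    have intZ: "integrable M ?Z" using inte by auto
    have intZ2: "integrable M (\<lambda>\<omega>. (?Z \<omega>)\<^sup>2)" unfolding Z2 using inte by (intro Bochner_Integration.integrable_diff integrable_mult_right integrable_Re) auto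
    have "0 \<le> variance ?Z" by (rule variance_positive)
    then have "(expectation ?Z)\<^sup>2 \<le> expectation (\<lambda>\<omega>. (?Z \<omega>)\<^sup>2)"
      using variance_eq[OF intZ intZ2] by linarith
    also have "\<dots> = 2 - 2 * (LINT \<omega>|M. Re (iexp (?Y \<omega>)))"
      unfolding Z2 using inte by (subst Bochner_Integration.integral_diff) (auto simp: prob_space intro!: integrable_Re simp del: Re_exp)
    also have "(LINT \<omega>|M. Re (iexp (?Y \<omega>))) = Re (LINT \<omega>|M. iexp (?Y \<omega>))" by (rule integral_Re[OF inte])
    also have "2 - 2 * Re (LINT \<omega>|M. iexp (?Y \<omega>)) = 2 * Re (1 - (LINT \<omega>|M. iexp (?Y \<omega>)))" by simp
    also have "\<dots> \<le> 2 * norm (1 - (LINT \<omega>|M. iexp (?Y \<omega>)))" by (intro mult_left_mono complex_Re_le_cmod) simp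
    also have "\<dots> \<le> 2 * (C * \<bar>l\<bar> powr \<alpha> * \<bar>r - s\<bar> powr (\<alpha> * H))" using char_incr[OF s, of l] s by simp
    finally show ?thesis by (rule real_le_rsqrt)
  qed
  consider "s < r" | "s = r" | "r < s" by linarith
  then show ?thesis
  proof cases
    case 3
    have "- l * (X s \<omega> - X r \<omega>) = l * (X r \<omega> - X s \<omega>)" for \<omega> by (simp add: algebra_simps)
    then show ?thesis using main[OF s(2) 3, of "- l"] by (simp only: abs_minus_cancel abs_minus_commute)
  qed (use main s in auto)
qed

text \<open>The exponential of a sum of two increments is compared with 1 through exp (p + q) - 1 =
  exp p (exp q - 1) + (exp p - 1), so the two times can be moved separately. The error tends to 0
  since \<alpha> H > 0.\<close>

lemma char2_tendsto:
  assumes sn: "\<And>n. 0 \<le> sn n" "sn \<longlonglongrightarrow> s" and rn: "\<And>n. 0 \<le> rn n" "rn \<longlonglongrightarrow> r"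
  shows "(\<lambda>n. char2 M (X (sn n)) (X (rn n)) \<xi>) \<longlonglongrightarrow> char2 M (X s) (X r) \<xi>"
proof -
  have s0: "0 \<le> s" and r0: "0 \<le> r" using sn rn by (auto intro: LIMSEQ_le_const)
  obtain l m where \<xi>: "\<xi> = (l, m)" by (cases \<xi>)
  have ie: "integrable M (\<lambda>\<omega>. iexp (c * X u \<omega> + d * X v \<omega>))" for c d u v
    by (rule integrable_const_bound[of _ 1]) auto
  have id: "integrable M (\<lambda>\<omega>. norm (iexp (c * (X u \<omega> - X v \<omega>)) - 1))" for c u v
    by (intro integrable_norm Bochner_Integration.integrable_diff) (auto intro!: integrable_const_bound[of _ 1])
  let ?b = "\<lambda>n. sqrt (2 * (C * \<bar>l\<bar> powr \<alpha> * \<bar>sn n - s\<bar> powr (\<alpha> * H))) + sqrt (2 * (C * \<bar>m\<bar> powr \<alpha> * \<bar>rn n - r\<bar> powr (\<alpha> * H)))"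
  have le: "norm (char2 M (X (sn n)) (X (rn n)) \<xi> - char2 M (X s) (X r) \<xi>) \<le> ?b n" for n
  proof -
    have "norm (char2 M (X (sn n)) (X (rn n)) \<xi> - char2 M (X s) (X r) \<xi>)
      = norm (LINT \<omega>|M. iexp (l * X (sn n) \<omega> + m * X (rn n) \<omega>) - iexp (l * X s \<omega> + m * X r \<omega>))"
      unfolding char2_def \<xi> fst_conv snd_conv using ie by (subst Bochner_Integration.integral_diff) auto
    also have "\<dots> \<le> (LINT \<omega>|M. norm (iexp (l * X (sn n) \<omega> + m * X (rn n) \<omega>) - iexp (l * X s \<omega> + m * X r \<omega>)))"
      by (rule integral_norm_bound)
    also have "\<dots> \<le> (LINT \<omega>|M. norm (iexp (l * (X (sn n) \<omega> - X s \<omega>)) - 1) + norm (iexp (m * (X (rn n) \<omega> - X r \<omega>)) - 1))"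
    proof (rule integral_mono)
      show "integrable M (\<lambda>\<omega>. norm (iexp (l * X (sn n) \<omega> + m * X (rn n) \<omega>) - iexp (l * X s \<omega> + m * X r \<omega>)))"
        by (intro integrable_norm Bochner_Integration.integrable_diff ie)
      show "integrable M (\<lambda>\<omega>. norm (iexp (l * (X (sn n) \<omega> - X s \<omega>)) - 1) + norm (iexp (m * (X (rn n) \<omega> - X r \<omega>)) - 1))"
        by (intro Bochner_Integration.integrable_add id)
      fix \<omega>
      let ?p = "l * (X (sn n) \<omega> - X s \<omega>)" and ?q = "m * (X (rn n) \<omega> - X r \<omega>)"
      have "iexp (l * X (sn n) \<omega> + m * X (rn n) \<omega>) - iexp (l * X s \<omega> + m * X r \<omega>)
          = iexp (l * X s \<omega> + m * X r \<omega>) * (iexp ?p * (iexp ?q - 1) + (iexp ?p - 1))"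
        by (simp add: algebra_simps exp_add[symmetric])
      also have "norm \<dots> = norm (iexp ?p * (iexp ?q - 1) + (iexp ?p - 1))" by (simp add: norm_mult)
      also have "\<dots> \<le> norm (iexp ?p * (iexp ?q - 1)) + norm (iexp ?p - 1)" by (rule norm_triangle_ineq)
      also have "\<dots> = norm (iexp ?p - 1) + norm (iexp ?q - 1)" by (simp add: norm_mult)
      finally show "norm (iexp (l * X (sn n) \<omega> + m * X (rn n) \<omega>) - iexp (l * X s \<omega> + m * X r \<omega>)) \<le> norm (iexp ?p - 1) + norm (iexp ?q - 1)" .
    qed
    also have "\<dots> = (LINT \<omega>|M. norm (iexp (l * (X (sn n) \<omega> - X s \<omega>)) - 1)) + (LINT \<omega>|M. norm (iexp (m * (X (rn n) \<omega> - X r \<omega>)) - 1))"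
      by (rule Bochner_Integration.integral_add[OF id id])
    also have "\<dots> \<le> ?b n"
      using incr_le[OF s0 sn(1)] incr_le[OF r0 rn(1)] by (intro add_mono) auto
    finally show ?thesis .
  qed
  have pow: "(\<lambda>n. \<bar>u n - v\<bar> powr (\<alpha> * H)) \<longlonglongrightarrow> 0" if "u \<longlonglongrightarrow> v" for u :: "nat \<Rightarrow> real" and v
  proof -
    have "(\<lambda>n. \<bar>u n - v\<bar>) \<longlonglongrightarrow> 0" using that by (simp add: LIM_zero tendsto_rabs_zero)
    moreover have "\<alpha> * H > 0" using alpha_pos H_pos by simp
    ultimately show ?thesis
      by (intro tendsto_zero_powrI[of _ _ _ "\<alpha> * H"]) auto
  qed
  have b_lim: "?b \<longlonglongrightarrow> 0"
  proof -
    have "(\<lambda>n. sqrt (2 * (c * \<bar>u n - v\<bar> powr (\<alpha> * H)))) \<longlonglongrightarrow> 0" if "u \<longlonglongrightarrow> v" for u :: "nat \<Rightarrow> real" and v c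
      using tendsto_real_sqrt[OF tendsto_mult_left[OF tendsto_mult_left[OF pow[OF that], of c], of 2]] by simp
    from tendsto_add[OF this[OF sn(2)] this[OF rn(2)]] show ?thesis by simp
  qed
  have "(\<lambda>n. char2 M (X (sn n)) (X (rn n)) \<xi> - char2 M (X s) (X r) \<xi>) \<longlonglongrightarrow> 0"
    by (rule Lim_null_comparison[OF _ b_lim]) (intro always_eventually allI le)
  then show ?thesis by (simp add: LIM_zero_iff)
qed

text \<open>Substituting y = x + v / b n and z = x + v' / c n moves the scaling from the test
  functions to the density, which is then evaluated at points tending to (x, x) and at times tending
  to (s, r). The densities are uniformly bounded by \<open>K\<close>, so \<open>K\<close> times |f|
  |g| dominates and integrability of f and g suffices.\<close>

lemma expectation_scaled_tendsto:
  assumes s: "0 < s" "s < r" and sn: "sn \<longlonglongrightarrow> s" and rn: "rn \<longlonglongrightarrow> r"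
    and f: "f \<in> borel_measurable borel" "integrable lborel f"
    and g: "g \<in> borel_measurable borel" "integrable lborel g"
    and b: "\<And>n. 0 < b n" "filterlim b at_top sequentially"
    and c: "\<And>n. 0 < c n" "filterlim c at_top sequentially"
  shows "(\<lambda>n. LINT \<omega>|M. scaled f (b n) x (X (sn n) \<omega>) * scaled g (c n) x (X (rn n) \<omega>))
     \<longlonglongrightarrow> (LINT y|lborel. f y) * (LINT y|lborel. g y) * fourier_inv (char2 M (X s) (X r)) (x, x)"
proof -
  note [measurable] = f(1) g(1)
  \<comment> \<open>The times are ordered and separated only for large n. At the other indices they
    are replaced by their limits, so that the density bounds hold for all n with the same
    constants.\<close>
  define ok where "ok n \<longleftrightarrow> s / 2 < sn n \<and> (r - s) / 2 < rn n - sn n" for n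
  define s' where "s' n = (if ok n then sn n else s)" for n
  define r' where "r' n = (if ok n then rn n else r)" for n
  have ev: "eventually ok sequentially"
  proof -
    have "eventually (\<lambda>n. s / 2 < sn n) sequentially" by (rule order_tendstoD(1)[OF sn]) (use s in auto)
    moreover have "eventually (\<lambda>n. (r - s) / 2 < rn n - sn n) sequentially"
      by (rule order_tendstoD(1)[OF tendsto_diff[OF rn sn]]) (use s in auto)
    ultimately show ?thesis by eventually_elim (simp add: ok_def)
  qed
  have s'_lim: "s' \<longlonglongrightarrow> s" by (rule Lim_transform_eventually[OF sn]) (use ev in eventually_elim, simp add: s'_def)
  have r'_lim: "r' \<longlonglongrightarrow> r" by (rule Lim_transform_eventually[OF rn]) (use ev in eventually_elim, simp add: r'_def)
  have s'_ge: "s / 2 \<le> s' n" and rs'_ge: "(r - s) / 2 \<le> r' n - s' n" for n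
    using s by (auto simp: s'_def r'_def ok_def)
  have s'_pos: "0 < s' n" and rs': "s' n < r' n" for n using s'_ge[of n] rs'_ge[of n] s by auto
  define p where "p n = fourier_inv (char2 M (X (s' n)) (X (r' n)))" for n
  define q where "q = fourier_inv (char2 M (X s) (X r)) (x, x)"
  have [measurable]: "char2 M (X u) (X v) \<in> borel_measurable lborel2" for u v by (rule char2_measurable) measurable
  have [measurable]: "p n \<in> borel_measurable lborel2" for n unfolding p_def by (rule fourier_inv_measurable) measurable
  let ?A = "\<kappa> * (s / 2) powr (\<alpha> * H)" and ?B = "\<kappa> * ((r - s) / 2) powr (\<alpha> * H)"
  let ?G = "\<lambda>\<xi>. exp (- ?A * \<bar>fst \<xi> + snd \<xi>\<bar> powr \<alpha> - ?B * \<bar>snd \<xi>\<bar> powr \<alpha>)"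
  have AB: "0 < ?A" "0 < ?B" using s kappa_pos by auto
  have G: "integrable lborel2 ?G" using has_bochner_integral_stable_bound[OF alpha_pos AB] by (simp only: has_bochner_integral_iff)
  have le: "norm (char2 M (X (s' n)) (X (r' n)) \<xi>) \<le> ?G \<xi>" for n \<xi>
  proof -
    have "(s / 2) powr (\<alpha> * H) \<le> s' n powr (\<alpha> * H)" "((r - s) / 2) powr (\<alpha> * H) \<le> (r' n - s' n) powr (\<alpha> * H)"
      using s'_ge[of n] rs'_ge[of n] s alpha_pos H_pos by (auto intro!: powr_mono2)
    then have "?A * \<bar>fst \<xi> + snd \<xi>\<bar> powr \<alpha> \<le> \<kappa> * s' n powr (\<alpha> * H) * \<bar>fst \<xi> + snd \<xi>\<bar> powr \<alpha>"
      "?B * \<bar>snd \<xi>\<bar> powr \<alpha> \<le> \<kappa> * (r' n - s' n) powr (\<alpha> * H) * \<bar>snd \<xi>\<bar> powr \<alpha>"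
      using kappa_pos by (auto intro!: mult_right_mono mult_left_mono)
    then show ?thesis
      by (intro order_trans[OF char2_le[OF s'_pos rs']]) (simp only: exp_le_cancel_iff, simp)
  qed
  define K where "K = (LINT \<xi>|lborel2. ?G \<xi>) / (2 * pi)\<^sup>2"
  have p_bd: "\<bar>p n w\<bar> \<le> K" for n w
  proof -
    have "\<bar>p n w\<bar> \<le> (LINT \<xi>|lborel2. norm (char2 M (X (s' n)) (X (r' n)) \<xi>)) / (2 * pi)\<^sup>2"
      unfolding p_def by (rule abs_fourier_inv_le)
    also have "\<dots> \<le> K" unfolding K_def
      using integrable_norm[OF integrable_char2(1)[OF s'_pos rs']] G le by (intro divide_right_mono integral_mono) auto
    finally show ?thesis .
  qed
  have p_lim: "(\<lambda>n. p n (w n)) \<longlonglongrightarrow> q" if "w \<longlonglongrightarrow> (x, x)" for w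
    unfolding p_def q_def
  proof (rule fourier_inv_tendsto[where D = ?G])
    show "(\<lambda>n. char2 M (X (s' n)) (X (r' n)) \<xi>) \<longlonglongrightarrow> char2 M (X s) (X r) \<xi>" for \<xi>
      using s'_pos rs' by (intro char2_tendsto s'_lim r'_lim) (auto intro: less_imp_le less_trans)
  qed (use G le that in auto)
  have sf: "sigma_finite_measure (lborel :: real measure)" by unfold_locales
  have fg: "has_bochner_integral lborel2 (\<lambda>w. f (fst w) * g (snd w)) ((LINT y|lborel. f y) * (LINT y|lborel. g y))"
    by (intro has_bochner_integral_pair_mult sf has_bochner_integral_integrable f g)
  have binv: "(\<lambda>n. 1 / b n) \<longlonglongrightarrow> 0" "(\<lambda>n. 1 / c n) \<longlonglongrightarrow> 0"
    using tendsto_divide_0[OF tendsto_const filterlim_at_top_imp_at_infinity[OF b(2)], of 1]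
      tendsto_divide_0[OF tendsto_const filterlim_at_top_imp_at_infinity[OF c(2)], of 1] by auto
  let ?P = "\<lambda>n w. p n (x + 1 / b n * fst w, x + 1 / c n * snd w)"
  have dom: "norm (f (fst w) * g (snd w) * ?P n w) \<le> norm (K * (f (fst w) * g (snd w)))" for n w
  proof -
    have "\<bar>f (fst w) * g (snd w)\<bar> * \<bar>?P n w\<bar> \<le> \<bar>f (fst w) * g (snd w)\<bar> * \<bar>K\<bar>"
      by (intro mult_left_mono order_trans[OF p_bd abs_ge_self]) auto
    then show ?thesis by (simp add: abs_mult mult.commute)
  qed
  have E: "(LINT \<omega>|M. scaled f (b n) x (X (s' n) \<omega>) * scaled g (c n) x (X (r' n) \<omega>))
      = (LINT w|lborel2. f (fst w) * g (snd w) * ?P n w)" for n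
  proof -
    have scaled_int: "integrable lborel (scaled h d x)" if "integrable lborel h" "0 < d" for h d
    proof -
      have "integrable lborel (\<lambda>y. h (- d * x + d * y))"
        using that by (intro lborel_integrable_real_affine) auto
      moreover have "scaled h d x = (\<lambda>y. d * h (- d * x + d * y))"
        by (auto simp: scaled_def algebra_simps)
      ultimately show ?thesis by simp
    qed
    have int1: "integrable lborel2 (\<lambda>w. p n w * (scaled f (b n) x (fst w) * scaled g (c n) x (snd w)))"
    proof (rule Bochner_Integration.integrable_bound)
      show "integrable lborel2 (\<lambda>w. K * (scaled f (b n) x (fst w) * scaled g (c n) x (snd w)))"
        using has_bochner_integral_pair_mult[OF sf sf has_bochner_integral_integrable[OF scaled_int[OF f(2) b(1)]]
            has_bochner_integral_integrable[OF scaled_int[OF g(2) c(1)]]]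
        by (auto simp: has_bochner_integral_iff)
    qed (use p_bd order_trans[OF p_bd abs_ge_self] in \<open>auto intro!: AE_I2 mult_right_mono simp: abs_mult\<close>)
    have int2: "integrable lborel2 (\<lambda>w. f (fst w) * g (snd w) * ?P n w)"
    proof (rule Bochner_Integration.integrable_bound)
      show "integrable lborel2 (\<lambda>w. K * (f (fst w) * g (snd w)))"
        using fg by (auto simp: has_bochner_integral_iff)
      show "AE w in lborel2. norm (f (fst w) * g (snd w) * ?P n w) \<le> norm (K * (f (fst w) * g (snd w)))"
        by (rule AE_I2) (rule dom)
    qed measurable
    have "(LINT \<omega>|M. scaled f (b n) x (X (s' n) \<omega>) * scaled g (c n) x (X (r' n) \<omega>))
        = (LINT w|lborel2. p n w * (scaled f (b n) x (fst w) * scaled g (c n) x (snd w)))"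
      using integral_fourier_inv[OF _ _ integrable_char2(1)[OF s'_pos rs'], of n "\<lambda>w. scaled f (b n) x (fst w) * scaled g (c n) x (snd w)"]
      by (simp add: p_def)
    also have "\<dots> = (LINT y|lborel. LINT z|lborel. p n (y, z) * (scaled f (b n) x y * scaled g (c n) x z))"
      using lborel_pair.integral_fst'[OF int1] by simp
    also have "\<dots> = (LINT y|lborel. LINT z|lborel. scaled f (b n) x y * (g z * p n (y, x + 1 / c n * z)))"
    proof (rule Bochner_Integration.integral_cong[OF refl])
      fix y
      have "(LINT z|lborel. p n (y, z) * (scaled f (b n) x y * scaled g (c n) x z))
        = 1 / c n * (LINT z|lborel. p n (y, x + 1 / c n * z) * (scaled f (b n) x y * scaled g (c n) x (x + 1 / c n * z)))"
        using c(1)[of n] by (subst lborel_integral_real_affine[of "1 / c n" _ x]) auto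
      also have "\<dots> = (LINT z|lborel. 1 / c n * (p n (y, x + 1 / c n * z) * (scaled f (b n) x y * scaled g (c n) x (x + 1 / c n * z))))"
        by (rule integral_mult_right_zero[symmetric])
      also have "\<dots> = (LINT z|lborel. scaled f (b n) x y * (g z * p n (y, x + 1 / c n * z)))"
        using c(1)[of n] by (intro Bochner_Integration.integral_cong) (auto simp: scaled_def)
      finally show "(LINT z|lborel. p n (y, z) * (scaled f (b n) x y * scaled g (c n) x z)) = \<dots>" .
    qed
    also have "\<dots> = (LINT y|lborel. scaled f (b n) x y * (LINT z|lborel. g z * p n (y, x + 1 / c n * z)))"
      by (simp only: integral_mult_right_zero)
    also have "\<dots> = 1 / b n * (LINT y|lborel. scaled f (b n) x (x + 1 / b n * y) * (LINT z|lborel. g z * p n (x + 1 / b n * y, x + 1 / c n * z)))"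
      using b(1)[of n] by (subst lborel_integral_real_affine[of "1 / b n" _ x]) auto
    also have "\<dots> = (LINT y|lborel. 1 / b n * (scaled f (b n) x (x + 1 / b n * y) * (LINT z|lborel. g z * p n (x + 1 / b n * y, x + 1 / c n * z))))"
      by (rule integral_mult_right_zero[symmetric])
    also have "\<dots> = (LINT y|lborel. f y * (LINT z|lborel. g z * p n (x + 1 / b n * y, x + 1 / c n * z)))"
      using b(1)[of n] by (intro Bochner_Integration.integral_cong) (auto simp: scaled_def)
    also have "\<dots> = (LINT y|lborel. LINT z|lborel. f y * g z * p n (x + 1 / b n * y, x + 1 / c n * z))"
      by (simp only: integral_mult_right_zero mult.assoc)
    also have "\<dots> = (LINT w|lborel2. f (fst w) * g (snd w) * ?P n w)"
      using lborel_pair.integral_fst'[OF int2] by simp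
    finally show ?thesis .
  qed
  have "(\<lambda>n. LINT w|lborel2. f (fst w) * g (snd w) * ?P n w) \<longlonglongrightarrow> (LINT w|lborel2. f (fst w) * g (snd w) * q)"
  proof (rule integral_dominated_convergence[where w = "\<lambda>w. norm (K * (f (fst w) * g (snd w)))"])
    show "integrable lborel2 (\<lambda>w. norm (K * (f (fst w) * g (snd w))))"
      using fg by (auto simp: has_bochner_integral_iff)
    show "AE w in lborel2. (\<lambda>n. f (fst w) * g (snd w) * ?P n w) \<longlonglongrightarrow> f (fst w) * g (snd w) * q"
    proof (intro AE_I2 tendsto_mult tendsto_const p_lim)
      fix w :: "real \<times> real"
      have "(\<lambda>n. (x + 1 / b n * fst w, x + 1 / c n * snd w)) \<longlonglongrightarrow> (x + 0 * fst w, x + 0 * snd w)"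
        by (intro tendsto_Pair tendsto_add tendsto_const tendsto_mult binv)
      then show "(\<lambda>n. (x + 1 / b n * fst w, x + 1 / c n * snd w)) \<longlonglongrightarrow> (x, x)" by simp
    qed
    show "AE w in lborel2. norm (f (fst w) * g (snd w) * ?P n w) \<le> norm (K * (f (fst w) * g (snd w)))" for n
      by (rule AE_I2) (rule dom)
  qed measurable
  also have "(LINT w|lborel2. f (fst w) * g (snd w) * q) = (LINT y|lborel. f y) * (LINT y|lborel. g y) * q"
    using fg by (simp add: has_bochner_integral_iff)
  finally have "(\<lambda>n. LINT \<omega>|M. scaled f (b n) x (X (s' n) \<omega>) * scaled g (c n) x (X (r' n) \<omega>)) \<longlonglongrightarrow> \<dots>"
    unfolding E .
  then show ?thesis unfolding q_def
    by (rule Lim_transform_eventually) (use ev in eventually_elim, simp add: s'_def r'_def)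
qed

end

section \<open>Second moments of balanced time integrals\<close>

lemma has_bochner_integral_singular_powr:
  fixes H T :: real
  assumes "0 < H" "H < 1" "0 \<le> T"
  shows "has_bochner_integral lborel (\<lambda>v. indicator {0<..<T} v * v powr (- H)) (T powr (1 - H) / (1 - H))"
proof (rule has_bochner_integral_nn_integral)
  have "((\<lambda>v. v powr (- H)) has_integral (T powr (- H + 1) / (- H + 1))) {0..T}"
    using assms by (intro has_integral_powr_from_0) auto
  from nn_integral_has_integral_lebesgue[OF _ this]
  have "(\<integral>\<^sup>+ v. ennreal (indicator {0..T} v * v powr (- H)) \<partial>lborel) = ennreal (T powr (1 - H) / (1 - H))" by simp
  moreover have "(\<integral>\<^sup>+ v. ennreal (indicator {0<..<T} v * v powr (- H)) \<partial>lborel) = (\<integral>\<^sup>+ v. ennreal (indicator {0..T} v * v powr (- H)) \<partial>lborel)"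
  proof (rule nn_integral_cong_AE)
    have "AE v in lborel. v \<noteq> 0 \<and> v \<noteq> T"
      using AE_lborel_singleton[of 0] AE_lborel_singleton[of T] by eventually_elim auto
    then show "AE v in lborel. ennreal (indicator {0<..<T} v * v powr (- H)) = ennreal (indicator {0..T} v * v powr (- H))"
      by eventually_elim (auto simp: indicator_def)
  qed
  ultimately show "(\<integral>\<^sup>+ v. ennreal (indicator {0<..<T} v * v powr (- H)) \<partial>lborel) = ennreal (T powr (1 - H) / (1 - H))" by simp
qed (use assms in auto)

lemma abs_mult_le_squares: "\<bar>y * z\<bar> \<le> y\<^sup>2 + z\<^sup>2" for y z :: real
proof -
  have "0 \<le> (\<bar>y\<bar> - \<bar>z\<bar>)\<^sup>2" by simp
  then have "2 * \<bar>y * z\<bar> \<le> y\<^sup>2 + z\<^sup>2" by (simp add: power2_diff abs_mult)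
  then show ?thesis using abs_ge_zero[of "y * z"] by linarith
qed

lemma integrable_mult_of_squares:
  fixes Y Z :: "'a \<Rightarrow> real"
  assumes [measurable]: "Y \<in> borel_measurable M" "Z \<in> borel_measurable M"
    and "integrable M (\<lambda>\<omega>. (Y \<omega>)\<^sup>2)" "integrable M (\<lambda>\<omega>. (Z \<omega>)\<^sup>2)"
  shows "integrable M (\<lambda>\<omega>. Y \<omega> * Z \<omega>)"
  by (rule Bochner_Integration.integrable_bound[OF Bochner_Integration.integrable_add[OF assms(3,4)]])
    (use abs_mult_le_squares in \<open>auto intro!: AE_I2\<close>)

text \<open>
  The piece \<open>i\<close> is \<open>f i\<close> at the scale \<open>b i n\<close>, evaluated along the discretized time \<open>\<sigma> i n\<close> and
  weighted by \<open>w i n\<close>. The total mass \<open>0\<close> makes the limits of the covariances cancel, so the limit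
  need not be identified.
\<close>

locale balanced_pieces = rough_process +
  fixes I :: "'i set" and f :: "'i \<Rightarrow> real \<Rightarrow> real" and b :: "'i \<Rightarrow> nat \<Rightarrow> real"
    and w \<sigma> :: "'i \<Rightarrow> nat \<Rightarrow> real \<Rightarrow> real" and x T :: real
  assumes I: "finite I" and T: "0 \<le> T"
    and f_meas [measurable]: "\<And>i. f i \<in> borel_measurable borel"
    and f_int: "\<And>i. integrable lborel (f i)" and f2_int: "\<And>i. integrable lborel (\<lambda>y. (f i y)\<^sup>2)"
    and b_pos: "\<And>i n. 0 < b i n" and b_top: "\<And>i. filterlim (b i) at_top sequentially"
    and b_small: "\<And>i. (\<lambda>n. b i n / real n) \<longlonglongrightarrow> 0"
    and w_meas [measurable]: "\<And>i n. w i n \<in> borel_measurable borel"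
    and w_bd: "\<And>i n s. \<bar>w i n s\<bar> \<le> 1" and w_out: "\<And>i n s. s \<notin> {0<..<T} \<Longrightarrow> w i n s = 0"
    and w_lim: "\<And>i s. s \<in> {0<..<T} \<Longrightarrow> (\<lambda>n. w i n s) \<longlonglongrightarrow> 1"
    and \<sigma>_meas [measurable]: "\<And>i n. \<sigma> i n \<in> borel_measurable borel"
    and \<sigma>_nonneg: "\<And>i n s. 0 < s \<Longrightarrow> 0 \<le> \<sigma> i n s"
    and \<sigma>_close: "\<And>i n s. 0 < n \<Longrightarrow> 0 < s \<Longrightarrow> s \<le> \<sigma> i n s \<and> \<sigma> i n s \<le> s + 1 / real n"
    and balanced: "(\<Sum>i\<in>I. LINT y|lborel. f i y) = 0"
begin

section \<open>Moment bounds for the balanced integrand\<close>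

definition D :: "nat \<Rightarrow> real \<Rightarrow> 'a \<Rightarrow> real" where
  "D n s \<omega> = (\<Sum>i\<in>I. w i n s * scaled (f i) (b i n) x (X (\<sigma> i n s) \<omega>))"

lemma D_compose [measurable (raw)]:
  assumes [measurable]: "g \<in> borel_measurable N" "h \<in> N \<rightarrow>\<^sub>M M"
  shows "(\<lambda>z. D n (g z) (h z)) \<in> borel_measurable N"
  unfolding D_def by measurable

lemma D_out: "s \<notin> {0<..<T} \<Longrightarrow> D n s \<omega> = 0"
  by (simp add: D_def w_out)

text \<open>Square integrability of \<open>f i\<close> enters here: the bound at one time is applied
  to the squared test function, whose integral carries the factor \<open>b i n\<close>.\<close>

lemma scaled_second_moment:
  assumes u: "0 < u"
  shows "integrable M (\<lambda>\<omega>. (scaled (f i) (b i n) x (X u \<omega>))\<^sup>2)"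
    and "(LINT \<omega>|M. (scaled (f i) (b i n) x (X u \<omega>))\<^sup>2) \<le> bound1 * u powr (- H) * (b i n * (LINT y|lborel. (f i y)\<^sup>2))"
proof -
  let ?S = "\<lambda>\<omega>. (scaled (f i) (b i n) x (X u \<omega>))\<^sup>2" and ?q = "LINT y|lborel. (f i y)\<^sup>2"
  have q0: "0 \<le> ?q" by (intro integral_nonneg_AE) auto
  have nonneg: "0 \<le> bound1 * u powr (- H) * (b i n * ?q)"
    using bound1_nonneg q0 b_pos[of i n] by (intro mult_nonneg_nonneg) auto
  have "(\<integral>\<^sup>+ \<omega>. ennreal (?S \<omega>) \<partial>M) \<le> ennreal (bound1 * u powr (- H)) * (\<integral>\<^sup>+ y. ennreal ((scaled (f i) (b i n) x y)\<^sup>2) \<partial>lborel)"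
    by (rule nn_integral_single_le[OF u]) measurable
  also have "(\<integral>\<^sup>+ y. ennreal ((scaled (f i) (b i n) x y)\<^sup>2) \<partial>lborel) = ennreal (b i n) * ennreal ?q"
    using f2_int[of i] by (subst nn_integral_scaled(2)[OF f_meas b_pos]) (simp add: nn_integral_eq_integral)
  also have "ennreal (bound1 * u powr (- H)) * (ennreal (b i n) * ennreal ?q) = ennreal (bound1 * u powr (- H) * (b i n * ?q))"
    using bound1_nonneg q0 b_pos[of i n] by (simp add: ennreal_mult)
  finally have le: "(\<integral>\<^sup>+ \<omega>. ennreal (?S \<omega>) \<partial>M) \<le> ennreal (bound1 * u powr (- H) * (b i n * ?q))" .
  show int: "integrable M ?S"
    using le by (intro integrableI_bounded) (auto intro: le_less_trans)
  show "(LINT \<omega>|M. ?S \<omega>) \<le> bound1 * u powr (- H) * (b i n * ?q)"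
    using le nonneg nn_integral_eq_integral[OF int] by simp
qed

text \<open>The factor \<open>card I\<close> comes from the Cauchy-Schwarz inequality for the sum
  over the pieces. Apart from it the growth is linear in the scales, hence o(n).\<close>

definition moment_const :: "nat \<Rightarrow> real" where
  "moment_const n = real (card I) * bound1 * (\<Sum>i\<in>I. b i n * (LINT y|lborel. (f i y)\<^sup>2))"

lemma moment_const_nonneg: "0 \<le> moment_const n"
  unfolding moment_const_def using bound1_nonneg b_pos
  by (intro mult_nonneg_nonneg sum_nonneg integral_nonneg_AE) (auto intro: less_imp_le)

lemma moment_const_small: "(\<lambda>n. moment_const n / real n) \<longlonglongrightarrow> 0"
proof -
  have "(\<lambda>n. real (card I) * bound1 * (\<Sum>i\<in>I. b i n / real n * (LINT y|lborel. (f i y)\<^sup>2))) \<longlonglongrightarrow>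
      real (card I) * bound1 * (\<Sum>i\<in>I. 0 * (LINT y|lborel. (f i y)\<^sup>2))"
    by (intro tendsto_intros b_small)
  then show ?thesis by (simp add: moment_const_def sum_divide_distrib[symmetric])
qed

lemma D_second_moment:
  assumes n: "0 < n" and s: "s \<in> {0<..<T}"
  shows "integrable M (\<lambda>\<omega>. (D n s \<omega>)\<^sup>2)" and "(LINT \<omega>|M. (D n s \<omega>)\<^sup>2) \<le> moment_const n * s powr (- H)"
proof -
  let ?S = "\<lambda>i \<omega>. (scaled (f i) (b i n) x (X (\<sigma> i n s) \<omega>))\<^sup>2"
  have \<sigma>: "0 < \<sigma> i n s" "s \<le> \<sigma> i n s" for i using \<sigma>_close[OF n, of s i] s by auto
  have le: "(D n s \<omega>)\<^sup>2 \<le> real (card I) * (\<Sum>i\<in>I. ?S i \<omega>)" for \<omega>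
  proof -
    have "(D n s \<omega>)\<^sup>2 \<le> (\<Sum>i\<in>I. (w i n s * scaled (f i) (b i n) x (X (\<sigma> i n s) \<omega>))\<^sup>2) * card I"
      unfolding D_def by (rule sum_squared_le_sum_of_squares)
    also have "\<dots> \<le> (\<Sum>i\<in>I. ?S i \<omega>) * card I"
    proof (intro mult_right_mono sum_mono)
      fix i
      have "(w i n s)\<^sup>2 \<le> 1" using w_bd[of i n s] by (simp add: abs_square_le_1)
      then show "(w i n s * scaled (f i) (b i n) x (X (\<sigma> i n s) \<omega>))\<^sup>2 \<le> ?S i \<omega>"
        by (simp add: power_mult_distrib mult_left_le_one_le)
    qed auto
    finally show ?thesis by (simp add: mult.commute)
  qed
  have intS: "integrable M (\<lambda>\<omega>. real (card I) * (\<Sum>i\<in>I. ?S i \<omega>))"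
    using scaled_second_moment(1)[OF \<sigma>(1)] by auto
  show int: "integrable M (\<lambda>\<omega>. (D n s \<omega>)\<^sup>2)"
    by (rule Bochner_Integration.integrable_bound[OF intS])
      (use le in \<open>auto intro!: AE_I2 order_trans[OF le abs_ge_self]\<close>)
  have "(LINT \<omega>|M. (D n s \<omega>)\<^sup>2) \<le> (LINT \<omega>|M. real (card I) * (\<Sum>i\<in>I. ?S i \<omega>))"
    by (intro integral_mono int intS le)
  also have "\<dots> = real (card I) * (\<Sum>i\<in>I. LINT \<omega>|M. ?S i \<omega>)"
    using scaled_second_moment(1)[OF \<sigma>(1)] by simp
  also have "\<dots> \<le> real (card I) * (\<Sum>i\<in>I. bound1 * s powr (- H) * (b i n * (LINT y|lborel. (f i y)\<^sup>2)))"
  proof (intro mult_left_mono sum_mono)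
    fix i
    have "\<sigma> i n s powr (- H) \<le> s powr (- H)" using \<sigma>[of i] s H_pos by (intro powr_mono2') auto
    then have "bound1 * \<sigma> i n s powr (- H) * (b i n * (LINT y|lborel. (f i y)\<^sup>2)) \<le> bound1 * s powr (- H) * (b i n * (LINT y|lborel. (f i y)\<^sup>2))"
      using bound1_nonneg b_pos[of i n]
      by (intro mult_right_mono mult_left_mono mult_nonneg_nonneg integral_nonneg_AE) auto
    then show "(LINT \<omega>|M. ?S i \<omega>) \<le> bound1 * s powr (- H) * (b i n * (LINT y|lborel. (f i y)\<^sup>2))"
      using scaled_second_moment(2)[OF \<sigma>(1)[of i], of i n] by linarith
  qed auto
  also have "\<dots> = moment_const n * s powr (- H)"
    by (simp add: moment_const_def sum_distrib_left sum_distrib_right mult_ac)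
  finally show "(LINT \<omega>|M. (D n s \<omega>)\<^sup>2) \<le> moment_const n * s powr (- H)" .
qed

lemma D_square_integrable: "0 < n \<Longrightarrow> integrable M (\<lambda>\<omega>. (D n s \<omega>)\<^sup>2)"
  using D_second_moment(1)[of n s] by (cases "s \<in> {0<..<T}") (auto simp: D_out)

lemma D_mult_integrable: "0 < n \<Longrightarrow> integrable M (\<lambda>\<omega>. D n s \<omega> * D n r \<omega>)"
  by (intro integrable_mult_of_squares D_square_integrable) auto

text \<open>The singularity in time of the density at one time, cut off so as to be integrable over
  the line. It vanishes at negative arguments, so \<open>sing (r - s)\<close> also encodes the order
  of the times.\<close>

definition sing :: "real \<Rightarrow> real" where
  "sing v = indicator {0<..<T} v * v powr (- H)"

lemma sing_measurable [measurable]: "sing \<in> borel_measurable borel"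
  unfolding sing_def by measurable

lemma sing_nonneg: "0 \<le> sing v" by (simp add: sing_def)

lemma sing_integral: "has_bochner_integral lborel sing (T powr (1 - H) / (1 - H))"
  unfolding sing_def using H_pos H_less T by (rule has_bochner_integral_singular_powr)

text \<open>No density of the pair can be used here: close to the diagonal the discretized times of
  different pieces may coincide or change their order. Splitting the product into squares leaves
  moments at single times.\<close>

lemma D_near_bound:
  assumes n: "0 < n"
  shows "(LINT \<omega>|M. \<bar>D n s \<omega> * D n r \<omega>\<bar>) \<le> moment_const n * (sing s * indicator {0<..<T} r + sing r * indicator {0<..<T} s)"
proof (cases "s \<in> {0<..<T} \<and> r \<in> {0<..<T}")
  case True
  have "(LINT \<omega>|M. \<bar>D n s \<omega> * D n r \<omega>\<bar>) \<le> (LINT \<omega>|M. (D n s \<omega>)\<^sup>2 + (D n r \<omega>)\<^sup>2)"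
    using n by (intro integral_mono integrable_abs D_mult_integrable Bochner_Integration.integrable_add D_square_integrable abs_mult_le_squares)
  also have "\<dots> = (LINT \<omega>|M. (D n s \<omega>)\<^sup>2) + (LINT \<omega>|M. (D n r \<omega>)\<^sup>2)"
    using n by (intro Bochner_Integration.integral_add D_square_integrable)
  also have "\<dots> \<le> moment_const n * s powr (- H) + moment_const n * r powr (- H)"
    using D_second_moment(2)[OF n] True by (intro add_mono) auto
  finally show ?thesis using True by (simp add: sing_def distrib_left)
next
  case False
  then have "(\<lambda>\<omega>. \<bar>D n s \<omega> * D n r \<omega>\<bar>) = (\<lambda>\<omega>. 0)" by (auto simp: D_out)
  then show ?thesis using moment_const_nonneg sing_nonneg
    by (simp only: integral_zero) (auto intro!: mult_nonneg_nonneg add_nonneg_nonneg)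
qed

text \<open>The square of the sum arises from the double sum over the pieces. The factor 2 pays for
  halving the gap r - s, since 2^H \<le> 2.\<close>

definition far_const :: real where
  "far_const = 2 * bound2 * (\<Sum>i\<in>I. LINT y|lborel. \<bar>f i y\<bar>)\<^sup>2"

lemma far_const_nonneg: "0 \<le> far_const"
  using bound2_nonneg by (simp add: far_const_def)

lemma scaled_pair_bound:
  assumes "0 < s" "s < r"
  shows "(LINT \<omega>|M. \<bar>scaled (f i) (b i n) x (X s \<omega>) * scaled (f j) (b j n) x (X r \<omega>)\<bar>)
    \<le> bound2 * (s powr (- H) * (r - s) powr (- H)) * ((LINT y|lborel. \<bar>f i y\<bar>) * (LINT y|lborel. \<bar>f j y\<bar>))"
proof -
  let ?F = "\<lambda>i u \<omega>. scaled (f i) (b i n) x (X u \<omega>)"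
  have N: "0 \<le> (LINT y|lborel. \<bar>f i y\<bar>)" for i by (intro integral_nonneg_AE) auto
  have int: "integrable M (\<lambda>\<omega>. \<bar>?F i s \<omega> * ?F j r \<omega>\<bar>)"
    using assms by (intro integrable_abs integrable_mult_of_squares scaled_second_moment) auto
  have "ennreal (LINT \<omega>|M. \<bar>?F i s \<omega> * ?F j r \<omega>\<bar>) = (\<integral>\<^sup>+ \<omega>. ennreal \<bar>?F i s \<omega>\<bar> * ennreal \<bar>?F j r \<omega>\<bar> \<partial>M)"
    using int by (subst nn_integral_eq_integral[symmetric]) (auto simp: abs_mult ennreal_mult)
  also have "\<dots> \<le> ennreal (bound2 * (s powr (- H) * (r - s) powr (- H))) *
     ((\<integral>\<^sup>+ y. ennreal \<bar>scaled (f i) (b i n) x y\<bar> \<partial>lborel) * (\<integral>\<^sup>+ y. ennreal \<bar>scaled (f j) (b j n) x y\<bar> \<partial>lborel))"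
    by (rule nn_integral_pair_le[OF assms]) measurable
  also have "\<dots> = ennreal (bound2 * (s powr (- H) * (r - s) powr (- H))) *
     (ennreal (LINT y|lborel. \<bar>f i y\<bar>) * ennreal (LINT y|lborel. \<bar>f j y\<bar>))"
    using f_int by (simp add: nn_integral_scaled(1)[OF f_meas b_pos] nn_integral_eq_integral)
  also have "\<dots> = ennreal (bound2 * (s powr (- H) * (r - s) powr (- H)) * ((LINT y|lborel. \<bar>f i y\<bar>) * (LINT y|lborel. \<bar>f j y\<bar>)))"
    using N bound2_nonneg by (simp add: ennreal_mult)
  finally show ?thesis using N bound2_nonneg by simp
qed

text \<open>A discretized time exceeds the true one by at most 1 / n. If the gap is larger than 2 /
  n, the discretized times of any two pieces keep their order and at least half of the distance, so
  the joint density bound applies with r - s up to a constant.\<close>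

lemma D_far_bound:
  assumes n: "0 < n" and s: "0 < s" "s < r" "r < T" and far: "2 / real n < r - s"
  shows "(LINT \<omega>|M. \<bar>D n s \<omega> * D n r \<omega>\<bar>) \<le> far_const * (sing s * sing (r - s))"
proof -
  let ?F = "\<lambda>i u \<omega>. scaled (f i) (b i n) x (X (\<sigma> i n u) \<omega>)" and ?N = "\<lambda>i. LINT y|lborel. \<bar>f i y\<bar>"
  have s': "s \<le> \<sigma> i n s" "\<sigma> i n s \<le> s + 1 / real n" for i using \<sigma>_close[OF n s(1)] by auto
  have r': "r \<le> \<sigma> i n r" for i using \<sigma>_close[OF n, of r] s by auto
  have gap: "(r - s) / 2 \<le> \<sigma> j n r - \<sigma> i n s" for i j
    using s'(2)[of i] r'[of j] far by (simp add: field_simps)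
  have pos: "0 < \<sigma> i n s" "\<sigma> i n s < \<sigma> j n r" for i j
    using s'(1)[of i] gap[of j i] s by auto
  have int: "integrable M (\<lambda>\<omega>. \<bar>?F i s \<omega> * ?F j r \<omega>\<bar>)" for i j
    using pos(1)[of i] order.strict_trans[OF pos]
    by (intro integrable_abs integrable_mult_of_squares scaled_second_moment) auto
  have "(LINT \<omega>|M. \<bar>D n s \<omega> * D n r \<omega>\<bar>) \<le> (LINT \<omega>|M. (\<Sum>i\<in>I. \<Sum>j\<in>I. \<bar>?F i s \<omega> * ?F j r \<omega>\<bar>))"
  proof (rule integral_mono)
    show "integrable M (\<lambda>\<omega>. \<bar>D n s \<omega> * D n r \<omega>\<bar>)" using D_mult_integrable[OF n] by simp
    show "integrable M (\<lambda>\<omega>. \<Sum>i\<in>I. \<Sum>j\<in>I. \<bar>?F i s \<omega> * ?F j r \<omega>\<bar>)"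
      by (intro Bochner_Integration.integrable_sum int)
    fix \<omega>
    have "\<bar>D n u \<omega>\<bar> \<le> (\<Sum>i\<in>I. \<bar>?F i u \<omega>\<bar>)" for u
      unfolding D_def by (intro order_trans[OF sum_abs] sum_mono) (simp add: abs_mult mult_left_le_one_le w_bd)
    then have "\<bar>D n s \<omega> * D n r \<omega>\<bar> \<le> (\<Sum>i\<in>I. \<bar>?F i s \<omega>\<bar>) * (\<Sum>j\<in>I. \<bar>?F j r \<omega>\<bar>)"
      unfolding abs_mult by (intro mult_mono) (auto intro: sum_nonneg)
    then show "\<bar>D n s \<omega> * D n r \<omega>\<bar> \<le> (\<Sum>i\<in>I. \<Sum>j\<in>I. \<bar>?F i s \<omega> * ?F j r \<omega>\<bar>)"
      by (simp add: sum_product abs_mult)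
  qed
  also have "\<dots> = (\<Sum>i\<in>I. \<Sum>j\<in>I. LINT \<omega>|M. \<bar>?F i s \<omega> * ?F j r \<omega>\<bar>)"
    using int by (simp add: Bochner_Integration.integral_sum)
  also have "\<dots> \<le> (\<Sum>i\<in>I. \<Sum>j\<in>I. (2 * bound2 * (s powr (- H) * (r - s) powr (- H))) * (?N i * ?N j))"
  proof (intro sum_mono)
    fix i j
    have "\<sigma> i n s powr (- H) \<le> s powr (- H)" using s'(1)[of i] s H_pos by (intro powr_mono2') auto
    moreover have "(\<sigma> j n r - \<sigma> i n s) powr (- H) \<le> 2 * (r - s) powr (- H)"
    proof -
      have "(\<sigma> j n r - \<sigma> i n s) powr (- H) \<le> ((r - s) / 2) powr (- H)"
        using gap[of j i] s H_pos by (intro powr_mono2') auto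
      also have "\<dots> = 2 powr H * (r - s) powr (- H)"
        by (simp only: powr_divide powr_minus_divide) simp
      also have "\<dots> \<le> 2 powr 1 * (r - s) powr (- H)"
        using H_less by (intro mult_right_mono powr_mono) auto
      finally show ?thesis by simp
    qed
    ultimately have "\<sigma> i n s powr (- H) * (\<sigma> j n r - \<sigma> i n s) powr (- H) \<le> s powr (- H) * (2 * (r - s) powr (- H))"
      by (intro mult_mono) auto
    then have "bound2 * (\<sigma> i n s powr (- H) * (\<sigma> j n r - \<sigma> i n s) powr (- H)) * (?N i * ?N j)
        \<le> bound2 * (s powr (- H) * (2 * (r - s) powr (- H))) * (?N i * ?N j)"
      using bound2_nonneg by (intro mult_right_mono mult_left_mono mult_nonneg_nonneg integral_nonneg_AE) auto
    then show "(LINT \<omega>|M. \<bar>?F i s \<omega> * ?F j r \<omega>\<bar>) \<le> (2 * bound2 * (s powr (- H) * (r - s) powr (- H))) * (?N i * ?N j)"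
      using scaled_pair_bound[OF pos(1)[of i] pos(2)[of i j], of i n j] by (simp add: mult_ac)
  qed
  also have "\<dots> = far_const * (s powr (- H) * (r - s) powr (- H))"
    by (simp add: far_const_def power2_eq_square sum_product sum_distrib_left mult_ac)
  also have "\<dots> = far_const * (sing s * sing (r - s))" using s by (simp add: sing_def)
  finally show ?thesis .
qed

lemma D_off_diagonal_tendsto:
  assumes s: "0 < s" "s < r" "r < T"
  shows "(\<lambda>n. LINT \<omega>|M. D n s \<omega> * D n r \<omega>) \<longlonglongrightarrow> 0"
proof -
  let ?F = "\<lambda>i n u \<omega>. scaled (f i) (b i n) x (X (\<sigma> i n u) \<omega>)"
  let ?q = "fourier_inv (char2 M (X s) (X r)) (x, x)"
  have \<sigma>_lim: "(\<lambda>n. \<sigma> i n u) \<longlonglongrightarrow> u" if "0 < u" for i u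
  proof (rule tendsto_sandwich)
    show "\<forall>\<^sub>F n in sequentially. u \<le> \<sigma> i n u" "\<forall>\<^sub>F n in sequentially. \<sigma> i n u \<le> u + 1 / real n"
      using \<sigma>_close[OF _ that] by (auto intro!: eventually_mono[OF eventually_gt_at_top[of 0]])
    show "(\<lambda>n. u + 1 / real n) \<longlonglongrightarrow> u"
      using tendsto_add[OF tendsto_const lim_1_over_n, of u] by simp
  qed auto
  have "(\<lambda>n. \<Sum>i\<in>I. \<Sum>j\<in>I. w i n s * w j n r * (LINT \<omega>|M. ?F i n s \<omega> * ?F j n r \<omega>)) \<longlonglongrightarrow>
     (\<Sum>i\<in>I. \<Sum>j\<in>I. 1 * 1 * ((LINT y|lborel. f i y) * (LINT y|lborel. f j y) * ?q))"
    using s by (intro tendsto_sum tendsto_mult w_lim expectation_scaled_tendsto \<sigma>_lim f_meas f_int b_pos b_top) auto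
  \<comment> \<open>The density value \<open>?q\<close> is common to all pairs of pieces, so the
    limit contains the square of the total mass as a factor and vanishes by
    \<open>balanced\<close>.\<close>
  also have "(\<Sum>i\<in>I. \<Sum>j\<in>I. 1 * 1 * ((LINT y|lborel. f i y) * (LINT y|lborel. f j y) * ?q))
     = (\<Sum>i\<in>I. LINT y|lborel. f i y) * (\<Sum>j\<in>I. LINT y|lborel. f j y) * ?q"
    by (simp only: sum_product) (simp add: sum_distrib_right)
  also have "\<dots> = 0" by (simp add: balanced)
  finally show ?thesis
  proof (rule Lim_transform_eventually)
    show "\<forall>\<^sub>F n in sequentially. (\<Sum>i\<in>I. \<Sum>j\<in>I. w i n s * w j n r * (LINT \<omega>|M. ?F i n s \<omega> * ?F j n r \<omega>))
       = (LINT \<omega>|M. D n s \<omega> * D n r \<omega>)"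
      using eventually_gt_at_top[of 0]
    proof eventually_elim
      case (elim n)
      have int: "integrable M (\<lambda>\<omega>. ?F i n s \<omega> * ?F j n r \<omega>)" for i j
        using \<sigma>_close[OF elim, of s i] \<sigma>_close[OF elim, of r j] s
        by (intro integrable_mult_of_squares scaled_second_moment) auto
      have "(LINT \<omega>|M. D n s \<omega> * D n r \<omega>) = (LINT \<omega>|M. (\<Sum>i\<in>I. \<Sum>j\<in>I. w i n s * w j n r * (?F i n s \<omega> * ?F j n r \<omega>)))"
        unfolding D_def sum_product
        by (intro Bochner_Integration.integral_cong refl sum.cong) (simp add: mult_ac)
      also have "\<dots> = (\<Sum>i\<in>I. \<Sum>j\<in>I. w i n s * w j n r * (LINT \<omega>|M. ?F i n s \<omega> * ?F j n r \<omega>))"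
        using int by (simp add: Bochner_Integration.integral_sum)
      finally show ?case by simp
    qed
  qed
qed

section \<open>Covariances away from the diagonal and close to it\<close>

definition cov :: "nat \<Rightarrow> real \<times> real \<Rightarrow> real" where
  "cov n v = (LINT \<omega>|M. D n (fst v) \<omega> * D n (snd v) \<omega>)"

lemma cov_measurable [measurable]: "cov n \<in> borel_measurable lborel2"
  unfolding cov_def by measurable

lemma abs_cov_le: "\<bar>cov n v\<bar> \<le> (LINT \<omega>|M. \<bar>D n (fst v) \<omega> * D n (snd v) \<omega>\<bar>)"
  unfolding cov_def by (rule integral_abs_bound)

lemma cov_swap: "cov n (r, s) = cov n (s, r)"
  by (simp add: cov_def mult.commute)

text \<open>Each summand lives on its own side of the diagonal. The inner integral of a shifted
  \<open>sing\<close> is the same for all shifts, so Tonelli gives the square of the integral of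
  \<open>sing\<close> for either summand.\<close>

lemma integrable_sing_pair: "integrable lborel2 (\<lambda>v. sing (fst v) * sing (snd v - fst v) + sing (snd v) * sing (fst v - snd v))"
proof -
  define L where "L = T powr (1 - H) / (1 - H)"
  have L: "0 \<le> L" using T H_less by (simp add: L_def)
  have nn: "(\<integral>\<^sup>+ v. ennreal (sing v) \<partial>lborel) = ennreal L"
    using sing_integral sing_nonneg by (subst nn_integral_eq_integral) (auto simp: has_bochner_integral_iff L_def)
  have shift: "(\<integral>\<^sup>+ v. ennreal (sing (v - u)) \<partial>lborel) = ennreal L" for u
    using nn nn_integral_real_affine[of "\<lambda>v. ennreal (sing (v - u))" 1 u] by simp
  have "(\<integral>\<^sup>+ v. ennreal (sing (fst v) * sing (snd v - fst v)) \<partial>lborel2) = (\<integral>\<^sup>+ s. \<integral>\<^sup>+ r. ennreal (sing s * sing (r - s)) \<partial>lborel \<partial>lborel)"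
    by (subst lborel.nn_integral_fst[symmetric]) auto
  also have "\<dots> = ennreal L * ennreal L"
    by (simp add: ennreal_mult sing_nonneg nn_integral_cmult nn_integral_multc shift nn)
  finally have 1: "integrable lborel2 (\<lambda>v. sing (fst v) * sing (snd v - fst v))"
    by (intro integrableI_nonneg) (auto simp: sing_nonneg ennreal_mult_less_top intro!: AE_I2)
  have "(\<integral>\<^sup>+ v. ennreal (sing (snd v) * sing (fst v - snd v)) \<partial>lborel2) = (\<integral>\<^sup>+ r. \<integral>\<^sup>+ s. ennreal (sing r * sing (s - r)) \<partial>lborel \<partial>lborel)"
    by (subst lborel_pair.nn_integral_snd[symmetric]) auto
  also have "\<dots> = ennreal L * ennreal L"
    by (simp add: ennreal_mult sing_nonneg nn_integral_cmult nn_integral_multc shift nn)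
  finally have 2: "integrable lborel2 (\<lambda>v. sing (snd v) * sing (fst v - snd v))"
    by (intro integrableI_nonneg) (auto simp: sing_nonneg ennreal_mult_less_top intro!: AE_I2)
  show ?thesis by (rule Bochner_Integration.integrable_add[OF 1 2])
qed

lemma far_cov_tendsto:
  "(\<lambda>n. LINT v|lborel2. indicator {v. 2 / real n < \<bar>fst v - snd v\<bar>} v * cov n v) \<longlonglongrightarrow> 0"
proof -
  let ?h = "\<lambda>n v. indicator {v. 2 / real n < \<bar>fst v - snd v\<bar>} v * cov n v"
  \<comment> \<open>The index 0 is skipped because domination is required for every n, while
    \<open>2 / real 0 = 0\<close> in HOL and the bound away from the diagonal needs n > 0.\<close>
  have "(\<lambda>n. LINT v|lborel2. ?h (Suc n) v) \<longlonglongrightarrow> (LINT v|lborel2. 0)"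
  proof (rule integral_dominated_convergence)
    show "integrable lborel2 (\<lambda>v. far_const * (sing (fst v) * sing (snd v - fst v) + sing (snd v) * sing (fst v - snd v)))"
      using integrable_sing_pair by simp
    have zero: "cov n v = 0" if "fst v \<notin> {0<..<T} \<or> snd v \<notin> {0<..<T}" for n v
      using that unfolding cov_def by (auto simp: D_out simp del: greaterThanLessThan_iff)
    show "AE v in lborel2. (\<lambda>n. ?h (Suc n) v) \<longlonglongrightarrow> 0"
    proof (rule AE_I2)
      fix v :: "real \<times> real"
      obtain s r where v: "v = (s, r)" by (cases v)
      have cov_lim: "(\<lambda>n. cov n v) \<longlonglongrightarrow> 0" if "s \<noteq> r"
      proof (cases "s \<in> {0<..<T} \<and> r \<in> {0<..<T}")
        case True
        with that consider "0 < s" "s < r" "r < T" | "0 < r" "r < s" "s < T" by force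
        then show ?thesis
        proof cases
          case 1
          then show ?thesis using D_off_diagonal_tendsto by (simp add: v cov_def)
        next
          case 2
          then show ?thesis using D_off_diagonal_tendsto[of r s] by (simp add: v cov_def mult.commute)
        qed
      next
        case False
        then show ?thesis using zero[of v] by (auto simp: v)
      qed
      have "(\<lambda>n. ?h n v) \<longlonglongrightarrow> 0"
      proof (cases "s = r")
        case False
        show ?thesis
          by (rule Lim_null_comparison[OF _ tendsto_rabs_zero[OF cov_lim[OF False]]])
            (auto simp: indicator_def)
      qed (simp add: v)
      then show "(\<lambda>n. ?h (Suc n) v) \<longlonglongrightarrow> 0" by (rule LIMSEQ_Suc)
    qed
    show "AE v in lborel2. norm (?h (Suc n) v) \<le> far_const * (sing (fst v) * sing (snd v - fst v) + sing (snd v) * sing (fst v - snd v))" for n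
    proof (rule AE_I2)
      fix v :: "real \<times> real"
      obtain s r where v: "v = (s, r)" by (cases v)
      let ?R = "far_const * (sing s * sing (r - s) + sing r * sing (s - r))"
      have R: "0 \<le> far_const * (sing s * sing (r - s))" "0 \<le> far_const * (sing r * sing (s - r))"
        using far_const_nonneg sing_nonneg by (auto intro!: mult_nonneg_nonneg)
      have "\<bar>cov (Suc n) (s, r)\<bar> \<le> ?R" if far: "2 / real (Suc n) < \<bar>s - r\<bar>"
      proof (cases "s \<in> {0<..<T} \<and> r \<in> {0<..<T}")
        case True
        show ?thesis
        proof (cases "s < r")
          case less: True
          have "\<bar>cov (Suc n) (s, r)\<bar> \<le> far_const * (sing s * sing (r - s))"
            using abs_cov_le[of "Suc n" "(s, r)"] D_far_bound[of "Suc n" s r] True less far by simp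
          then show ?thesis using R unfolding distrib_left by linarith
        next
          case False
          have "2 / real (Suc n) > 0" by simp
          then have less: "r < s" "2 / real (Suc n) < s - r" using far False by linarith+
          have "\<bar>cov (Suc n) (s, r)\<bar> \<le> far_const * (sing r * sing (s - r))"
            using abs_cov_le[of "Suc n" "(r, s)"] D_far_bound[of "Suc n" r s] True less
            by (simp add: cov_swap[of _ r s])
          then show ?thesis using R unfolding distrib_left by linarith
        qed
      next
        case False
        then show ?thesis using zero[of "(s, r)"] R unfolding distrib_left by auto
      qed
      then show "norm (?h (Suc n) v) \<le> far_const * (sing (fst v) * sing (snd v - fst v) + sing (snd v) * sing (fst v - snd v))"
        using R unfolding v by (auto simp: indicator_def distrib_left)
    qed
  qed measurable
  then have "(\<lambda>n. LINT v|lborel2. ?h (Suc n) v) \<longlonglongrightarrow> 0" by simp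
  then show ?thesis by (rule LIMSEQ_imp_Suc)
qed

text \<open>Every section of the strip has length 4 / n. Integrating over the coordinate without the
  singularity first gives this factor, and the two coordinates contribute equally.\<close>

lemma near_integral_le:
  assumes n: "0 < n"
  shows "(\<integral>\<^sup>+ v. ennreal (indicator {v. \<bar>fst v - snd v\<bar> \<le> 2 / real n} v * (sing (fst v) + sing (snd v))) \<partial>lborel2)
     \<le> ennreal (8 / real n * (T powr (1 - H) / (1 - H)))"
proof -
  define L where "L = T powr (1 - H) / (1 - H)"
  have L: "0 \<le> L" using T H_less by (simp add: L_def)
  have nn: "(\<integral>\<^sup>+ v. ennreal (sing v) \<partial>lborel) = ennreal L"
    using sing_integral sing_nonneg by (subst nn_integral_eq_integral) (auto simp: has_bochner_integral_iff L_def)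
  let ?A = "{v::real \<times> real. \<bar>fst v - snd v\<bar> \<le> 2 / real n}"
  have len: "(\<integral>\<^sup>+ r. indicator {s - 2 / real n..s + 2 / real n} r \<partial>lborel) = ennreal (4 / real n)" for s
    by (simp add: algebra_simps)
  have inner: "(\<integral>\<^sup>+ r. ennreal c * indicator {s - 2 / real n..s + 2 / real n} r \<partial>lborel) = ennreal c * ennreal (4 / real n)" for c s
    by (subst nn_integral_cmult) (simp, simp only: len)
  have "(\<integral>\<^sup>+ v. ennreal (indicator ?A v * sing (fst v)) \<partial>lborel2)
     = (\<integral>\<^sup>+ s. \<integral>\<^sup>+ r. ennreal (sing s) * indicator {s - 2 / real n..s + 2 / real n} r \<partial>lborel \<partial>lborel)"
    by (subst lborel.nn_integral_fst[symmetric]) (auto simp: indicator_def abs_le_iff intro!: nn_integral_cong)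
  also have "\<dots> = ennreal L * ennreal (4 / real n)"
    by (simp only: inner) (simp add: nn_integral_multc nn)
  finally have 1: "(\<integral>\<^sup>+ v. ennreal (indicator ?A v * sing (fst v)) \<partial>lborel2) = ennreal (4 / real n * L)"
    using L by (simp add: ennreal_mult[symmetric] mult.commute)
  have "(\<integral>\<^sup>+ v. ennreal (indicator ?A v * sing (snd v)) \<partial>lborel2)
     = (\<integral>\<^sup>+ r. \<integral>\<^sup>+ s. ennreal (sing r) * indicator {r - 2 / real n..r + 2 / real n} s \<partial>lborel \<partial>lborel)"
    by (subst lborel_pair.nn_integral_snd[symmetric]) (auto simp: indicator_def abs_le_iff intro!: nn_integral_cong)
  also have "\<dots> = ennreal L * ennreal (4 / real n)"
    by (simp only: inner) (simp add: nn_integral_multc nn)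
  finally have 2: "(\<integral>\<^sup>+ v. ennreal (indicator ?A v * sing (snd v)) \<partial>lborel2) = ennreal (4 / real n * L)"
    using L by (simp add: ennreal_mult[symmetric] mult.commute)
  have "(\<integral>\<^sup>+ v. ennreal (indicator ?A v * (sing (fst v) + sing (snd v))) \<partial>lborel2)
     = (\<integral>\<^sup>+ v. ennreal (indicator ?A v * sing (fst v)) + ennreal (indicator ?A v * sing (snd v)) \<partial>lborel2)"
    by (intro nn_integral_cong) (simp add: distrib_left ennreal_plus[symmetric] sing_nonneg del: ennreal_plus)
  also have "\<dots> = ennreal (4 / real n * L) + ennreal (4 / real n * L)"
    by (subst nn_integral_add) (auto simp: 1 2)
  also have "\<dots> = ennreal (8 / real n * L)"
    using L by (simp add: ennreal_plus[symmetric] add_divide_distrib[symmetric] del: ennreal_plus)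
  finally show ?thesis by (simp add: L_def)
qed

lemma near_cov_tendsto:
  "(\<lambda>n. LINT v|lborel2. indicator {v. \<bar>fst v - snd v\<bar> \<le> 2 / real n} v * cov n v) \<longlonglongrightarrow> 0"
proof -
  let ?A = "\<lambda>n. {v::real \<times> real. \<bar>fst v - snd v\<bar> \<le> 2 / real n}"
  define L where "L = T powr (1 - H) / (1 - H)"
  have L: "0 \<le> L" using T H_less by (simp add: L_def)
  have le: "\<bar>\<integral>v. indicator (?A n) v * cov n v \<partial>lborel2\<bar> \<le> moment_const n / real n * (8 * L)" if n: "0 < n" for n
  proof -
    have pt: "ennreal \<bar>indicator (?A n) v * cov n v\<bar> \<le> ennreal (moment_const n) * ennreal (indicator (?A n) v * (sing (fst v) + sing (snd v)))" for v
    proof -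
      have "\<bar>cov n v\<bar> \<le> moment_const n * (sing (fst v) * indicator {0<..<T} (snd v) + sing (snd v) * indicator {0<..<T} (fst v))"
        using abs_cov_le D_near_bound[OF n] order_trans by blast
      also have "\<dots> \<le> moment_const n * (sing (fst v) * 1 + sing (snd v) * 1)"
        using sing_nonneg moment_const_nonneg by (intro mult_left_mono add_mono) (auto simp: indicator_def)
      finally have "\<bar>cov n v\<bar> \<le> moment_const n * (sing (fst v) + sing (snd v))" by simp
      then have "\<bar>indicator (?A n) v * cov n v\<bar> \<le> moment_const n * (indicator (?A n) v * (sing (fst v) + sing (snd v)))"
        by (auto simp: indicator_def)
      then show ?thesis
        using moment_const_nonneg sing_nonneg by (subst ennreal_mult[symmetric]) (auto intro!: ennreal_leI)
    qed
    have [measurable]: "?A n \<in> sets lborel2"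
    proof -
      have "Measurable.pred lborel2 (\<lambda>v. \<bar>fst v - snd v\<bar> \<le> 2 / real n)" by measurable
      then show ?thesis by (simp add: pred_def space_pair_measure)
    qed
    have "(\<integral>\<^sup>+ v. ennreal \<bar>indicator (?A n) v * cov n v\<bar> \<partial>lborel2)
        \<le> (\<integral>\<^sup>+ v. ennreal (moment_const n) * ennreal (indicator (?A n) v * (sing (fst v) + sing (snd v))) \<partial>lborel2)"
      by (intro nn_integral_mono pt)
    also have "\<dots> = ennreal (moment_const n) * (\<integral>\<^sup>+ v. ennreal (indicator (?A n) v * (sing (fst v) + sing (snd v))) \<partial>lborel2)"
      by (intro nn_integral_cmult) measurable
    also have "\<dots> \<le> ennreal (moment_const n) * ennreal (8 / real n * L)"
      using near_integral_le[OF n] by (intro mult_left_mono) (auto simp: L_def)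
    also have "\<dots> = ennreal (moment_const n / real n * (8 * L))"
      using moment_const_nonneg L by (simp add: ennreal_mult[symmetric] mult_ac)
    finally have nn: "(\<integral>\<^sup>+ v. ennreal \<bar>indicator (?A n) v * cov n v\<bar> \<partial>lborel2) \<le> ennreal (moment_const n / real n * (8 * L))" .
    have "ennreal \<bar>\<integral>v. indicator (?A n) v * cov n v \<partial>lborel2\<bar> \<le> (\<integral>\<^sup>+ v. ennreal \<bar>indicator (?A n) v * cov n v\<bar> \<partial>lborel2)"
      using integral_norm_bound_ennreal[of lborel2 "\<lambda>v. indicator (?A n) v * cov n v"]
      by (cases "integrable lborel2 (\<lambda>v. indicator (?A n) v * cov n v)") (auto simp: not_integrable_integral_eq)
    with nn have "ennreal \<bar>\<integral>v. indicator (?A n) v * cov n v \<partial>lborel2\<bar> \<le> ennreal (moment_const n / real n * (8 * L))"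
      by (rule order_trans[rotated])
    then show ?thesis using moment_const_nonneg L by simp
  qed
  have lim: "(\<lambda>n. moment_const n / real n * (8 * L)) \<longlonglongrightarrow> 0"
    using tendsto_mult_right[OF moment_const_small, of "8 * L"] by simp
  show ?thesis
    by (rule Lim_null_comparison[OF _ lim])
      (use le in \<open>auto intro!: eventually_mono[OF eventually_gt_at_top[of 0]]\<close>)
qed

text \<open>For fixed n no decay in n is required, so the bound from moments at single times serves
  on the whole square.\<close>

lemma cov_dominated:
  assumes n: "0 < n"
  shows "integrable lborel2 (\<lambda>v. LINT \<omega>|M. \<bar>D n (fst v) \<omega> * D n (snd v) \<omega>\<bar>)"
proof (rule Bochner_Integration.integrable_bound)
  have sf: "sigma_finite_measure (lborel :: real measure)" by unfold_locales
  have s: "integrable lborel sing" using sing_integral by (simp add: has_bochner_integral_iff)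
  have i: "integrable lborel (indicator {0<..<T} :: real \<Rightarrow> real)" by (rule integrable_indicator_Ioo)
  have "integrable lborel2 (\<lambda>v. sing (fst v) * indicator {0<..<T} (snd v))"
    using has_bochner_integral_pair_mult[OF sf sf has_bochner_integral_integrable[OF s] has_bochner_integral_integrable[OF i]]
    by (simp add: has_bochner_integral_iff)
  moreover have "integrable lborel2 (\<lambda>v. sing (snd v) * indicator {0<..<T} (fst v))"
    using has_bochner_integral_pair_mult[OF sf sf has_bochner_integral_integrable[OF i] has_bochner_integral_integrable[OF s]]
    by (simp add: has_bochner_integral_iff mult.commute)
  ultimately show "integrable lborel2 (\<lambda>v. moment_const n * (sing (fst v) * indicator {0<..<T} (snd v) + sing (snd v) * indicator {0<..<T} (fst v)))"
    by auto
  show "AE v in lborel2. norm (LINT \<omega>|M. \<bar>D n (fst v) \<omega> * D n (snd v) \<omega>\<bar>)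
     \<le> norm (moment_const n * (sing (fst v) * indicator {0<..<T} (snd v) + sing (snd v) * indicator {0<..<T} (fst v)))"
    using order_trans[OF D_near_bound[OF n] abs_ge_self] by (intro AE_I2) (simp add: abs_of_nonneg[OF integral_nonneg_AE])
qed measurable

lemma cov_integrable:
  assumes n: "0 < n"
  shows "integrable lborel2 (cov n)"
  by (rule Bochner_Integration.integrable_bound[OF cov_dominated[OF n]])
    (auto intro!: AE_I2 order_trans[OF abs_cov_le])

lemma integral_cov_tendsto: "(\<lambda>n. LINT v|lborel2. cov n v) \<longlonglongrightarrow> 0"
proof -
  let ?far = "\<lambda>n. {v::real \<times> real. 2 / real n < \<bar>fst v - snd v\<bar>}"
  let ?near = "\<lambda>n. {v::real \<times> real. \<bar>fst v - snd v\<bar> \<le> 2 / real n}"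
  have "(\<lambda>n. (LINT v|lborel2. indicator (?far n) v * cov n v)
      + (LINT v|lborel2. indicator (?near n) v * cov n v)) \<longlonglongrightarrow> 0"
    using tendsto_add[OF far_cov_tendsto near_cov_tendsto] by simp
  then show ?thesis
  proof (rule Lim_transform_eventually)
    show "\<forall>\<^sub>F n in sequentially. (LINT v|lborel2. indicator (?far n) v * cov n v)
      + (LINT v|lborel2. indicator (?near n) v * cov n v) = (LINT v|lborel2. cov n v)"
      using eventually_gt_at_top[of 0]
    proof eventually_elim
      case (elim n)
      have sets: "?far n \<in> sets lborel2" "?near n \<in> sets lborel2"
      proof -
        have "Measurable.pred lborel2 (\<lambda>v. 2 / real n < \<bar>fst v - snd v\<bar>)" "Measurable.pred lborel2 (\<lambda>v. \<bar>fst v - snd v\<bar> \<le> 2 / real n)"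
          by measurable
        then show "?far n \<in> sets lborel2" "?near n \<in> sets lborel2"
          by (simp_all add: pred_def space_pair_measure)
      qed
      note i = integrable_mult_indicator[OF sets(1) cov_integrable[OF elim]] integrable_mult_indicator[OF sets(2) cov_integrable[OF elim]]
      have "(LINT v|lborel2. indicator (?far n) v * cov n v)
      + (LINT v|lborel2. indicator (?near n) v * cov n v)
       = (LINT v|lborel2. indicator (?far n) v * cov n v + indicator (?near n) v * cov n v)"
        using i by (subst Bochner_Integration.integral_add) auto
      also have "\<dots> = (LINT v|lborel2. cov n v)"
        by (intro Bochner_Integration.integral_cong) (auto simp: indicator_def)
      finally show ?case .
    qed
  qed
qed

text \<open>The squared time integral is a double integral over the plane for almost every path,
  namely for those along which \<open>D n\<close> is integrable; Fubini then exchanges it with the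
  expectation. The first application of Fubini, in one time variable, provides these paths.\<close>

lemma integral_D_square:
  assumes n: "0 < n"
  shows "integrable M (\<lambda>\<omega>. (LINT s|lborel. D n s \<omega>)\<^sup>2)"
    and "(LINT \<omega>|M. (LINT s|lborel. D n s \<omega>)\<^sup>2) = (LINT v|lborel2. cov n v)"
proof -
  interpret L: sigma_finite_measure lborel2
    by (rule sigma_finite_pair_measure) unfold_locales
  interpret P: pair_sigma_finite lborel2 M by unfold_locales
  interpret Q: pair_sigma_finite lborel M by unfold_locales
  have sf: "sigma_finite_measure (lborel :: real measure)" by unfold_locales
  have int: "integrable (lborel2 \<Otimes>\<^sub>M M) (\<lambda>(v, \<omega>). D n (fst v) \<omega> * D n (snd v) \<omega>)"
  proof (rule P.Fubini_integrable)
    show "integrable lborel2 (\<lambda>v. LINT \<omega>|M. norm (case (v, \<omega>) of (v, \<omega>) \<Rightarrow> D n (fst v) \<omega> * D n (snd v) \<omega>))"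
      using cov_dominated[OF n] by simp
    show "AE v in lborel2. integrable M (\<lambda>\<omega>. case (v, \<omega>) of (v, \<omega>) \<Rightarrow> D n (fst v) \<omega> * D n (snd v) \<omega>)"
      using D_mult_integrable[OF n] by simp
  qed measurable
  have D_int: "integrable M (D n s)" for s
    by (rule square_integrable_imp_integrable[OF _ D_square_integrable[OF n]]) measurable
  have int1: "integrable (lborel \<Otimes>\<^sub>M M) (\<lambda>(s, \<omega>). D n s \<omega>)"
  proof (rule Q.Fubini_integrable)
    show "integrable lborel (\<lambda>s. LINT \<omega>|M. norm (case (s, \<omega>) of (s, \<omega>) \<Rightarrow> D n s \<omega>))"
    proof (rule Bochner_Integration.integrable_bound)
      show "integrable lborel (\<lambda>s. indicator {0<..<T} s + moment_const n * sing s)"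
        using sing_integral integrable_indicator_Ioo[of 0 T] by (auto simp: has_bochner_integral_iff)
      have bound: "(LINT \<omega>|M. \<bar>D n s \<omega>\<bar>) \<le> indicator {0<..<T} s + moment_const n * sing s" for s
      proof (cases "s \<in> {0<..<T}")
        case True
        have "\<bar>y\<bar> \<le> 1 + y\<^sup>2" for y :: real using abs_mult_le_squares[of 1 y] by simp
        then have "(LINT \<omega>|M. \<bar>D n s \<omega>\<bar>) \<le> (LINT \<omega>|M. 1 + (D n s \<omega>)\<^sup>2)"
          using D_int D_square_integrable[OF n] by (intro integral_mono) auto
        also have "\<dots> = 1 + (LINT \<omega>|M. (D n s \<omega>)\<^sup>2)"
          using D_square_integrable[OF n] by (simp add: prob_space)
        also have "\<dots> \<le> 1 + moment_const n * s powr (- H)" using D_second_moment(2)[OF n True] by simp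
        finally show ?thesis using True by (simp add: sing_def)
      qed (simp add: D_out sing_def)
      show "AE s in lborel. norm (LINT \<omega>|M. norm (case (s, \<omega>) of (s, \<omega>) \<Rightarrow> D n s \<omega>)) \<le> norm (indicator {0<..<T} s + moment_const n * sing s)"
        using order_trans[OF bound abs_ge_self] by (intro AE_I2) (simp add: abs_of_nonneg[OF integral_nonneg_AE])
    qed measurable
    show "AE s in lborel. integrable M (\<lambda>\<omega>. case (s, \<omega>) of (s, \<omega>) \<Rightarrow> D n s \<omega>)" using D_int by simp
  qed measurable
  have "AE \<omega> in M. integrable lborel (\<lambda>s. D n s \<omega>)" by (rule Q.AE_integrable_snd[OF int1])
  then have AE: "AE \<omega> in M. (LINT v|lborel2. D n (fst v) \<omega> * D n (snd v) \<omega>) = (LINT s|lborel. D n s \<omega>)\<^sup>2"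
  proof eventually_elim
    case (elim \<omega>)
    then show ?case
      using has_bochner_integral_pair_mult[OF sf sf has_bochner_integral_integrable[OF elim] has_bochner_integral_integrable[OF elim]]
      by (simp add: has_bochner_integral_iff power2_eq_square)
  qed
  have "integrable M (\<lambda>\<omega>. LINT v|lborel2. D n (fst v) \<omega> * D n (snd v) \<omega>)"
    by (rule P.integrable_snd[OF int])
  then show "integrable M (\<lambda>\<omega>. (LINT s|lborel. D n s \<omega>)\<^sup>2)"
    by (rule integrable_cong_AE_imp) (use AE in \<open>auto intro: AE_symmetric\<close>)
  have "(LINT \<omega>|M. (LINT s|lborel. D n s \<omega>)\<^sup>2) = (LINT \<omega>|M. LINT v|lborel2. D n (fst v) \<omega> * D n (snd v) \<omega>)"
    by (rule integral_cong_AE) (use AE in \<open>auto intro: AE_symmetric\<close>)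
  also have "\<dots> = (LINT v|lborel2. cov n v)"
    using P.Fubini_integral[OF int] by (simp add: cov_def)
  finally show "(LINT \<omega>|M. (LINT s|lborel. D n s \<omega>)\<^sup>2) = (LINT v|lborel2. cov n v)" .
qed

lemma integral_D_L2_tendsto:
  "(\<lambda>n. LINT \<omega>|M. (LINT s|lborel. D n s \<omega>)\<^sup>2) \<longlonglongrightarrow> 0"
  by (rule Lim_transform_eventually[OF integral_cov_tendsto])
    (use integral_D_square(2) in \<open>auto intro!: eventually_mono[OF eventually_gt_at_top[of 0]]\<close>)

end

section \<open>Riemann sums and local time\<close>

text \<open>On the cell from (k - 1) / n (excluded) to k / n (included) the ceiling returns k, so
  sampling at right endpoints turns the sum from k = 1 into a time integral. Intersecting with
  \<open>{0<..<T}\<close> removes at most the point T and makes the weight vanish outside the open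
  interval, as \<open>balanced_pieces\<close> demands.\<close>

lemma has_bochner_integral_riemann_sum:
  fixes h :: "real \<Rightarrow> real"
  assumes n: "0 < n" and T: "0 \<le> T" and [measurable]: "h \<in> borel_measurable borel"
  shows "has_bochner_integral lborel
    (\<lambda>s. indicator ({0<..real (nat \<lfloor>real n * T\<rfloor>) / real n} \<inter> {0<..<T}) s * h (of_int \<lceil>real n * s\<rceil> / real n))
    ((\<Sum>k = 1..nat \<lfloor>real n * T\<rfloor>. h (real k / real n)) / real n)"
proof -
  define N where "N = nat \<lfloor>real n * T\<rfloor>"
  have NT: "real N / real n \<le> T"
    using n T by (simp add: N_def field_simps)
  let ?g = "\<lambda>s. \<Sum>k = 1..N. h (real k / real n) * indicator {(real k - 1) / real n<..real k / real n} s"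
  have A: "has_bochner_integral lborel ?g (\<Sum>k = 1..N. h (real k / real n) * (1 / real n))"
  proof (intro has_bochner_integral_sum has_bochner_integral_mult_right)
    fix k
    show "has_bochner_integral lborel (indicator {(real k - 1) / real n<..real k / real n}) (1 / real n)"
      using has_bochner_integral_real_indicator[of "{(real k - 1) / real n<..real k / real n}" lborel] n
      by (simp add: divide_right_mono diff_divide_distrib)
  qed
  have B: "AE s in lborel. ?g s = indicator ({0<..real N / real n} \<inter> {0<..<T}) s * h (of_int \<lceil>real n * s\<rceil> / real n)"
    using AE_lborel_singleton[of T]
  proof eventually_elim
    case (elim s)
    have ind: "indicator {(real k - 1) / real n<..real k / real n} s = (if int k = \<lceil>real n * s\<rceil> then 1 else 0 :: real)" for k
      using n by (auto simp: indicator_def field_simps ceiling_eq_iff eq_commute[of "int k"] split: if_splits)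
    show ?case
    proof (cases "0 < s \<and> s \<le> real N / real n")
      case True
      define k where "k = nat \<lceil>real n * s\<rceil>"
      have ns: "0 < real n * s" "real n * s \<le> real N" using True n by (auto simp: field_simps)
      have k: "int k = \<lceil>real n * s\<rceil>" using ns by (simp add: k_def)
      have "k \<in> {1..N}" using ns k by (simp add: k_def Suc_le_eq nat_le_iff ceiling_le_iff)
      have "?g s = (\<Sum>j = 1..N. if j = k then h (real k / real n) else 0)"
        unfolding ind k[symmetric] by (intro sum.cong) auto
      also have "\<dots> = h (of_int \<lceil>real n * s\<rceil> / real n)" using \<open>k \<in> {1..N}\<close> k by (simp flip: k)
      finally show ?thesis using True NT elim by simp
    next
      case False
      have "indicator {(real k - 1) / real n<..real k / real n} s = (0::real)" if k: "k \<in> {1..N}" for k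
      proof -
        have "0 \<le> (real k - 1) / real n" "real k / real n \<le> real N / real n" using k by (auto intro: divide_right_mono)
        then show ?thesis using False by (auto simp: indicator_def)
      qed
      then show ?thesis using False by simp
    qed
  qed
  have "has_bochner_integral lborel (\<lambda>s. indicator ({0<..real N / real n} \<inter> {0<..<T}) s * h (of_int \<lceil>real n * s\<rceil> / real n))
    (\<Sum>k = 1..N. h (real k / real n) * (1 / real n))"
    by (rule iffD1[OF has_bochner_integral_cong_AE[OF borel_measurable_has_bochner_integral[OF A] _ B] A]) measurable
  then show ?thesis by (simp add: N_def sum_divide_distrib)
qed

text \<open>The two pieces are indexed by \<open>bool\<close>: \<open>True\<close> is the Riemann
  sum of f at scale \<beta> n, sampled at rounded times, and \<open>False\<close> is - c times the
  occupation average with undiscretized time, where c = \<integral>f. Since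
  \<open>indicator {0..<1}\<close> has integral 1, the masses c and - c balance.\<close>

lemma (in rough_process) riemann_sum_approximates_occupation:
  fixes f :: "real \<Rightarrow> real" and \<beta> :: "nat \<Rightarrow> real" and x :: real
  assumes T: "0 \<le> T" and f [measurable]: "f \<in> borel_measurable borel" "integrable lborel f" "integrable lborel (\<lambda>y. (f y)\<^sup>2)"
    and \<beta>: "\<And>n. 0 < \<beta> n" "filterlim \<beta> at_top sequentially" "(\<lambda>n. \<beta> n / real n) \<longlonglongrightarrow> 0"
  defines "E \<equiv> \<lambda>n \<omega>. \<beta> n / real n * (\<Sum>k = 1..nat \<lfloor>real n * T\<rfloor>. f (\<beta> n * (X (real k / real n) \<omega> - x)))
     - (LINT y|lborel. f y) * (sqrt (real n) * (LINT s:{0..T}|lborel. indicator {x..<x + 1 / sqrt (real n)} (X s \<omega>)))"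
  shows "(\<lambda>n. LINT \<omega>|M. (E n \<omega>)\<^sup>2) \<longlonglongrightarrow> 0" and "\<And>n. 0 < n \<Longrightarrow> integrable M (\<lambda>\<omega>. (E n \<omega>)\<^sup>2)"
    and "\<And>n. E n \<in> borel_measurable M"
proof -
  define c where "c = (LINT y|lborel. f y)"
  define F where "F i = (if i then f else (\<lambda>y. - c * indicator {0..<1} y))" for i
  \<comment> \<open>At n = 0 the scale \<open>sqrt 0\<close> would not be positive, hence the
    default value 1.\<close>
  define b where "b i n = (if i then \<beta> n else if n = 0 then 1 else sqrt (real n))" for i n
  define N where "N n = nat \<lfloor>real n * T\<rfloor>" for n
  define w where "w i n = (if i then indicator ({0<..real (N n) / real n} \<inter> {0<..<T}) else indicator {0<..<T} :: real \<Rightarrow> real)" for i n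
  define \<sigma> where "\<sigma> i n s = (if i then of_int \<lceil>real n * s\<rceil> / real n else s)" for i n and s :: real
  have ind01: "has_bochner_integral lborel (indicator {0..<1::real} :: real \<Rightarrow> real) 1"
    using has_bochner_integral_real_indicator[of "{0..<1::real}" lborel] by simp
  interpret P: balanced_pieces M X \<alpha> H \<kappa> C UNIV F b w \<sigma> x T
  proof
    show "finite (UNIV :: bool set)" "0 \<le> T" using T by auto
    show "F i \<in> borel_measurable borel" for i by (cases i) (auto simp: F_def)
    show "integrable lborel (F i)" for i
      using ind01 f by (cases i) (auto simp: F_def has_bochner_integral_iff)
    show "integrable lborel (\<lambda>y. (F i y)\<^sup>2)" for i
    proof (cases i)
      case False
      have "(\<lambda>y. (- c * indicator {0..<1} y)\<^sup>2) = (\<lambda>y. c\<^sup>2 * indicator {0..<1::real} y)"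
        by (auto simp: indicator_def)
      then show ?thesis using ind01 False by (simp add: F_def has_bochner_integral_iff)
    qed (use f in \<open>simp add: F_def\<close>)
    show "0 < b i n" for i n using \<beta> by (simp add: b_def)
    have sq: "filterlim (\<lambda>n. sqrt (real n)) at_top sequentially"
      by (rule filterlim_compose[OF sqrt_at_top filterlim_real_sequentially])
    show "filterlim (b i) at_top sequentially" for i
    proof (cases i)
      case False
      show ?thesis
        by (rule filterlim_cong[THEN iffD1, OF refl refl _ sq])
          (use False in \<open>auto simp: b_def intro!: eventually_mono[OF eventually_gt_at_top[of 0]]\<close>)
    qed (use \<beta> in \<open>simp add: b_def[abs_def]\<close>)
    show "(\<lambda>n. b i n / real n) \<longlonglongrightarrow> 0" for i
    proof (cases i)
      case False
      have "(\<lambda>n. inverse (sqrt (real n))) \<longlonglongrightarrow> 0"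
        using tendsto_inverse_0_at_top[OF sq] .
      then show ?thesis
      proof (rule Lim_transform_eventually)
        show "\<forall>\<^sub>F n in sequentially. inverse (sqrt (real n)) = b i n / real n"
          using eventually_gt_at_top[of 0]
        proof eventually_elim
          case (elim n)
          have "sqrt (real n) * sqrt (real n) = real n" by simp
          then have "inverse (sqrt (real n)) = sqrt (real n) / real n"
            using elim by (simp add: field_simps)
          then show ?case using elim False by (simp add: b_def)
        qed
      qed
    qed (use \<beta> in \<open>simp add: b_def\<close>)
    show "w i n \<in> borel_measurable borel" for i n by (simp add: w_def)
    show "\<bar>w i n s\<bar> \<le> 1" for i n s by (simp add: w_def indicator_def)
    show "w i n s = 0" if "s \<notin> {0<..<T}" for i n s using that by (simp add: w_def)
    show "(\<lambda>n. w i n s) \<longlonglongrightarrow> 1" if s: "s \<in> {0<..<T}" for i s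
    proof (cases i)
      case True
      \<comment> \<open>Rounding n T down loses less than 1, so every s < T lies before the last
        sampling time \<open>N n / n\<close> once 1 / n < T - s.\<close>
      have "eventually (\<lambda>n. real n > 1 / (T - s)) sequentially"
        using filterlim_real_sequentially by (simp add: filterlim_at_top_dense)
      then have "eventually (\<lambda>n. w i n s = 1) sequentially"
        using eventually_gt_at_top[of 0]
      proof eventually_elim
        case (elim n)
        have "1 < real n * (T - s)" using elim(1) s by (simp add: field_simps)
        then have "real n * s \<le> real n * T - 1" by (simp add: algebra_simps)
        also have "\<dots> \<le> of_int \<lfloor>real n * T\<rfloor>" by linarith
        also have "\<dots> = real (N n)" using T by (simp add: N_def)
        finally show ?case using s elim(2) True by (simp add: w_def field_simps)
      qed
      then show ?thesis by (rule tendsto_eventually)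
    next
      case False
      then show ?thesis using s by (simp add: w_def)
    qed
    show "\<sigma> i n \<in> borel_measurable borel" for i n by (cases i) (auto simp: \<sigma>_def[abs_def])
    show "0 \<le> \<sigma> i n s" if "0 < s" for i n s
      using that by (auto simp: \<sigma>_def intro!: divide_nonneg_nonneg) (smt (verit) ceiling_le_zero le_of_int_ceiling mult_nonneg_nonneg of_nat_0_le_iff)
    show "s \<le> \<sigma> i n s \<and> \<sigma> i n s \<le> s + 1 / real n" if "0 < n" "0 < s" for i n s
    proof -
      have "real n * s \<le> of_int \<lceil>real n * s\<rceil>" "of_int \<lceil>real n * s\<rceil> \<le> real n * s + 1" by linarith+
      then show ?thesis using that by (auto simp: \<sigma>_def field_simps)
    qed
    show "(\<Sum>i\<in>UNIV. LINT y|lborel. F i y) = 0"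
      using ind01 by (simp add: UNIV_bool F_def c_def has_bochner_integral_iff)
  qed
  have D_eq: "(LINT s|lborel. P.D n s \<omega>) = E n \<omega>" if n: "0 < n" and \<omega>: "\<omega> \<in> space M" for n \<omega>
  proof -
    have [measurable]: "(\<lambda>s. X s \<omega>) \<in> borel_measurable borel" using \<omega> by measurable
    have 1: "has_bochner_integral lborel (\<lambda>s. w True n s * scaled (F True) (b True n) x (X (\<sigma> True n s) \<omega>))
       ((\<Sum>k = 1..N n. scaled f (\<beta> n) x (X (real k / real n) \<omega>)) / real n)"
      using has_bochner_integral_riemann_sum[OF n T, of "\<lambda>u. scaled f (\<beta> n) x (X u \<omega>)"]
      by (simp add: w_def F_def b_def \<sigma>_def N_def)
    let ?I = "{x..<x + 1 / sqrt (real n)}"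
    have scaled_ind: "scaled (F False) (b False n) x y = - c * sqrt (real n) * indicator ?I y" for y
      using n by (auto simp: scaled_def F_def b_def indicator_def field_simps split: if_splits)
    have int2: "integrable lborel (\<lambda>s. indicator {0<..<T} s * indicator ?I (X s \<omega>) :: real)"
      by (rule Bochner_Integration.integrable_bound[OF integrable_indicator_Ioo[of 0 T]])
        (auto intro!: AE_I2 simp: indicator_def)
    have val2: "(LINT s|lborel. indicator {0<..<T} s * indicator ?I (X s \<omega>)) = (LINT s:{0..T}|lborel. indicator ?I (X s \<omega>) :: real)"
      unfolding set_lebesgue_integral_def real_scaleR_def
    proof (rule integral_cong_AE)
      have "AE v in lborel. v \<noteq> 0 \<and> v \<noteq> T"
        using AE_lborel_singleton[of 0] AE_lborel_singleton[of T] by eventually_elim auto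
      then show "AE s in lborel. indicator {0<..<T} s * indicator ?I (X s \<omega>) = (indicator {0..T} s * indicator ?I (X s \<omega>) :: real)"
        by eventually_elim (auto simp: indicator_def)
    qed measurable
    have 2: "has_bochner_integral lborel (\<lambda>s. w False n s * scaled (F False) (b False n) x (X (\<sigma> False n s) \<omega>))
       (- c * sqrt (real n) * (LINT s:{0..T}|lborel. indicator ?I (X s \<omega>)))"
    proof -
      have "has_bochner_integral lborel (\<lambda>s. - c * sqrt (real n) * (indicator {0<..<T} s * indicator ?I (X s \<omega>)))
        (- c * sqrt (real n) * (LINT s:{0..T}|lborel. indicator ?I (X s \<omega>)))"
        using int2 val2 by (intro has_bochner_integral_mult_right) (simp add: has_bochner_integral_iff)
      then show ?thesis unfolding scaled_ind by (simp add: w_def \<sigma>_def mult_ac)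
    qed
    have D_sum: "P.D n s \<omega> = w True n s * scaled (F True) (b True n) x (X (\<sigma> True n s) \<omega>)
        + w False n s * scaled (F False) (b False n) x (X (\<sigma> False n s) \<omega>)" for s
      by (subst P.D_def) (simp add: UNIV_bool add.commute)
    have "has_bochner_integral lborel (\<lambda>s. P.D n s \<omega>) ((\<Sum>k = 1..N n. scaled f (\<beta> n) x (X (real k / real n) \<omega>)) / real n
        + - c * sqrt (real n) * (LINT s:{0..T}|lborel. indicator ?I (X s \<omega>)))"
      unfolding D_sum by (rule has_bochner_integral_add[OF 1 2])
    then have "(LINT s|lborel. P.D n s \<omega>) = (\<Sum>k = 1..N n. scaled f (\<beta> n) x (X (real k / real n) \<omega>)) / real n
        + - c * sqrt (real n) * (LINT s:{0..T}|lborel. indicator ?I (X s \<omega>))"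
      by (simp add: has_bochner_integral_iff)
    then show ?thesis
      by (simp add: E_def c_def N_def scaled_def sum_distrib_left sum_divide_distrib)
  qed
  then have sq_eq: "(LINT \<omega>|M. (LINT s|lborel. P.D n s \<omega>)\<^sup>2) = (LINT \<omega>|M. (E n \<omega>)\<^sup>2)"
    "integrable M (\<lambda>\<omega>. (LINT s|lborel. P.D n s \<omega>)\<^sup>2) = integrable M (\<lambda>\<omega>. (E n \<omega>)\<^sup>2)" if "0 < n" for n
    using that by (auto intro!: Bochner_Integration.integral_cong Bochner_Integration.integrable_cong)
  show "(\<lambda>n. LINT \<omega>|M. (E n \<omega>)\<^sup>2) \<longlonglongrightarrow> 0"
    by (rule Lim_transform_eventually[OF P.integral_D_L2_tendsto])
      (use sq_eq in \<open>auto intro!: eventually_mono[OF eventually_gt_at_top[of 0]]\<close>)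
  show "integrable M (\<lambda>\<omega>. (E n \<omega>)\<^sup>2)" if "0 < n" for n
    using P.integral_D_square(1)[OF that] sq_eq(2)[OF that] by simp
  show "E n \<in> borel_measurable M" for n
    unfolding E_def set_lebesgue_integral_def by measurable
qed

text \<open>The bound at one time makes the law of \<open>X s\<close> absolutely continuous for s >
  0. Hence changing a test function on a Lebesgue null set changes its value along the process only
  on a null event.\<close>

lemma (in rough_process) AE_scaled_X:
  assumes P: "AE y in lborel. P y" and s: "0 < s" and b: "0 < b"
  shows "AE \<omega> in M. P (b * (X s \<omega> - x))"
proof -
  obtain N where N: "N \<in> null_sets lborel" "\<And>y. y \<notin> N \<Longrightarrow> P y"
    using AE_E3[OF P] by auto
  have [measurable]: "N \<in> sets borel" using N(1) by auto
  have "(\<integral>\<^sup>+ y. indicator N (b * (y - x)) \<partial>lborel) = ennreal (1 / b) * (\<integral>\<^sup>+ y. indicator N y \<partial>lborel)"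
    using b by (subst nn_integral_real_affine[where c = "1 / b" and t = x]) auto
  also have "\<dots> = 0" using N(1) by (simp add: null_sets_def)
  finally have "(\<integral>\<^sup>+ \<omega>. indicator N (b * (X s \<omega> - x)) \<partial>M) = 0"
    using nn_integral_single_le[OF s, of "\<lambda>y. indicator N (b * (y - x))"] by simp
  then have "AE \<omega> in M. indicator N (b * (X s \<omega> - x)) = (0::ennreal)"
    by (subst (asm) nn_integral_0_iff_AE) auto
  then show ?thesis by eventually_elim (use N(2) in \<open>auto simp: indicator_def split: if_splits\<close>)
qed

section \<open>Mean-square convergence and the completed probability space\<close>

lemma square_sum_le: "(y + z)\<^sup>2 \<le> 2 * y\<^sup>2 + 2 * z\<^sup>2" for y z :: real
  using zero_le_power2[of "y - z"] by (simp add: power2_eq_square algebra_simps)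

lemma L2_rv_lincomb:
  assumes "L2_rv M X" "L2_rv M Y"
  shows "L2_rv M (\<lambda>\<omega>. a * X \<omega> + c * Y \<omega>)"
proof -
  have [measurable]: "X \<in> borel_measurable M" "Y \<in> borel_measurable M" using assms by (auto simp: L2_rv_def)
  have "integrable M (\<lambda>\<omega>. (a * X \<omega> + c * Y \<omega>)\<^sup>2)"
  proof (rule Bochner_Integration.integrable_bound)
    show "integrable M (\<lambda>\<omega>. 2 * a\<^sup>2 * (X \<omega>)\<^sup>2 + 2 * c\<^sup>2 * (Y \<omega>)\<^sup>2)"
      using assms by (auto simp: L2_rv_def)
    show "AE \<omega> in M. norm ((a * X \<omega> + c * Y \<omega>)\<^sup>2) \<le> norm (2 * a\<^sup>2 * (X \<omega>)\<^sup>2 + 2 * c\<^sup>2 * (Y \<omega>)\<^sup>2)"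
    proof (rule AE_I2)
      fix \<omega>
      show "norm ((a * X \<omega> + c * Y \<omega>)\<^sup>2) \<le> norm (2 * a\<^sup>2 * (X \<omega>)\<^sup>2 + 2 * c\<^sup>2 * (Y \<omega>)\<^sup>2)"
        using square_sum_le[of "a * X \<omega>" "c * Y \<omega>"] by (simp add: power_mult_distrib)
    qed
  qed measurable
  then show ?thesis by (simp add: L2_rv_def)
qed

lemma L2_tendsto_compose:
  assumes "L2_tendsto M X Y F" "filterlim g F G"
  shows "L2_tendsto M (\<lambda>i. X (g i)) Y G"
  using assms eventually_compose_filterlim[of _ F g G] filterlim_compose[of _ _ F g G]
  unfolding L2_tendsto_def by blast

lemma L2_tendsto_cmult_close:
  assumes A: "L2_tendsto M A Y F"
    and E: "\<forall>\<^sub>F i in F. L2_rv M (\<lambda>\<omega>. S i \<omega> - c * A i \<omega>)"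
    and lim: "((\<lambda>i. LINT \<omega>|M. (S i \<omega> - c * A i \<omega>)\<^sup>2) \<longlongrightarrow> 0) F"
  shows "L2_tendsto M S (\<lambda>\<omega>. c * Y \<omega>) F"
proof -
  let ?E = "\<lambda>i. LINT \<omega>|M. (S i \<omega> - c * A i \<omega>)\<^sup>2"
  let ?A = "\<lambda>i. LINT \<omega>|M. (A i \<omega> - Y \<omega>)\<^sup>2"
  have Y: "L2_rv M Y" and Ai: "\<forall>\<^sub>F i in F. L2_rv M (A i)"
    and A_lim: "(?A \<longlongrightarrow> 0) F"
    using A by (auto simp: L2_tendsto_def)
  have cY: "L2_rv M (\<lambda>\<omega>. c * Y \<omega>)" using L2_rv_lincomb[OF Y Y, of c 0] by simp
  have ev: "\<forall>\<^sub>F i in F. L2_rv M (S i) \<and> (LINT \<omega>|M. (S i \<omega> - c * Y \<omega>)\<^sup>2)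
     \<le> 2 * ?E i + 2 * c\<^sup>2 * ?A i"
    using E Ai
  proof eventually_elim
    case (elim i)
    have S: "L2_rv M (S i)" using L2_rv_lincomb[OF elim, of 1 c] by simp
    have AY: "L2_rv M (\<lambda>\<omega>. A i \<omega> - Y \<omega>)" using L2_rv_lincomb[OF elim(2) Y, of 1 "-1"] by simp
    have SY: "L2_rv M (\<lambda>\<omega>. S i \<omega> - c * Y \<omega>)" using L2_rv_lincomb[OF S Y, of 1 "- c"] by simp
    have "(LINT \<omega>|M. (S i \<omega> - c * Y \<omega>)\<^sup>2) \<le> (LINT \<omega>|M. 2 * (S i \<omega> - c * A i \<omega>)\<^sup>2 + 2 * c\<^sup>2 * (A i \<omega> - Y \<omega>)\<^sup>2)"
    proof (rule integral_mono)
      show "integrable M (\<lambda>\<omega>. (S i \<omega> - c * Y \<omega>)\<^sup>2)" using SY by (simp add: L2_rv_def)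
      show "integrable M (\<lambda>\<omega>. 2 * (S i \<omega> - c * A i \<omega>)\<^sup>2 + 2 * c\<^sup>2 * (A i \<omega> - Y \<omega>)\<^sup>2)"
        using elim AY by (auto simp: L2_rv_def)
      show "(S i \<omega> - c * Y \<omega>)\<^sup>2 \<le> 2 * (S i \<omega> - c * A i \<omega>)\<^sup>2 + 2 * c\<^sup>2 * (A i \<omega> - Y \<omega>)\<^sup>2" for \<omega>
      proof -
        have "S i \<omega> - c * Y \<omega> = (S i \<omega> - c * A i \<omega>) + c * (A i \<omega> - Y \<omega>)"
          by (simp add: algebra_simps)
        then show ?thesis
          using square_sum_le[of "S i \<omega> - c * A i \<omega>" "c * (A i \<omega> - Y \<omega>)"]
          by (simp only: power_mult_distrib mult.assoc)
      qed
    qed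
    also have "\<dots> = 2 * ?E i + 2 * c\<^sup>2 * ?A i"
      using elim AY by (simp add: L2_rv_def)
    finally show ?case using S by simp
  qed
  have upper: "((\<lambda>i. 2 * ?E i + 2 * c\<^sup>2 * ?A i) \<longlongrightarrow> 0) F"
    using tendsto_add[OF tendsto_mult_left[OF lim, of 2] tendsto_mult_left[OF A_lim, of "2 * c\<^sup>2"]] by simp
  have "((\<lambda>i. LINT \<omega>|M. (S i \<omega> - c * Y \<omega>)\<^sup>2) \<longlongrightarrow> 0) F"
    by (rule tendsto_sandwich[OF _ _ tendsto_const upper]) (use ev in \<open>auto elim: eventually_mono\<close>)
  then show ?thesis
    using ev cY by (auto simp: L2_tendsto_def elim: eventually_mono)
qed

lemma borel_measurable_completion_AE:
  fixes X Y :: "'w \<Rightarrow> real"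
  assumes X: "X \<in> borel_measurable M" and eq: "AE \<omega> in M. X \<omega> = Y \<omega>"
  shows "Y \<in> borel_measurable (completion M)"
proof (rule measurableI)
  fix A :: "real set" assume A: "A \<in> sets borel"
  have X': "X \<in> borel_measurable (completion M)" using X by (rule measurable_completion)
  show "Y -` A \<inter> space (completion M) \<in> sets (completion M)"
  proof (rule completion.in_sets_AE)
    show "X -` A \<inter> space (completion M) \<in> sets (completion M)"
      using X' A by (rule measurable_sets)
    show "AE \<omega> in completion M. (\<omega> \<in> X -` A \<inter> space (completion M)) = (\<omega> \<in> Y -` A \<inter> space (completion M))"
      using AE_completion[OF eq] by eventually_elim auto
  qed auto
qed auto

text \<open>Serves to return from a Borel version of the test function to the original one: a
  Lebesgue measurable function of the process is almost surely equal to a measurable random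
  variable, but may itself be measurable for the completion only.\<close>

lemma L2_tendsto_completion:
  assumes X: "L2_tendsto M X Z F" and eq: "\<forall>\<^sub>F i in F. AE \<omega> in M. X i \<omega> = Y i \<omega>"
  shows "L2_tendsto (completion M) Y Z F"
proof -
  have Z: "L2_rv M Z" and Xi: "\<forall>\<^sub>F i in F. L2_rv M (X i)"
    and lim: "((\<lambda>i. LINT \<omega>|M. (X i \<omega> - Z \<omega>)\<^sup>2) \<longlongrightarrow> 0) F"
    using X by (auto simp: L2_tendsto_def)
  have Zm: "Z \<in> borel_measurable M" using Z by (simp add: L2_rv_def)
  have ev: "\<forall>\<^sub>F i in F. L2_rv (completion M) (Y i) \<and> (LINT \<omega>|M. (X i \<omega> - Z \<omega>)\<^sup>2) = (LINT \<omega>|completion M. (Y i \<omega> - Z \<omega>)\<^sup>2)"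
    using Xi eq
  proof eventually_elim
    case (elim i)
    have Xm [measurable]: "X i \<in> borel_measurable M" using elim by (simp add: L2_rv_def)
    note [measurable] = borel_measurable_completion_AE[OF Xm elim(2)] Zm
      measurable_completion[OF Xm] measurable_completion[OF Zm]
    have AE: "AE \<omega> in completion M. X i \<omega> = Y i \<omega>" by (rule AE_completion[OF elim(2)])
    have "integrable (completion M) (\<lambda>\<omega>. (X i \<omega>)\<^sup>2)"
      using elim(1) by (subst integrable_completion) (auto simp: L2_rv_def)
    then have "integrable (completion M) (\<lambda>\<omega>. (Y i \<omega>)\<^sup>2)"
      by (rule integrable_cong_AE_imp) (use AE in \<open>auto elim: eventually_mono\<close>)
    moreover have "(LINT \<omega>|completion M. (X i \<omega> - Z \<omega>)\<^sup>2) = (LINT \<omega>|completion M. (Y i \<omega> - Z \<omega>)\<^sup>2)"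
      by (rule integral_cong_AE) (use AE in \<open>auto elim: eventually_mono\<close>)
    moreover have "(LINT \<omega>|completion M. (X i \<omega> - Z \<omega>)\<^sup>2) = (LINT \<omega>|M. (X i \<omega> - Z \<omega>)\<^sup>2)"
      by (rule integral_completion) measurable
    ultimately show ?case by (simp add: L2_rv_def)
  qed
  have "L2_rv (completion M) Z"
    using Z Zm by (auto simp: L2_rv_def integrable_completion intro: measurable_completion)
  moreover have "((\<lambda>i. LINT \<omega>|completion M. (Y i \<omega> - Z \<omega>)\<^sup>2) \<longlongrightarrow> 0) F"
    by (rule Lim_transform_eventually[OF lim]) (use ev in \<open>auto elim: eventually_mono\<close>)
  ultimately show ?thesis
    using ev by (auto simp: L2_tendsto_def elim: eventually_mono)
qed

text \<open>The process is only given for nonnegative times; \<open>max 0\<close> extends it to all times.\<close>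

lemma lfsm_rough_process:
  assumes X: "lfsm M \<alpha> H X" and H: "0 < H" "H < 1"
  shows "\<exists>\<kappa> C. rough_process M (\<lambda>t. X (max 0 t)) \<alpha> H \<kappa> C"
proof -
  obtain \<kappa> C where kc: "0 < \<kappa>"
    and pair: "\<And>s r l m. 0 < s \<Longrightarrow> s < r \<Longrightarrow> norm (LINT \<omega>|M. iexp (l * X s \<omega> + m * X r \<omega>))
       \<le> exp (- \<kappa> * (s powr (\<alpha> * H) * \<bar>l + m\<bar> powr \<alpha> + (r - s) powr (\<alpha> * H) * \<bar>m\<bar> powr \<alpha>))"
    and incr: "\<And>s r l. 0 \<le> s \<Longrightarrow> s < r \<Longrightarrow> norm (1 - (LINT \<omega>|M. iexp (l * (X r \<omega> - X s \<omega>))))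
       \<le> C * \<bar>l\<bar> powr \<alpha> * (r - s) powr (\<alpha> * H)"
    using lfsm_char_bounds[OF X] by blast
  obtain b Z where Z: "stable_levy_motion M \<alpha> b Z" using X unfolding lfsm_def by blast
  interpret prob_space M using Z by (simp add: stable_levy_motion_def)
  have joint: "(\<lambda>(t, \<omega>). X t \<omega>) \<in> borel_measurable (restrict_space borel {0..} \<Otimes>\<^sub>M M)"
    using X by (simp add: lfsm_def)
  have "(\<lambda>p. (max 0 (fst p), snd p)) \<in> borel \<Otimes>\<^sub>M M \<rightarrow>\<^sub>M restrict_space borel {0::real..} \<Otimes>\<^sub>M M"
    by (intro measurable_Pair measurable_restrict_space2) auto
  from measurable_compose[OF this joint]
  have "(\<lambda>(t, \<omega>). X (max 0 t) \<omega>) \<in> borel_measurable (borel \<Otimes>\<^sub>M M)"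
    by (simp add: split_beta')
  then have "rough_process M (\<lambda>t. X (max 0 t)) \<alpha> H \<kappa> C"
    using Z H kc pair incr by unfold_locales (auto simp: stable_levy_motion_def)
  then show ?thesis by blast
qed

theorem theorem4:
  fixes M :: "'w measure"
    and \<Lambda> :: "real \<Rightarrow> 'w \<Rightarrow> real"
    and L :: "real \<Rightarrow> real \<Rightarrow> 'w \<Rightarrow> real"
    and \<alpha> H :: real
    and \<beta> :: "nat \<Rightarrow> real"
    and f :: "real \<Rightarrow> real"
    and t x :: real
  assumes "prob_space M"
    and "0 < \<alpha>" "\<alpha> \<le> 2" "0 < H" "H < 1"
    and "lfsm M \<alpha> H \<Lambda>"
    and "local_time M \<Lambda> L"
    and "filterlim \<beta> at_top sequentially"
    and "(\<lambda>n. \<beta> n / real n) \<longlonglongrightarrow> 0"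
    and "integrable lebesgue f"
    and "integrable lebesgue (\<lambda>y. (f y)\<^sup>2)"
    and "0 \<le> t"
  shows "L2_tendsto (completion M)
           (\<lambda>n \<omega>. \<beta> n / real n *
                  (\<Sum>k = 1..nat \<lfloor>real n * t\<rfloor>. f (\<beta> n * (\<Lambda> (real k / real n) \<omega> - x))))
           (\<lambda>\<omega>. (\<integral>y. f y \<partial>lebesgue) * L t x \<omega>)
           sequentially"
proof -
  obtain \<kappa> C where "rough_process M (\<lambda>t. \<Lambda> (max 0 t)) \<alpha> H \<kappa> C"
    using lfsm_rough_process[OF assms(6,4,5)] by blast
  then interpret rough_process M "\<lambda>t. \<Lambda> (max 0 t)" \<alpha> H \<kappa> C .
  \<comment> \<open>A Borel version of f. The limit theorem is applied to g, and absolute continuity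
    of the laws at positive times carries it back to f.\<close>
  obtain g where g [measurable]: "g \<in> borel_measurable lborel" and fg: "AE y in lborel. f y = g y"
    using completion_ex_borel_measurable_real[of f lborel] borel_measurable_integrable[OF assms(10)] by blast
  have g_leb: "g \<in> borel_measurable lebesgue" using g by (rule measurable_completion)
  have f_leb: "f \<in> borel_measurable lebesgue" using assms(10) by (rule borel_measurable_integrable)
  have fg': "AE y in lebesgue. f y = g y" using fg by (rule AE_completion)
  have "integrable lebesgue g"
    using assms(10) g_leb by (rule integrable_cong_AE_imp) (use fg' in \<open>auto elim: eventually_mono\<close>)
  then have g_int: "integrable lborel g" using g by (simp add: integrable_completion)
  have "integrable lebesgue (\<lambda>y. (g y)\<^sup>2)"
    using assms(11) by (rule integrable_cong_AE_imp) (use fg' g_leb in \<open>auto elim: eventually_mono\<close>)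
  then have g2_int: "integrable lborel (\<lambda>y. (g y)\<^sup>2)" using g by (subst (asm) integrable_completion) auto
  have "(LINT y|lebesgue. f y) = (LINT y|lebesgue. g y)"
    by (rule integral_cong_AE[OF f_leb g_leb fg'])
  then have int_eq: "(LINT y|lebesgue. f y) = (LINT y|lborel. g y)" using g by (simp add: integral_completion)
  \<comment> \<open>Positivity of the scales is required for all n, whereas \<beta> n may be
    nonpositive for finitely many n.\<close>
  define \<gamma> where "\<gamma> n = (if 0 < \<beta> n then \<beta> n else 1)" for n
  have \<beta>\<gamma>: "\<forall>\<^sub>F n in sequentially. \<beta> n = \<gamma> n"
    using assms(8) by (auto simp: filterlim_at_top_dense \<gamma>_def elim!: allE[of _ 0] eventually_mono)
  have \<gamma>: "0 < \<gamma> n" "filterlim \<gamma> at_top sequentially" "(\<lambda>n. \<gamma> n / real n) \<longlonglongrightarrow> 0" for n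
  proof -
    show "0 < \<gamma> n" by (simp add: \<gamma>_def)
    show "filterlim \<gamma> at_top sequentially"
      by (rule filterlim_cong[THEN iffD1, OF refl refl \<beta>\<gamma> assms(8)])
    show "(\<lambda>n. \<gamma> n / real n) \<longlonglongrightarrow> 0"
      by (rule Lim_transform_eventually[OF assms(9)]) (use \<beta>\<gamma> in \<open>auto elim: eventually_mono\<close>)
  qed
  define S where "S n \<omega> = \<gamma> n / real n * (\<Sum>k = 1..nat \<lfloor>real n * t\<rfloor>. g (\<gamma> n * (\<Lambda> (max 0 (real k / real n)) \<omega> - x)))" for n \<omega>
  define A where "A n \<omega> = sqrt (real n) * (LINT s:{0..t}|lborel. indicator {x..<x + 1 / sqrt (real n)} (\<Lambda> (max 0 s) \<omega>))" for n \<omega>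
  have g': "g \<in> borel_measurable borel" using g by simp
  note R = riemann_sum_approximates_occupation[where x = x, OF \<open>0 \<le> t\<close> g' g_int g2_int \<gamma>, folded S_def A_def]
  have "L2_tendsto M (\<lambda>\<eta> \<omega>. (1 / \<eta>) * (LINT s:{0..t}|lborel. indicator {x..<x + \<eta>} (\<Lambda> s \<omega>))) (L t x) (at_right 0)"
    using assms(7,12) by (simp add: local_time_def)
  moreover have \<eta>: "filterlim (\<lambda>n. 1 / sqrt (real n)) (at_right 0) sequentially"
  proof -
    have "filterlim (\<lambda>n. sqrt (real n)) at_top sequentially"
      by (rule filterlim_compose[OF sqrt_at_top filterlim_real_sequentially])
    then have "filterlim (\<lambda>n. inverse (sqrt (real n))) (at_right 0) sequentially"
      by (rule filterlim_compose[OF filterlim_inverse_at_right_top])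
    then show ?thesis by (simp add: inverse_eq_divide)
  qed
  ultimately have "L2_tendsto M (\<lambda>n \<omega>. (1 / (1 / sqrt (real n))) * (LINT s:{0..t}|lborel. indicator {x..<x + 1 / sqrt (real n)} (\<Lambda> s \<omega>))) (L t x) sequentially"
    by (rule L2_tendsto_compose)
  \<comment> \<open>On the range of integration the extension by \<open>max 0\<close> is the
    identity.\<close>
  moreover have "(LINT s:{0..t}|lborel. indicator {x..<x + 1 / sqrt (real n)} (\<Lambda> s \<omega>))
      = (LINT s:{0..t}|lborel. indicator {x..<x + 1 / sqrt (real n)} (\<Lambda> (max 0 s) \<omega>) :: real)" for n \<omega>
    by (rule set_lebesgue_integral_cong) auto
  ultimately have A: "L2_tendsto M A (L t x) sequentially"
    unfolding A_def by simp
  have "L2_tendsto M S (\<lambda>\<omega>. (LINT y|lborel. g y) * L t x \<omega>) sequentially"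
    by (rule L2_tendsto_cmult_close[OF A _ R(1)])
      (use R in \<open>auto simp: L2_rv_def intro!: eventually_mono[OF eventually_gt_at_top[of 0]]\<close>)
  then show ?thesis unfolding int_eq
  proof (rule L2_tendsto_completion)
    show "\<forall>\<^sub>F n in sequentially. AE \<omega> in M. S n \<omega> = \<beta> n / real n * (\<Sum>k = 1..nat \<lfloor>real n * t\<rfloor>. f (\<beta> n * (\<Lambda> (real k / real n) \<omega> - x)))"
      using \<beta>\<gamma> eventually_gt_at_top[of 0]
    proof eventually_elim
      case (elim n)
      \<comment> \<open>The sum starts at k = 1, so all sampling times are positive and have
        absolutely continuous laws; at time 0 the kernel vanishes and the process is
        degenerate.\<close>
      have "AE \<omega> in M. \<forall>k\<in>{1..nat \<lfloor>real n * t\<rfloor>}. f (\<gamma> n * (\<Lambda> (max 0 (real k / real n)) \<omega> - x)) = g (\<gamma> n * (\<Lambda> (max 0 (real k / real n)) \<omega> - x))"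
        using elim(2) \<gamma>(1) by (intro AE_finite_allI AE_scaled_X[OF fg]) auto
      then show ?case by eventually_elim (simp add: S_def elim(1))
    qed
  qed
qed

end
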